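(* Let $\mathbb{F}$ be a field in which field operations can be performed efficiently. There is a randomized algorithm that, given an integer $k$ and an arithmetic circuit $C$ of size $\mathrm{poly}(n)$ over $\mathbb{F}$ computing a polynomial $f\in\mathbb{F}[x_1,\dots,x_n]$, decides whether $f$ contains a degree-$k$ multilinear monomial with nonzero coefficient (the $k$-MMD problem), running in time $O^*(4.32^k)$ and using space polynomial in $n$ and $k$.
   Context: A monomial is multilinear if every variable has exponent at most $1$ in it. The notation $O^*(\cdot)$ suppresses factors polynomial in the input size ($n$ and $k$). A randomized algorithm here means one that answers correctly with probability at least a positive constant. *)

theory Defs
  imports
    "HOL-Probability.Probability"
    "HOL-Library.Poly_Mapping"
    "HOL-Library.Stream"
    "HOL-Library.Log_Nat"
    "HOL-Computational_Algebra.Polynomial"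
begin

section \<open>Multivariate polynomials and multilinear monomials\<close>

text \<open>
  A monomial is its exponent vector; variables are numbered from 0, so that
  the polynomials in n variables are those in which only indices below n occur.
  Multiplication of the type \<open>'f mpoly\<close> is the convolution product of
  \<^theory>\<open>HOL-Library.Poly_Mapping\<close>.
\<close>

type_synonym monomial = "nat \<Rightarrow>\<^sub>0 nat"
type_synonym 'f mpoly = "monomial \<Rightarrow>\<^sub>0 'f"

definition mvar :: "nat \<Rightarrow> 'f::field mpoly" where
  "mvar i = Poly_Mapping.single (Poly_Mapping.single i 1) 1"

definition mconst :: "'f::field \<Rightarrow> 'f mpoly" where
  "mconst c = Poly_Mapping.single 0 c"

definition monomial_degree :: "monomial \<Rightarrow> nat" where
  "monomial_degree m = (\<Sum>i\<in>Poly_Mapping.keys m. Poly_Mapping.lookup m i)"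

definition multilinear :: "monomial \<Rightarrow> bool" where
  "multilinear m \<longleftrightarrow> (\<forall>i. Poly_Mapping.lookup m i \<le> 1)"

definition has_multilinear_monomial :: "nat \<Rightarrow> 'f::field mpoly \<Rightarrow> bool" where
  "has_multilinear_monomial k f \<longleftrightarrow>
     (\<exists>m. multilinear m \<and> monomial_degree m = k \<and> Poly_Mapping.lookup f m \<noteq> 0)"

section \<open>Arithmetic circuits\<close>

text \<open>
  A circuit is a directed acyclic graph with gates of fan-in two, given in
  topological order: the arguments of an inner gate are positions of earlier
  gates, any gate may be used arbitrarily often, and the last gate is the output.
\<close>

datatype 'f gate = Var nat | Const 'f | Add nat nat | Mul nat nat

type_synonym 'f circuit = "'f gate list"

fun wf_gate :: "nat \<Rightarrow> nat \<Rightarrow> 'f gate \<Rightarrow> bool" where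
  "wf_gate n j (Var i) \<longleftrightarrow> i < n"
| "wf_gate n j (Const c) \<longleftrightarrow> True"
| "wf_gate n j (Add a b) \<longleftrightarrow> a < j \<and> b < j"
| "wf_gate n j (Mul a b) \<longleftrightarrow> a < j \<and> b < j"

definition wf_circuit :: "nat \<Rightarrow> 'f circuit \<Rightarrow> bool" where
  "wf_circuit n C \<longleftrightarrow> C \<noteq> [] \<and> (\<forall>j<length C. wf_gate n j (C ! j))"

fun gate_poly :: "'f::field mpoly list \<Rightarrow> 'f gate \<Rightarrow> 'f mpoly" where
  "gate_poly fs (Var i) = mvar i"
| "gate_poly fs (Const c) = mconst c"
| "gate_poly fs (Add a b) = fs ! a + fs ! b"
| "gate_poly fs (Mul a b) = fs ! a * fs ! b"

definition gate_polys :: "'f::field circuit \<Rightarrow> 'f mpoly list" where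
  "gate_polys C = foldl (\<lambda>fs g. fs @ [gate_poly fs g]) [] C"

definition circuit_poly :: "'f::field circuit \<Rightarrow> 'f mpoly" where
  "circuit_poly C = last (gate_polys C)"

abbreviation circuit_size :: "'f circuit \<Rightarrow> nat" where
  "circuit_size C \<equiv> length C"

section \<open>The machine model\<close>

text \<open>
  Algorithms are programs of a structured random access machine. It has a memory of
  natural numbers, a memory of field elements and a source of random bits.
  Operations on natural numbers are charged logarithmic cost: every value that is
  computed, read or used as an address costs its number of bits plus one.
  The field is a black box: a program can add, subtract, multiply, divide
  and test for zero, and can access the constants 0 and 1 and the constants of
  its input. The parameter \<open>ot\<close> is the time of one field operation (or of moving
  one field element), and \<open>eb\<close> the number of bits occupied by one field element.
  As programs are finite syntax trees, independent of the input, the model is uniform.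
\<close>

datatype iexp =
    INum nat
  | IMem iexp
  | IPlus iexp iexp
  | IMinus iexp iexp
  | ITimes iexp iexp
  | IDiv iexp iexp

datatype fexp =
    FZero
  | FOne
  | FMem iexp
  | FPlus fexp fexp
  | FMinus fexp fexp
  | FTimes fexp fexp
  | FDivide fexp fexp

datatype bexp =
    Less iexp iexp
  | IsZero fexp
  | Not bexp
  | And bexp bexp

datatype com =
    Skip
  | IStore iexp iexp
  | FStore iexp fexp
  | Flip iexp
  | Seq com com
  | If bexp com com
  | While bexp com

record 'f state =
  ints :: "nat \<Rightarrow> nat"
  flds :: "nat \<Rightarrow> 'f"
  coins :: "bool stream"

definition bits :: "nat \<Rightarrow> nat" where
  "bits v = 1 + floorlog 2 v"

primrec ival :: "iexp \<Rightarrow> 'f state \<Rightarrow> nat" where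
  "ival (INum v) s = v"
| "ival (IMem a) s = ints s (ival a s)"
| "ival (IPlus a b) s = ival a s + ival b s"
| "ival (IMinus a b) s = ival a s - ival b s"
| "ival (ITimes a b) s = ival a s * ival b s"
| "ival (IDiv a b) s = ival a s div ival b s"

primrec icost :: "iexp \<Rightarrow> 'f state \<Rightarrow> nat" where
  "icost (INum v) s = bits v"
| "icost (IMem a) s = icost a s + bits (ints s (ival a s))"
| "icost (IPlus a b) s = icost a s + icost b s + bits (ival a s + ival b s)"
| "icost (IMinus a b) s = icost a s + icost b s + bits (ival a s - ival b s)"
| "icost (ITimes a b) s = icost a s + icost b s + bits (ival a s * ival b s)"
| "icost (IDiv a b) s = icost a s + icost b s + bits (ival a s div ival b s)"

primrec fval :: "fexp \<Rightarrow> 'f::field state \<Rightarrow> 'f" where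
  "fval FZero s = 0"
| "fval FOne s = 1"
| "fval (FMem a) s = flds s (ival a s)"
| "fval (FPlus a b) s = fval a s + fval b s"
| "fval (FMinus a b) s = fval a s - fval b s"
| "fval (FTimes a b) s = fval a s * fval b s"
| "fval (FDivide a b) s = fval a s / fval b s"

primrec fcost :: "nat \<Rightarrow> fexp \<Rightarrow> 'f state \<Rightarrow> nat" where
  "fcost ot FZero s = 1 + ot"
| "fcost ot FOne s = 1 + ot"
| "fcost ot (FMem a) s = icost a s + 1 + ot"
| "fcost ot (FPlus a b) s = fcost ot a s + fcost ot b s + 1 + ot"
| "fcost ot (FMinus a b) s = fcost ot a s + fcost ot b s + 1 + ot"
| "fcost ot (FTimes a b) s = fcost ot a s + fcost ot b s + 1 + ot"
| "fcost ot (FDivide a b) s = fcost ot a s + fcost ot b s + 1 + ot"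

primrec bval :: "bexp \<Rightarrow> 'f::field state \<Rightarrow> bool" where
  "bval (Less a b) s \<longleftrightarrow> ival a s < ival b s"
| "bval (IsZero a) s \<longleftrightarrow> fval a s = 0"
| "bval (Not a) s \<longleftrightarrow> \<not> bval a s"
| "bval (And a b) s \<longleftrightarrow> bval a s \<and> bval b s"

primrec bcost :: "nat \<Rightarrow> bexp \<Rightarrow> 'f state \<Rightarrow> nat" where
  "bcost ot (Less a b) s = icost a s + icost b s + 1"
| "bcost ot (IsZero a) s = fcost ot a s + 1 + ot"
| "bcost ot (Not a) s = bcost ot a s + 1"
| "bcost ot (And a b) s = bcost ot a s + bcost ot b s + 1"

text \<open>
  The space occupied by a state: each nonzero memory cell is charged its address and
  its content. Cells containing 0 are free, since they carry no information beyond
  the list of the nonzero ones. In all reachable states both sums are finite.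
\<close>

definition state_space :: "nat \<Rightarrow> 'f::field state \<Rightarrow> nat" where
  "state_space eb s =
     (\<Sum>a | ints s a \<noteq> 0. bits a + bits (ints s a)) +
     (\<Sum>a | flds s a \<noteq> 0. bits a + eb)"

text \<open>
  \<open>exec ot eb c s t m s'\<close>: started in \<open>s\<close>, the program \<open>c\<close> halts in \<open>s'\<close> after time \<open>t\<close>,
  and \<open>m\<close> is the maximal space of a state visited on the way. Random bits are
  taken one by one from the stream \<open>coins s\<close>.
\<close>

inductive exec ::
  "nat \<Rightarrow> nat \<Rightarrow> com \<Rightarrow> 'f::field state \<Rightarrow> nat \<Rightarrow> nat \<Rightarrow> 'f state \<Rightarrow> bool"
  for ot eb :: nat
where
  Skip: "exec ot eb Skip s 1 (state_space eb s) s"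
| IStore: "s' = s\<lparr>ints := (ints s)(ival a s := ival e s)\<rparr> \<Longrightarrow>
    exec ot eb (IStore a e) s (icost a s + icost e s + 1)
      (max (state_space eb s) (state_space eb s')) s'"
| FStore: "s' = s\<lparr>flds := (flds s)(ival a s := fval e s)\<rparr> \<Longrightarrow>
    exec ot eb (FStore a e) s (icost a s + fcost ot e s + 1 + ot)
      (max (state_space eb s) (state_space eb s')) s'"
| Flip: "s' = s\<lparr>ints := (ints s)(ival a s := of_bool (shd (coins s))),
              coins := stl (coins s)\<rparr> \<Longrightarrow>
    exec ot eb (Flip a) s (icost a s + 1)
      (max (state_space eb s) (state_space eb s')) s'"
| Seq: "exec ot eb c1 s t1 m1 s1 \<Longrightarrow> exec ot eb c2 s1 t2 m2 s2 \<Longrightarrow>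
    exec ot eb (Seq c1 c2) s (t1 + t2 + 1) (max m1 m2) s2"
| IfTrue: "bval b s \<Longrightarrow> exec ot eb c1 s t m s' \<Longrightarrow>
    exec ot eb (If b c1 c2) s (bcost ot b s + t + 1) m s'"
| IfFalse: "\<not> bval b s \<Longrightarrow> exec ot eb c2 s t m s' \<Longrightarrow>
    exec ot eb (If b c1 c2) s (bcost ot b s + t + 1) m s'"
| WhileFalse: "\<not> bval b s \<Longrightarrow>
    exec ot eb (While b c) s (bcost ot b s + 1) (state_space eb s) s"
| WhileTrue: "bval b s \<Longrightarrow> exec ot eb c s t1 m1 s1 \<Longrightarrow>
    exec ot eb (While b c) s1 t2 m2 s2 \<Longrightarrow>
    exec ot eb (While b c) s (bcost ot b s + t1 + t2 + 1) (max m1 m2) s2"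

inductive_cases Skip_execE: "exec ot eb Skip s t m s'"
inductive_cases IStore_execE: "exec ot eb (IStore a e) s t m s'"
inductive_cases FStore_execE: "exec ot eb (FStore a e) s t m s'"
inductive_cases Flip_execE: "exec ot eb (Flip a) s t m s'"
inductive_cases Seq_execE: "exec ot eb (Seq c1 c2) s t m s'"
inductive_cases If_execE: "exec ot eb (If b c1 c2) s t m s'"
inductive_cases While_execE: "exec ot eb (While b c) s t m s'"

lemma exec_deterministic:
  assumes "exec ot eb c s t m s'" and "exec ot eb c s u n s''"
  shows "t = u \<and> m = n \<and> s' = s''"
  using assms
proof (induction arbitrary: u n s'' rule: exec.induct)
  case Skip
  then show ?case by (auto elim: Skip_execE)
next
  case IStore
  then show ?case by (auto elim: IStore_execE)
next
  case FStore
  then show ?case by (auto elim: FStore_execE)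
next
  case Flip
  then show ?case by (auto elim: Flip_execE)
next
  case (Seq c1 s t1 m1 s1 c2 t2 m2 s2)
  from Seq.prems obtain t1' m1' s1' t2' m2' where
    1: "exec ot eb c1 s t1' m1' s1'" and 2: "exec ot eb c2 s1' t2' m2' s''"
    and eq: "u = Suc (t1' + t2')" "n = max m1' m2'"
    by (rule Seq_execE) (rule that; assumption)
  from Seq.IH(1)[OF 1] have "t1 = t1'" "m1 = m1'" "s1 = s1'" by simp_all
  moreover from this 2 have "t2 = t2' \<and> m2 = m2' \<and> s2 = s''" by (intro Seq.IH(2)) simp
  ultimately show ?case using eq by simp
next
  case (IfTrue b s c1 t m s' c2)
  from IfTrue.prems obtain t' where
    "exec ot eb c1 s t' n s''" "u = Suc (bcost ot b s + t')"
    by (rule If_execE) ((rule that; assumption) | (use IfTrue.hyps in simp))+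
  with IfTrue.IH[of t' n s''] show ?case by simp
next
  case (IfFalse b s c2 t m s' c1)
  from IfFalse.prems obtain t' where
    "exec ot eb c2 s t' n s''" "u = Suc (bcost ot b s + t')"
    by (rule If_execE) ((rule that; assumption) | (use IfFalse.hyps in simp))+
  with IfFalse.IH[of t' n s''] show ?case by simp
next
  case (WhileFalse b s c)
  from WhileFalse.prems show ?case
    by (rule While_execE) (use WhileFalse.hyps in simp_all)
next
  case (WhileTrue b s c t1 m1 s1 t2 m2 s2)
  from WhileTrue.prems obtain t1' m1' s1' t2' m2' where
    1: "exec ot eb c s t1' m1' s1'" and 2: "exec ot eb (While b c) s1' t2' m2' s''"
    and eq: "u = Suc (bcost ot b s + t1' + t2')" "n = max m1' m2'"
    by (rule While_execE) ((rule that; assumption) | (use WhileTrue.hyps in simp))+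
  from WhileTrue.IH(1)[OF 1] have "t1 = t1'" "m1 = m1'" "s1 = s1'" by simp_all
  moreover from this 2 have "t2 = t2' \<and> m2 = m2' \<and> s2 = s''" by (intro WhileTrue.IH(2)) simp
  ultimately show ?case using eq by simp
qed

section \<open>Inputs, outputs and resource bounds\<close>

text \<open>
  Input format: the cells 0, 1, 2 of the integer memory contain n, k and the size of
  the circuit, and the cells 3 + 3j, 4 + 3j, 5 + 3j contain the code of gate number j.
  The scalar of a constant gate number j is cell j of the field memory.
  All other cells are 0.
\<close>

primrec gate_code :: "'f gate \<Rightarrow> nat list" where
  "gate_code (Var i) = [0, i, 0]"
| "gate_code (Const c) = [1, 0, 0]"
| "gate_code (Add a b) = [2, a, b]"
| "gate_code (Mul a b) = [3, a, b]"

primrec gate_scalar :: "'f::field gate \<Rightarrow> 'f" where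
  "gate_scalar (Var i) = 0"
| "gate_scalar (Const c) = c"
| "gate_scalar (Add a b) = 0"
| "gate_scalar (Mul a b) = 0"

definition input_ints :: "nat \<Rightarrow> nat \<Rightarrow> 'f circuit \<Rightarrow> nat list" where
  "input_ints n k C = [n, k, length C] @ concat (map gate_code C)"

definition input_state :: "nat \<Rightarrow> nat \<Rightarrow> 'f::field circuit \<Rightarrow> bool stream \<Rightarrow> 'f state" where
  "input_state n k C \<omega> =
     \<lparr>ints = (\<lambda>a. if a < length (input_ints n k C) then input_ints n k C ! a else 0),
      flds = (\<lambda>j. if j < length C then gate_scalar (C ! j) else 0),
      coins = \<omega>\<rparr>"

definition accepting :: "'f state \<Rightarrow> bool" where
  "accepting s \<longleftrightarrow> ints s 0 = 1"

text \<open>Infinite sequences of independent fair coin tosses.\<close>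

definition coin_space :: "bool stream measure" where
  "coin_space = stream_space (measure_pmf (bernoulli_pmf (1 / 2)))"

text \<open>
  \<open>ot N\<close> and \<open>eb N\<close> are the time of a field operation and the number of bits of a field
  element in computations on inputs of size \<open>N\<close>; field operations are efficient if these
  are bounded by polynomials.
\<close>

definition input_size :: "nat \<Rightarrow> nat \<Rightarrow> 'f circuit \<Rightarrow> nat" where
  "input_size n k C = n + k + circuit_size C"

definition polynomially_bounded :: "(nat \<Rightarrow> nat) \<Rightarrow> bool" where
  "polynomially_bounded h \<longleftrightarrow> (\<exists>p :: nat poly. \<forall>N. h N \<le> poly p N)"

definition run ::
  "(nat \<Rightarrow> nat) \<Rightarrow> (nat \<Rightarrow> nat) \<Rightarrow> com \<Rightarrow> nat \<Rightarrow> nat \<Rightarrow> 'f::field circuit \<Rightarrow>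
     bool stream \<Rightarrow> nat \<Rightarrow> nat \<Rightarrow> 'f state \<Rightarrow> bool"
where
  "run ot eb P n k C \<omega> t m s' \<longleftrightarrow>
     exec (ot (input_size n k C)) (eb (input_size n k C)) P (input_state n k C \<omega>) t m s'"

text \<open>The event that the program halts with the correct answer to the k-MMD problem.\<close>

definition answers_correctly ::
  "(nat \<Rightarrow> nat) \<Rightarrow> (nat \<Rightarrow> nat) \<Rightarrow> com \<Rightarrow> nat \<Rightarrow> nat \<Rightarrow> 'f::field circuit \<Rightarrow> bool stream set"
where
  "answers_correctly ot eb P n k C =
     {\<omega>. \<exists>t m s'. run ot eb P n k C \<omega> t m s' \<and>
        (accepting s' \<longleftrightarrow> has_multilinear_monomial k (circuit_poly C))}"

end

theory Submission
  imports Defs "HOL-Library.Nat_Bijection"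
begin

text \<open>
  Color the variables randomly with \<open>K = 4j\<close> colors, where \<open>j = k div 3 + 1\<close>, and call a
  monomial colorful if its variables have different colors. For a set \<open>S\<close> of colors let \<open>f\<^sub>S\<close> be
  \<open>f\<close> with the variables of the other colors set to 0. In
  \<open>\<Sum>S. (-1)^z * (z choose (K - k)) * f\<^sub>S\<close> with \<open>z = K - card S\<close>, every monomial with fewer than
  \<open>k\<close> colors cancels and every monomial with exactly \<open>k\<close> colors is multiplied by
  \<open>(-1)^(K - k)\<close>; so this works in every characteristic, and in degree \<open>k\<close> precisely the
  colorful multilinear monomials survive.

  A black box field need not offer enough elements for random evaluation points. Instead the
  i-th variable is replaced by \<open>u^(D + w i)\<close> with random weights \<open>w i < W\<close> and \<open>D = k * W + 1\<close>, and
  the circuit is evaluated modulo \<open>u^((k + 1) * D)\<close>. The part of degree \<open>k\<close> is then found in the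
  exponents from \<open>k * D\<close> to \<open>(k + 1) * D - 1\<close>, and by the isolation lemma some colorful
  monomial is, with probability at least 1/2, the only one of its weight.

  A fixed multilinear monomial is colorful with probability at least \<open>(4 / e^3)^j / (e * j)\<close>,
  up to a factor 1/2 because \<open>K\<close> does not divide the number of outcomes of the coin tosses.
  Hence about \<open>16 * j * (161 / 32)^j\<close> trials suffice since \<open>e^3 / 4 < 161 / 32\<close>, and the running time
  is polynomial times \<open>2^K * (161 / 32)^j = 80.5^j \<le> 4.32^(3 * j)\<close>.
\<close>


section \<open>Bounding the cost of machine operations\<close>

text \<open>Why four colors for three variables. With \<open>K = c * k\<close> colors a trial
  evaluates the circuit \<open>2 ^ K\<close> times, and a multilinear monomial of degree
  \<open>k\<close> is colorful with probability about \<open>1 / b ^ k\<close>, where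
  \<open>b = e * ((c - 1) / c) ^ (c - 1)\<close>. So the total is governed by
  \<open>2 ^ c * b\<close>. For \<open>c = 1\<close> this is \<open>2 * e\<close>, about 5.44. The
  minimum, about 4.312, lies near \<open>c = 1.302\<close>; the ratio 4/3 gives the cube root of
  \<open>4 * e ^ 3\<close>, about 4.315, and is simple enough for exact integer arithmetic.

  The space is polynomial because the sets of colors are visited one after another and only their
  weighted sum is kept. The counters reach exponential values but have polynomially many bits.

  The bounds on time and space must hold for every coin sequence. This is why the program is written
  with loops whose number of iterations is known on entry: termination is then automatic, and the
  running time follows from upper bounds on the variables.\<close>

primrec isz :: "iexp \<Rightarrow> nat" where
  "isz (INum v) = v + 1"
| "isz (IMem a) = isz a + 1"
| "isz (IPlus a b) = isz a + isz b + 1"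
| "isz (IMinus a b) = isz a + isz b + 1"
| "isz (ITimes a b) = isz a + isz b + 1"
| "isz (IDiv a b) = isz a + isz b + 1"

primrec fsz :: "fexp \<Rightarrow> nat" where
  "fsz FZero = 1"
| "fsz FOne = 1"
| "fsz (FMem a) = isz a + 1"
| "fsz (FPlus a b) = fsz a + fsz b + 1"
| "fsz (FMinus a b) = fsz a + fsz b + 1"
| "fsz (FTimes a b) = fsz a + fsz b + 1"
| "fsz (FDivide a b) = fsz a + fsz b + 1"

primrec bsz :: "bexp \<Rightarrow> nat" where
  "bsz (Less a b) = isz a + isz b + 1"
| "bsz (IsZero a) = fsz a + 1"
| "bsz (Not a) = bsz a + 1"
| "bsz (And a b) = bsz a + bsz b + 1"

primrec csz :: "com \<Rightarrow> nat" where
  "csz Skip = 1"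
| "csz (IStore a e) = isz a + isz e + 1"
| "csz (FStore a e) = isz a + fsz e + 1"
| "csz (Flip a) = isz a + 1"
| "csz (Seq c1 c2) = csz c1 + csz c2 + 1"
| "csz (If b c1 c2) = bsz b + csz c1 + csz c2 + 1"
| "csz (While b c) = bsz b + csz c + 1"

text \<open>The charge at one syntax node of a program of size \<kappa>: a value computed there has
  at most \<open>B * \<kappa>\<close> bits if the memory cells have at most \<open>B\<close>, and
  \<open>2 + ot\<close> covers the constant charges and a field operation.\<close>

definition unit_cost :: "nat \<Rightarrow> nat \<Rightarrow> nat \<Rightarrow> nat" where
  "unit_cost B ot \<kappa> = B * \<kappa> + 2 + ot"

lemma bits_le: "v < 2 ^ w \<Longrightarrow> bits v \<le> w + 1"
  unfolding bits_def using floorlog_leI[of v 2 w] by simp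

text \<open>An operation at most adds the bit lengths of its arguments, and a sum needs one bit
  more, which the node itself provides because \<open>B \<ge> 1\<close>. A numeral \<open>v\<close>
  has size \<open>v + 1\<close> in \<open>isz\<close> so that it obeys the same bound; such waste is
  harmless, as the program is fixed.\<close>

lemma ival_less:
  assumes B: "B \<ge> 1" and cells: "\<And>a. ints s a < 2 ^ B"
  shows "ival e s < 2 ^ (B * isz e)"
proof (induction e)
  case (INum v)
  have "v < 2 ^ v" by (rule less_exp)
  also have "(2::nat) ^ v \<le> 2 ^ (B * (v + 1))" using B by (intro power_increasing) (cases B; simp)+
  finally show ?case by simp
next
  case (IMem a)
  have "ints s (ival a s) < 2 ^ B" by (rule cells)
  also have "(2::nat) ^ B \<le> 2 ^ (B * (isz a + 1))" by (intro power_increasing) auto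
  finally show ?case by simp
next
  case (IPlus a b)
  let ?x = "(2::nat) ^ (B * isz a)" and ?y = "(2::nat) ^ (B * isz b)"
  have "ival a s + ival b s < ?x + ?y" using IPlus by linarith
  also have "\<dots> \<le> 2 * (?x * ?y)"
  proof -
    have "?x \<le> ?x * ?y" "?y \<le> ?x * ?y" by simp_all
    then show ?thesis by linarith
  qed
  also have "\<dots> = 2 ^ (B * isz a + B * isz b + 1)" by (simp add: power_add)
  also have "\<dots> \<le> 2 ^ (B * (isz a + isz b + 1))"
    using B by (intro power_increasing) (auto simp: algebra_simps)
  finally show ?case by simp
next
  case (IMinus a b)
  have "ival a s - ival b s \<le> ival a s" by simp
  also have "\<dots> < 2 ^ (B * isz a)" by (rule IMinus)
  also have "(2::nat) ^ (B * isz a) \<le> 2 ^ (B * isz (IMinus a b))" by (intro power_increasing) (auto simp: algebra_simps)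
  finally show ?case by simp
next
  case (ITimes a b)
  have "ival a s * ival b s < 2 ^ (B * isz a) * 2 ^ (B * isz b)"
    using ITimes by (intro mult_strict_mono) auto
  also have "\<dots> = 2 ^ (B * isz a + B * isz b)" by (simp add: power_add)
  also have "\<dots> \<le> 2 ^ (B * (isz a + isz b + 1))" by (intro power_increasing) (auto simp: algebra_simps)
  finally show ?case by simp
next
  case (IDiv a b)
  have "ival a s div ival b s \<le> ival a s" by simp
  also have "\<dots> < 2 ^ (B * isz a)" by (rule IDiv)
  also have "(2::nat) ^ (B * isz a) \<le> 2 ^ (B * isz (IDiv a b))" by (intro power_increasing) (auto simp: algebra_simps)
  finally show ?case by simp
qed

context
  fixes B \<kappa> ot :: nat and s :: "'f::field state"
  assumes B: "B \<ge> 1" and cells: "\<And>a. ints s a < 2 ^ B"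
begin

lemma bits_ival_le:
  assumes "isz e \<le> \<kappa>"
  shows "bits (ival e s) \<le> unit_cost B ot \<kappa>"
proof -
  have "bits (ival e s) \<le> B * isz e + 1" using ival_less[OF B cells] by (rule bits_le)
  also have "\<dots> \<le> B * \<kappa> + 1" using assms by simp
  finally show ?thesis by (simp add: unit_cost_def)
qed

lemma icost_le: "isz e \<le> \<kappa> \<Longrightarrow> icost e s \<le> isz e * unit_cost B ot \<kappa>"
proof (induction e)
  case (INum v)
  then show ?case using bits_ival_le[OF INum] by (simp add: algebra_simps)
next
  case (IMem a)
  then show ?case using bits_ival_le[OF IMem.prems] by (simp add: algebra_simps)
next
  case (IPlus a b)
  then show ?case using bits_ival_le[OF IPlus.prems] by (simp add: algebra_simps)
next
  case (IMinus a b)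
  then show ?case using bits_ival_le[OF IMinus.prems] by (simp add: algebra_simps)
next
  case (ITimes a b)
  then show ?case using bits_ival_le[OF ITimes.prems] by (simp add: algebra_simps)
next
  case (IDiv a b)
  then show ?case using bits_ival_le[OF IDiv.prems] by (simp add: algebra_simps)
qed

lemma fcost_le: "fsz e \<le> \<kappa> \<Longrightarrow> fcost ot e s \<le> fsz e * unit_cost B ot \<kappa>"
proof (induction e)
  case (FMem a)
  then have "icost a s \<le> isz a * unit_cost B ot \<kappa>" by (intro icost_le) simp
  then show ?case by (simp add: unit_cost_def)
qed (simp_all add: unit_cost_def algebra_simps)

lemma bcost_le: "bsz b \<le> \<kappa> \<Longrightarrow> bcost ot b s \<le> bsz b * unit_cost B ot \<kappa>"
proof (induction b)
  case (Less a b)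
  then have "icost a s \<le> isz a * unit_cost B ot \<kappa>" "icost b s \<le> isz b * unit_cost B ot \<kappa>"
    by (intro icost_le; simp)+
  then show ?case by (simp add: unit_cost_def algebra_simps)
next
  case (IsZero a)
  then have "fcost ot a s \<le> fsz a * unit_cost B ot \<kappa>" by (intro fcost_le) simp
  then show ?case by (simp add: unit_cost_def)
qed (simp_all add: unit_cost_def algebra_simps)

lemma command_cost_le:
  "csz (IStore a e) \<le> \<kappa> \<Longrightarrow> icost a s + icost e s + 1 \<le> \<kappa> * unit_cost B ot \<kappa>"
  "csz (FStore a fe) \<le> \<kappa> \<Longrightarrow> icost a s + fcost ot fe s + 1 + ot \<le> \<kappa> * unit_cost B ot \<kappa>"
  "csz (Flip a) \<le> \<kappa> \<Longrightarrow> icost a s + 1 \<le> \<kappa> * unit_cost B ot \<kappa>"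
  "bsz b + 1 \<le> \<kappa> \<Longrightarrow> bcost ot b s + 1 \<le> \<kappa> * unit_cost B ot \<kappa>"
proof -
  let ?u = "unit_cost B ot \<kappa>"
  have *: "t \<le> \<kappa> * ?u" if "t \<le> z * ?u" "z \<le> \<kappa>" for t z
    using that by (meson le_trans mult_le_mono1)
  show "icost a s + icost e s + 1 \<le> \<kappa> * ?u" if "csz (IStore a e) \<le> \<kappa>"
    using that icost_le[of a] icost_le[of e]
    by (intro *[of _ "csz (IStore a e)"]) (auto simp: algebra_simps unit_cost_def)
  show "icost a s + fcost ot fe s + 1 + ot \<le> \<kappa> * ?u" if "csz (FStore a fe) \<le> \<kappa>"
    using that icost_le[of a] fcost_le[of fe]
    by (intro *[of _ "csz (FStore a fe)"]) (auto simp: algebra_simps unit_cost_def)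
  show "icost a s + 1 \<le> \<kappa> * ?u" if "csz (Flip a) \<le> \<kappa>"
    using that icost_le[of a] by (intro *[of _ "csz (Flip a)"]) (auto simp: algebra_simps unit_cost_def)
  show "bcost ot b s + 1 \<le> \<kappa> * ?u" if "bsz b + 1 \<le> \<kappa>"
    using that bcost_le[of b] by (intro *[of _ "bsz b + 1"]) (auto simp: algebra_simps unit_cost_def)
qed

end

section \<open>A language of bounded loops\<close>

text \<open>
  The integer memory is divided into the input in the cells below \<open>low\<close>, the variables
  \<open>vars 0, \<dots>, vars (nvars - 1)\<close> and an array \<open>arr\<close>. The boundary \<open>low\<close> is computed from the cell 2,
  which contains the size of the circuit and never changes.
\<close>

record 'f store =
  inputs :: "nat \<Rightarrow> nat"
  vars :: "nat \<Rightarrow> nat"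
  arr :: "nat \<Rightarrow> nat"
  fld :: "nat \<Rightarrow> 'f"
  toss :: "bool stream"

definition nvars :: nat where "nvars = 32"

definition low :: "'f store \<Rightarrow> nat" where "low \<sigma> = 3 * inputs \<sigma> 2 + 3"

definition conc :: "'f store \<Rightarrow> 'f state" where
  "conc \<sigma> = \<lparr>ints = (\<lambda>a. if a < low \<sigma> then inputs \<sigma> a
                      else if a < low \<sigma> + nvars then vars \<sigma> (a - low \<sigma>)
                      else arr \<sigma> (a - low \<sigma> - nvars)),
             flds = fld \<sigma>, coins = toss \<sigma>\<rparr>"

definition var_addr :: "nat \<Rightarrow> iexp" where
  "var_addr x = IPlus (INum (3 + x)) (ITimes (INum 3) (IMem (INum 2)))"

definition arr_addr :: "iexp \<Rightarrow> iexp" where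
  "arr_addr e = IPlus (IPlus (INum (3 + nvars)) (ITimes (INum 3) (IMem (INum 2)))) e"

definition Rd :: "nat \<Rightarrow> iexp" where "Rd x = IMem (var_addr x)"
definition RdA :: "iexp \<Rightarrow> iexp" where "RdA e = IMem (arr_addr e)"

datatype hcom =
    HSkip
  | HAssign nat iexp
  | HAStore iexp iexp
  | HFStore iexp fexp
  | HFlip nat
  | HSeq hcom hcom
  | HIf bexp hcom hcom
  | HFor nat nat hcom

primrec compile :: "hcom \<Rightarrow> com" where
  "compile HSkip = Skip"
| "compile (HAssign x e) = IStore (var_addr x) e"
| "compile (HAStore i e) = IStore (arr_addr i) e"
| "compile (HFStore i e) = FStore i e"
| "compile (HFlip x) = Flip (var_addr x)"
| "compile (HSeq c d) = Seq (compile c) (compile d)"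
| "compile (HIf b c d) = If b (compile c) (compile d)"
| "compile (HFor x y c) =
     Seq (IStore (var_addr x) (INum 0))
      (Seq (While (Less (Rd x) (Rd y))
             (Seq (compile c) (IStore (var_addr x) (IPlus (Rd x) (INum 1)))))
        (IStore (var_addr x) (INum 0)))"

definition setV :: "nat \<Rightarrow> nat \<Rightarrow> 'f store \<Rightarrow> 'f store" where
  "setV x v \<sigma> = \<sigma>\<lparr>vars := (vars \<sigma>)(x := v)\<rparr>"

definition setA :: "nat \<Rightarrow> nat \<Rightarrow> 'f store \<Rightarrow> 'f store" where
  "setA i v \<sigma> = \<sigma>\<lparr>arr := (arr \<sigma>)(i := v)\<rparr>"

definition setF :: "nat \<Rightarrow> 'f \<Rightarrow> 'f store \<Rightarrow> 'f store" where
  "setF i v \<sigma> = \<sigma>\<lparr>fld := (fld \<sigma>)(i := v)\<rparr>"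

lemma set_sel [simp]:
  "inputs (setV x v \<sigma>) = inputs \<sigma>" "vars (setV x v \<sigma>) = (vars \<sigma>)(x := v)" "arr (setV x v \<sigma>) = arr \<sigma>"
  "fld (setV x v \<sigma>) = fld \<sigma>" "toss (setV x v \<sigma>) = toss \<sigma>"
  "inputs (setA i v \<sigma>) = inputs \<sigma>" "vars (setA i v \<sigma>) = vars \<sigma>" "arr (setA i v \<sigma>) = (arr \<sigma>)(i := v)"
  "fld (setA i v \<sigma>) = fld \<sigma>" "toss (setA i v \<sigma>) = toss \<sigma>"
  "inputs (setF i u \<sigma>) = inputs \<sigma>" "vars (setF i u \<sigma>) = vars \<sigma>" "arr (setF i u \<sigma>) = arr \<sigma>"
  "fld (setF i u \<sigma>) = (fld \<sigma>)(i := u)" "toss (setF i u \<sigma>) = toss \<sigma>"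
  "low (setV x v \<sigma>) = low \<sigma>" "low (setA i v \<sigma>) = low \<sigma>" "low (setF i u \<sigma>) = low \<sigma>"
  "low (\<sigma>\<lparr>toss := w\<rparr>) = low \<sigma>"
  by (simp_all add: setV_def setA_def setF_def low_def)

primrec iter :: "(nat \<Rightarrow> 'a \<Rightarrow> 'a) \<Rightarrow> nat \<Rightarrow> 'a \<Rightarrow> 'a" where
  "iter f 0 \<sigma> = \<sigma>"
| "iter f (Suc j) \<sigma> = f j (iter f j \<sigma>)"

primrec sem :: "hcom \<Rightarrow> 'f::field store \<Rightarrow> 'f store" where
  "sem HSkip \<sigma> = \<sigma>"
| "sem (HAssign x e) \<sigma> = setV x (ival e (conc \<sigma>)) \<sigma>"
| "sem (HAStore i e) \<sigma> = setA (ival i (conc \<sigma>)) (ival e (conc \<sigma>)) \<sigma>"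
| "sem (HFStore i e) \<sigma> = setF (ival i (conc \<sigma>)) (fval e (conc \<sigma>)) \<sigma>"
| "sem (HFlip x) \<sigma> = (setV x (of_bool (shd (toss \<sigma>))) \<sigma>)\<lparr>toss := stl (toss \<sigma>)\<rparr>"
| "sem (HSeq c d) \<sigma> = sem d (sem c \<sigma>)"
| "sem (HIf b c d) \<sigma> = (if bval b (conc \<sigma>) then sem c \<sigma> else sem d \<sigma>)"
| "sem (HFor x y c) \<sigma> = setV x 0 (iter (\<lambda>j \<tau>. sem c (setV x j \<tau>)) (vars \<sigma> y) \<sigma>)"

primrec mods :: "hcom \<Rightarrow> nat set" where
  "mods HSkip = {}"
| "mods (HAssign x e) = {x}"
| "mods (HAStore i e) = {}"
| "mods (HFStore i e) = {}"
| "mods (HFlip x) = {x}"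
| "mods (HSeq c d) = mods c \<union> mods d"
| "mods (HIf b c d) = mods c \<union> mods d"
| "mods (HFor x y c) = insert x (mods c)"

fun writesA :: "hcom \<Rightarrow> bool" where
  "writesA (HAStore i e) \<longleftrightarrow> True"
| "writesA (HSeq c d) \<longleftrightarrow> writesA c \<or> writesA d"
| "writesA (HIf b c d) \<longleftrightarrow> writesA c \<or> writesA d"
| "writesA (HFor x y c) \<longleftrightarrow> writesA c"
| "writesA _ \<longleftrightarrow> False"

fun writesF :: "hcom \<Rightarrow> bool" where
  "writesF (HFStore i e) \<longleftrightarrow> True"
| "writesF (HSeq c d) \<longleftrightarrow> writesF c \<or> writesF d"
| "writesF (HIf b c d) \<longleftrightarrow> writesF c \<or> writesF d"
| "writesF (HFor x y c) \<longleftrightarrow> writesF c"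
| "writesF _ \<longleftrightarrow> False"

fun flips :: "hcom \<Rightarrow> bool" where
  "flips (HFlip x) \<longleftrightarrow> True"
| "flips (HSeq c d) \<longleftrightarrow> flips c \<or> flips d"
| "flips (HIf b c d) \<longleftrightarrow> flips c \<or> flips d"
| "flips (HFor x y c) \<longleftrightarrow> flips c"
| "flips _ \<longleftrightarrow> False"

text \<open>A loop body may change neither the counter nor the bound. So the number of iterations is
  fixed on entry, and setting the counter before each iteration, as \<open>sem\<close> does, agrees
  with incrementing it afterwards, as the compiled loop does.\<close>

primrec wf_hcom :: "hcom \<Rightarrow> bool" where
  "wf_hcom HSkip \<longleftrightarrow> True"
| "wf_hcom (HAssign x e) \<longleftrightarrow> x < nvars"
| "wf_hcom (HAStore i e) \<longleftrightarrow> True"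
| "wf_hcom (HFStore i e) \<longleftrightarrow> True"
| "wf_hcom (HFlip x) \<longleftrightarrow> x < nvars"
| "wf_hcom (HSeq c d) \<longleftrightarrow> wf_hcom c \<and> wf_hcom d"
| "wf_hcom (HIf b c d) \<longleftrightarrow> wf_hcom c \<and> wf_hcom d"
| "wf_hcom (HFor x y c) \<longleftrightarrow>
     x < nvars \<and> y < nvars \<and> x \<noteq> y \<and> x \<notin> mods c \<and> y \<notin> mods c \<and> wf_hcom c"

text \<open>A frame condition read off from the syntax: whatever a program contains no command to
  write is preserved.\<close>

definition agree :: "hcom \<Rightarrow> 'f store \<Rightarrow> 'f store \<Rightarrow> bool" where
  "agree c \<sigma> \<tau> \<longleftrightarrow> inputs \<tau> = inputs \<sigma> \<and> (\<forall>x. x \<notin> mods c \<longrightarrow> vars \<tau> x = vars \<sigma> x) \<and>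
     (\<not> writesA c \<longrightarrow> arr \<tau> = arr \<sigma>) \<and> (\<not> writesF c \<longrightarrow> fld \<tau> = fld \<sigma>) \<and> (\<not> flips c \<longrightarrow> toss \<tau> = toss \<sigma>)"

lemma agree_refl [simp]: "agree c \<sigma> \<sigma>"
  by (simp add: agree_def)

lemma agree_trans: "agree c \<sigma> \<tau> \<Longrightarrow> agree c \<tau> \<upsilon> \<Longrightarrow> agree c \<sigma> \<upsilon>"
  unfolding agree_def by (metis (no_types))

lemma agree_ForI: "agree c (setV x j \<sigma>) \<tau> \<Longrightarrow> agree (HFor x y c) \<sigma> \<tau>"
  by (simp add: agree_def)

lemma agree_For_iter:
  fixes c :: hcom and \<sigma> :: "'f::field store"
  assumes "\<And>\<tau> :: 'f store. agree c \<tau> (sem c \<tau>)"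
  shows "agree (HFor x y c) \<sigma> (iter (\<lambda>j \<tau>. sem c (setV x j \<tau>)) m \<sigma>)"
proof (induction m)
  case (Suc m)
  show ?case unfolding iter.simps by (rule agree_trans[OF Suc agree_ForI]) (rule assms)
qed simp

lemma agree_sem: "agree c \<sigma> (sem c \<sigma>)"
proof (induction c arbitrary: \<sigma>)
  case (HFor x y c)
  have "agree (HFor x y c) \<sigma> (iter (\<lambda>j \<tau>. sem c (setV x j \<tau>)) (vars \<sigma> y) \<sigma>)"
    by (rule agree_For_iter) (rule HFor)
  then show ?case by (auto simp: agree_def)
next
  case (HSeq c d)
  from HSeq(1)[of \<sigma>] HSeq(2)[of "sem c \<sigma>"] show ?case by (auto simp: agree_def)
next
  case (HIf b c d)
  from HIf(1)[of \<sigma>] HIf(2)[of \<sigma>] show ?case by (auto simp: agree_def)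
qed (auto simp: agree_def)

lemma ival_conc [simp]:
  "x < nvars \<Longrightarrow> ival (Rd x) (conc \<sigma>) = vars \<sigma> x"
  "ival (RdA e) (conc \<sigma>) = arr \<sigma> (ival e (conc \<sigma>))"
  "ival (var_addr x) (conc \<sigma>) = low \<sigma> + x"
  "ival (arr_addr e) (conc \<sigma>) = low \<sigma> + nvars + ival e (conc \<sigma>)"
  by (auto simp: conc_def low_def var_addr_def arr_addr_def Rd_def RdA_def)

lemma ints_conc [simp]:
  "x < nvars \<Longrightarrow> ints (conc \<sigma>) (low \<sigma> + x) = vars \<sigma> x"
  "ints (conc \<sigma>) (low \<sigma> + nvars + i) = arr \<sigma> i"
  by (simp_all add: conc_def)

lemma ival_input: "ival e (conc \<sigma>) < low \<sigma> \<Longrightarrow> ival (IMem e) (conc \<sigma>) = inputs \<sigma> (ival e (conc \<sigma>))"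
  by (simp add: conc_def)

lemma flds_conc [simp]: "flds (conc \<sigma>) = fld \<sigma>"
  by (simp add: conc_def)

lemma conc_updates:
  "x < nvars \<Longrightarrow> conc (setV x v \<sigma>) = (conc \<sigma>)\<lparr>ints := (ints (conc \<sigma>))(low \<sigma> + x := v)\<rparr>"
  "conc (setA i v \<sigma>) = (conc \<sigma>)\<lparr>ints := (ints (conc \<sigma>))(low \<sigma> + nvars + i := v)\<rparr>"
  "conc (setF i u \<sigma>) = (conc \<sigma>)\<lparr>flds := (flds (conc \<sigma>))(i := u)\<rparr>"
  "conc (\<sigma>\<lparr>toss := w\<rparr>) = (conc \<sigma>)\<lparr>coins := w\<rparr>"
  by (auto simp: conc_def low_def setV_def setA_def setF_def fun_eq_iff)

section \<open>Safety and running time\<close>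

text \<open>
  In \<open>bounded\<close>, \<open>bd\<close> bounds the variables, \<open>ba\<close> the entries of the array \<open>arr\<close>, and \<open>na\<close> and
  \<open>nf\<close> the parts of the array and of the field memory that are in use. Since the number of
  iterations of a loop is the value of a variable, \<open>bd\<close> also determines a bound on the running
  time.
\<close>

locale bounded =
  fixes bd :: "nat \<Rightarrow> nat" and ba na nf :: nat
begin

definition good :: "'f::field store \<Rightarrow> bool" where
  "good \<sigma> \<longleftrightarrow> (\<forall>x<nvars. vars \<sigma> x \<le> bd x) \<and> (\<forall>i. arr \<sigma> i \<le> ba) \<and> (\<forall>i\<ge>na. arr \<sigma> i = 0) \<and>
     (\<forall>i\<ge>nf. fld \<sigma> i = 0)"

text \<open>In the clause for loops, \<open>bd y \<le> bd x\<close> is there because the machine's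
  counter reaches the value of \<open>y\<close> before the loop exits.\<close>

primrec safe :: "hcom \<Rightarrow> 'f::field store \<Rightarrow> bool" where
  "safe HSkip \<sigma> \<longleftrightarrow> True"
| "safe (HAssign x e) \<sigma> \<longleftrightarrow> ival e (conc \<sigma>) \<le> bd x"
| "safe (HAStore i e) \<sigma> \<longleftrightarrow> ival i (conc \<sigma>) < na \<and> ival e (conc \<sigma>) \<le> ba"
| "safe (HFStore i e) \<sigma> \<longleftrightarrow> ival i (conc \<sigma>) < nf"
| "safe (HFlip x) \<sigma> \<longleftrightarrow> 1 \<le> bd x"
| "safe (HSeq c d) \<sigma> \<longleftrightarrow> safe c \<sigma> \<and> safe d (sem c \<sigma>)"
| "safe (HIf b c d) \<sigma> \<longleftrightarrow> (if bval b (conc \<sigma>) then safe c \<sigma> else safe d \<sigma>)"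
| "safe (HFor x y c) \<sigma> \<longleftrightarrow> bd y \<le> bd x \<and>
     (\<forall>j<vars \<sigma> y. safe c (setV x j (iter (\<lambda>j \<tau>. sem c (setV x j \<tau>)) j \<sigma>)))"

text \<open>Counted in units of \<open>\<kappa> * unit_cost B ot \<kappa>\<close>, which pay for any
  single command or test. An iteration needs 3 units besides its body, for the test, the increment
  and the sequencing; the 5 remaining ones pay for the two resets of the counter, the last test and
  the sequencing around the loop.\<close>

primrec cost :: "hcom \<Rightarrow> nat" where
  "cost HSkip = 1"
| "cost (HAssign x e) = 1"
| "cost (HAStore i e) = 1"
| "cost (HFStore i e) = 1"
| "cost (HFlip x) = 1"
| "cost (HSeq c d) = cost c + cost d + 1"
| "cost (HIf b c d) = cost c + cost d + 1"
| "cost (HFor x y c) = bd y * (cost c + 3) + 5"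

definition hoare :: "hcom \<Rightarrow> 'f::field store \<Rightarrow> ('f store \<Rightarrow> bool) \<Rightarrow> bool" where
  "hoare c \<sigma> Q \<longleftrightarrow> safe c \<sigma> \<and> Q (sem c \<sigma>)"

lemma hoare_simps:
  "hoare HSkip \<sigma> Q \<longleftrightarrow> Q \<sigma>"
  "hoare (HAssign x e) \<sigma> Q \<longleftrightarrow> ival e (conc \<sigma>) \<le> bd x \<and> Q (setV x (ival e (conc \<sigma>)) \<sigma>)"
  "hoare (HAStore i e) \<sigma> Q \<longleftrightarrow> ival i (conc \<sigma>) < na \<and> ival e (conc \<sigma>) \<le> ba \<and>
     Q (setA (ival i (conc \<sigma>)) (ival e (conc \<sigma>)) \<sigma>)"
  "hoare (HFStore i fe) \<sigma> Q \<longleftrightarrow> ival i (conc \<sigma>) < nf \<and> Q (setF (ival i (conc \<sigma>)) (fval fe (conc \<sigma>)) \<sigma>)"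
  "hoare (HFlip x) \<sigma> Q \<longleftrightarrow>
     1 \<le> bd x \<and> Q ((setV x (of_bool (shd (toss \<sigma>))) \<sigma>)\<lparr>toss := stl (toss \<sigma>)\<rparr>)"
  "hoare (HSeq c d) \<sigma> Q \<longleftrightarrow> hoare c \<sigma> (\<lambda>\<tau>. hoare d \<tau> Q)"
  "hoare (HIf b c d) \<sigma> Q \<longleftrightarrow> (if bval b (conc \<sigma>) then hoare c \<sigma> Q else hoare d \<sigma> Q)"
  by (auto simp: hoare_def)

lemma hoare_Seq: "hoare c \<sigma> (\<lambda>\<tau>. hoare d \<tau> Q) \<Longrightarrow> hoare (HSeq c d) \<sigma> Q"
  by (simp add: hoare_def)

lemma hoare_conseq:
  "hoare c \<sigma> P \<Longrightarrow> (\<And>\<tau>. P \<tau> \<Longrightarrow> agree c \<sigma> \<tau> \<Longrightarrow> Q \<tau>) \<Longrightarrow> hoare c \<sigma> Q"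
  by (simp add: hoare_def agree_sem)

text \<open>Besides the invariant, the step and the conclusion receive the frame condition relative
  to the store on entry. So invariants only have to mention what the body changes.\<close>

lemma hoare_For:
  assumes "bd y \<le> bd x" and "I 0 \<sigma>"
    and step: "\<And>j \<tau>. j < vars \<sigma> y \<Longrightarrow> I j \<tau> \<Longrightarrow> agree (HFor x y c) \<sigma> \<tau> \<Longrightarrow>
      hoare c (setV x j \<tau>) (I (Suc j))"
    and post: "\<And>\<tau>. I (vars \<sigma> y) \<tau> \<Longrightarrow> agree (HFor x y c) \<sigma> \<tau> \<Longrightarrow> Q (setV x 0 \<tau>)"
  shows "hoare (HFor x y c) \<sigma> Q"
proof -
  let ?it = "\<lambda>j. iter (\<lambda>j \<tau>. sem c (setV x j \<tau>)) j \<sigma>"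
  have agr: "agree (HFor x y c) \<sigma> (?it j)" for j by (intro agree_For_iter agree_sem)
  have I: "j \<le> vars \<sigma> y \<Longrightarrow> I j (?it j)" for j
  proof (induction j)
    case (Suc j)
    then show ?case using step[OF _ _ agr] by (simp add: hoare_def)
  qed (use assms in simp)
  have "safe c (setV x j (?it j))" if "j < vars \<sigma> y" for j
    using step[OF that I[of j] agr] that by (simp add: hoare_def)
  then show ?thesis using assms(1) post[OF I[OF order_refl] agr] by (simp add: hoare_def)
qed

text \<open>Cells that contain 0 are free, and \<open>good\<close> makes all cells outside the
  regions in use zero; hence counting addresses is enough.\<close>

lemma state_space_le:
  fixes \<sigma> :: "'f::field store"
  assumes "good \<sigma>" and lowB: "low \<sigma> + nvars + na \<le> 2 ^ B" "nf \<le> 2 ^ B"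
    and cells: "\<And>a. ints (conc \<sigma>) a < 2 ^ B"
  shows "state_space eb (conc \<sigma>) \<le> (low \<sigma> + nvars + na) * (2 * (B + 1)) + nf * (B + 1 + eb)"
proof -
  let ?n = "low \<sigma> + nvars + na"
  have "(\<Sum>a | ints (conc \<sigma>) a \<noteq> 0. bits a + bits (ints (conc \<sigma>) a))
      \<le> (\<Sum>a<?n. bits a + bits (ints (conc \<sigma>) a))"
  proof (rule sum_mono2)
    have "ints (conc \<sigma>) a = 0" if "a \<ge> ?n" for a
    proof -
      have "na \<le> a - low \<sigma> - nvars" using that by simp
      then show ?thesis using assms(1) that by (simp add: conc_def good_def)
    qed
    then show "{a. ints (conc \<sigma>) a \<noteq> 0} \<subseteq> {..<?n}" by (metis (mono_tags, lifting) lessThan_iff mem_Collect_eq not_le subsetI)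
  qed auto
  also have "\<dots> \<le> (\<Sum>a<?n. 2 * (B + 1))"
  proof (rule sum_mono)
    fix a assume "a \<in> {..<?n}"
    then have "bits a \<le> B + 1" using lowB by (intro bits_le) simp
    moreover have "bits (ints (conc \<sigma>) a) \<le> B + 1" by (intro bits_le cells)
    ultimately show "bits a + bits (ints (conc \<sigma>) a) \<le> 2 * (B + 1)" by simp
  qed
  finally have 1: "(\<Sum>a | ints (conc \<sigma>) a \<noteq> 0. bits a + bits (ints (conc \<sigma>) a)) \<le> ?n * (2 * (B + 1))"
    by simp
  have "(\<Sum>a | flds (conc \<sigma>) a \<noteq> 0. bits a + eb) \<le> (\<Sum>a<nf. bits a + eb)"
  proof (rule sum_mono2)
    show "{a. flds (conc \<sigma>) a \<noteq> 0} \<subseteq> {..<nf}"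
      using assms(1) by (auto simp: good_def) (meson linorder_not_less)
  qed auto
  also have "\<dots> \<le> (\<Sum>a<nf. B + 1 + eb)"
    using lowB by (intro sum_mono add_right_mono bits_le) auto
  finally show ?thesis using 1 by (simp add: state_space_def)
qed

text \<open>\<open>B\<close> bounds the number of bits of all cells and addresses, \<open>n3\<close> is the size of the input.\<close>

definition fits :: "nat \<Rightarrow> nat \<Rightarrow> 'f store \<Rightarrow> bool" where
  "fits B n3 \<sigma> \<longleftrightarrow> B \<ge> 1 \<and> low \<sigma> = n3 \<and> n3 + nvars + na \<le> 2 ^ B \<and> nf \<le> 2 ^ B \<and>
     (\<forall>a. inputs \<sigma> a < 2 ^ B) \<and> (\<forall>x<nvars. bd x < 2 ^ B) \<and> ba < 2 ^ B"

definition space :: "nat \<Rightarrow> nat \<Rightarrow> nat \<Rightarrow> nat" where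
  "space eb B n3 = (n3 + nvars + na) * (2 * (B + 1)) + nf * (B + 1 + eb)"

lemma fits_agree: "fits B n3 \<sigma> \<Longrightarrow> inputs \<tau> = inputs \<sigma> \<Longrightarrow> fits B n3 \<tau>"
  by (simp add: fits_def low_def)

lemma fits_sem: "fits B n3 \<sigma> \<Longrightarrow> fits B n3 (sem c \<sigma>)"
  by (rule fits_agree) (use agree_sem[of c \<sigma>] in \<open>auto simp: agree_def\<close>)

lemma fits_cells: "fits B n3 \<sigma> \<Longrightarrow> good \<sigma> \<Longrightarrow> ints (conc \<sigma>) a < 2 ^ B"
  by (auto simp: fits_def good_def conc_def)
    (metis add_diff_inverse_nat le_less_trans nat_add_left_cancel_less, metis le_less_trans)

lemma fits_space: "fits B n3 \<sigma> \<Longrightarrow> good \<sigma> \<Longrightarrow> state_space eb (conc \<sigma>) \<le> space eb B n3"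
  using state_space_le[of \<sigma> B eb] fits_cells[of B n3 \<sigma>] by (simp add: space_def fits_def)

lemma good_sem:
  assumes "good \<sigma>" "safe c \<sigma>" "wf_hcom c"
  shows "good (sem c \<sigma>)"
  using assms
proof (induction c arbitrary: \<sigma>)
  case (HFor x y c)
  let ?it = "\<lambda>j. iter (\<lambda>j \<tau>. sem c (setV x j \<tau>)) j \<sigma>"
  have "j \<le> vars \<sigma> y \<Longrightarrow> good (?it j)" for j
  proof (induction j)
    case (Suc j)
    have "vars \<sigma> y \<le> bd y" "bd y \<le> bd x" using HFor.prems by (auto simp: good_def)
    then have "j \<le> bd x" using Suc.prems by linarith
    then have "good (setV x j (?it j))" using Suc by (auto simp: good_def)
    then show ?case using HFor Suc.prems by auto
  qed (use HFor in simp)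
  then have "good (?it (vars \<sigma> y))" by simp
  then show ?case by (auto simp: good_def)
qed (auto simp: good_def)

definition runs :: "nat \<Rightarrow> nat \<Rightarrow> com \<Rightarrow> 'f::field state \<Rightarrow> nat \<Rightarrow> nat \<Rightarrow> 'f state \<Rightarrow> bool" where
  "runs ot eb c s T M s' \<longleftrightarrow> (\<exists>t m. exec ot eb c s t m s' \<and> t \<le> T \<and> m \<le> M)"

lemma runsI: "exec ot eb c s t m s' \<Longrightarrow> t \<le> T \<Longrightarrow> m \<le> M \<Longrightarrow> runs ot eb c s T M s'"
  by (auto simp: runs_def)

lemma runs_IStore:
  assumes "fits B n3 \<sigma>" "good \<sigma>" "good \<tau>" "inputs \<tau> = inputs \<sigma>" "csz (IStore a e) \<le> \<kappa>"
    and "conc \<tau> = (conc \<sigma>)\<lparr>ints := (ints (conc \<sigma>))(ival a (conc \<sigma>) := ival e (conc \<sigma>))\<rparr>"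
  shows "runs ot eb (IStore a e) (conc \<sigma>) (\<kappa> * unit_cost B ot \<kappa>) (space eb B n3) (conc \<tau>)"
  unfolding runs_def
proof (intro exI conjI)
  show "exec ot eb (IStore a e) (conc \<sigma>) (icost a (conc \<sigma>) + icost e (conc \<sigma>) + 1)
     (max (state_space eb (conc \<sigma>)) (state_space eb (conc \<tau>))) (conc \<tau>)"
    using assms(6) by (rule exec.IStore)
  show "icost a (conc \<sigma>) + icost e (conc \<sigma>) + 1 \<le> \<kappa> * unit_cost B ot \<kappa>"
    using assms fits_cells[OF assms(1,2)] by (intro command_cost_le) (auto simp: fits_def)
  show "max (state_space eb (conc \<sigma>)) (state_space eb (conc \<tau>)) \<le> space eb B n3"
    using fits_space[OF assms(1,2)] fits_space[OF fits_agree[OF assms(1,4)] assms(3)] by simp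
qed

lemma runs_While:
  fixes st :: "nat \<Rightarrow> 'f::field state"
  assumes "j \<le> N"
    and true: "\<And>i. j \<le> i \<Longrightarrow> i < N \<Longrightarrow> bval b (st i) \<and> runs ot eb c (st i) T M (st (Suc i))"
    and false: "\<not> bval b (st N)" "state_space eb (st N) \<le> M"
    and u: "\<And>i. j \<le> i \<Longrightarrow> i \<le> N \<Longrightarrow> bcost ot b (st i) + 1 \<le> u"
  shows "runs ot eb (While b c) (st j) ((N - j) * (T + u) + u) M (st N)"
  using assms(1) true u
\<comment> \<open>Induction downwards from \<open>N\<close>, since the rule for \<open>While\<close>
  unrolls a loop at its front.\<close>
proof (induction rule: inc_induct)
  case base
  then show ?case using false by (intro runsI[OF exec.WhileFalse]) auto
next
  case (step j)
  have "runs ot eb (While b c) (st (Suc j)) ((N - Suc j) * (T + u) + u) M (st N)"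
    using step by auto
  then obtain t2 m2 where 2: "exec ot eb (While b c) (st (Suc j)) t2 m2 (st N)"
    "t2 \<le> (N - Suc j) * (T + u) + u" "m2 \<le> M" by (auto simp: runs_def)
  from step have b: "bval b (st j)" and "runs ot eb c (st j) T M (st (Suc j))" by auto
  then obtain t1 m1 where 1: "exec ot eb c (st j) t1 m1 (st (Suc j))" "t1 \<le> T" "m1 \<le> M"
    by (auto simp: runs_def)
  have "exec ot eb (While b c) (st j) (bcost ot b (st j) + t1 + t2 + 1) (max m1 m2) (st N)"
    using b 1 2 by (intro exec.WhileTrue)
  moreover have "bcost ot b (st j) + t1 + t2 + 1 \<le> (N - j) * (T + u) + u"
  proof -
    have "bcost ot b (st j) + 1 \<le> u" using step by simp
    moreover have "(N - j) * (T + u) = (N - Suc j) * (T + u) + (T + u)"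
    proof -
      have "N - j = Suc (N - Suc j)" using step by simp
      then show ?thesis by (metis add.commute mult_Suc)
    qed
    ultimately show ?thesis using 1 2 by linarith
  qed
  ultimately show ?case using 1 2 by (auto intro: runsI)
qed

lemma runs_Seq:
  "runs ot eb c s T M s' \<Longrightarrow> runs ot eb d s' T' M s'' \<Longrightarrow> runs ot eb (Seq c d) s (T + T' + 1) M s''"
  unfolding runs_def by (meson Seq add_le_mono max.boundedI order_refl)

lemma runs_mono: "runs ot eb c s T M s' \<Longrightarrow> T \<le> T' \<Longrightarrow> runs ot eb c s T' M s'"
  unfolding runs_def using le_trans by blast

theorem compile_correct:
  fixes \<sigma> :: "'f::field store"
  assumes "good \<sigma>" "safe c \<sigma>" "wf_hcom c" "fits B n3 \<sigma>" "csz (compile c) \<le> \<kappa>"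
  shows "runs ot eb (compile c) (conc \<sigma>) (cost c * (\<kappa> * unit_cost B ot \<kappa>)) (space eb B n3)
           (conc (sem c \<sigma>))"
  using assms
proof (induction c arbitrary: \<sigma>)
  case HSkip
  have "exec ot eb Skip (conc \<sigma>) 1 (state_space eb (conc \<sigma>)) (conc \<sigma>)" by (rule exec.Skip)
  moreover have "1 \<le> \<kappa> * unit_cost B ot \<kappa>" using HSkip by (simp add: unit_cost_def)
  ultimately show ?case using fits_space[of B n3 \<sigma> eb] HSkip by (auto intro: runsI)
next
  case (HAssign x e)
  have "runs ot eb (compile (HAssign x e)) (conc \<sigma>) (\<kappa> * unit_cost B ot \<kappa>) (space eb B n3)
     (conc (sem (HAssign x e) \<sigma>))"
    unfolding compile.simps
    by (rule runs_IStore) (use HAssign good_sem[OF HAssign.prems(1-3)] in \<open>simp_all add: conc_updates\<close>)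
  then show ?case by simp
next
  case (HAStore i e)
  have "runs ot eb (compile (HAStore i e)) (conc \<sigma>) (\<kappa> * unit_cost B ot \<kappa>) (space eb B n3)
     (conc (sem (HAStore i e) \<sigma>))"
    unfolding compile.simps
    by (rule runs_IStore) (use HAStore good_sem[OF HAStore.prems(1-3)] in \<open>simp_all add: conc_updates\<close>)
  then show ?case by simp
next
  case (HFStore i e)
  let ?\<tau> = "sem (HFStore i e) \<sigma>"
  have "exec ot eb (FStore i e) (conc \<sigma>) (icost i (conc \<sigma>) + fcost ot e (conc \<sigma>) + 1 + ot)
     (max (state_space eb (conc \<sigma>)) (state_space eb (conc ?\<tau>))) (conc ?\<tau>)"
    by (rule exec.FStore) (simp add: conc_updates)
  moreover have "icost i (conc \<sigma>) + fcost ot e (conc \<sigma>) + 1 + ot \<le> \<kappa> * unit_cost B ot \<kappa>"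
    using HFStore fits_cells[OF HFStore(4,1)] by (intro command_cost_le) (auto simp: fits_def)
  moreover have "max (state_space eb (conc \<sigma>)) (state_space eb (conc ?\<tau>)) \<le> space eb B n3"
    using fits_space HFStore(4,1) fits_sem[OF HFStore(4), of "HFStore i e"] good_sem[OF HFStore.prems(1-3)]
    by (metis max.boundedI)
  ultimately show ?case by (auto intro: runsI)
next
  case (HFlip x)
  let ?\<tau> = "sem (HFlip x) \<sigma>"
  have "exec ot eb (Flip (var_addr x)) (conc \<sigma>) (icost (var_addr x) (conc \<sigma>) + 1)
     (max (state_space eb (conc \<sigma>)) (state_space eb (conc ?\<tau>))) (conc ?\<tau>)"
  proof (rule exec.Flip)
    have "coins (conc \<sigma>) = toss \<sigma>" by (simp add: conc_def)
    then show "conc ?\<tau> = (conc \<sigma>)\<lparr>ints := (ints (conc \<sigma>))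
        (ival (var_addr x) (conc \<sigma>) := of_bool (shd (coins (conc \<sigma>)))),
        coins := stl (coins (conc \<sigma>))\<rparr>"
      using HFlip by (simp add: conc_updates)
  qed
  moreover have "icost (var_addr x) (conc \<sigma>) + 1 \<le> \<kappa> * unit_cost B ot \<kappa>"
    using HFlip fits_cells[OF HFlip(4,1)] by (intro command_cost_le) (auto simp: fits_def)
  moreover have "max (state_space eb (conc \<sigma>)) (state_space eb (conc ?\<tau>)) \<le> space eb B n3"
    using fits_space HFlip(4,1) fits_sem[OF HFlip(4), of "HFlip x"] good_sem[OF HFlip.prems(1-3)]
    by (metis max.boundedI)
  ultimately show ?case by (auto intro: runsI)
next
  case (HSeq c d)
  let ?U = "\<kappa> * unit_cost B ot \<kappa>"
  have "runs ot eb (compile c) (conc \<sigma>) (cost c * ?U) (space eb B n3) (conc (sem c \<sigma>))"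
    using HSeq by auto
  moreover have "runs ot eb (compile d) (conc (sem c \<sigma>)) (cost d * ?U) (space eb B n3) (conc (sem d (sem c \<sigma>)))"
    using HSeq good_sem[of \<sigma> c] fits_sem[of B n3 \<sigma> c] by auto
  ultimately have "runs ot eb (Seq (compile c) (compile d)) (conc \<sigma>) (cost c * ?U + cost d * ?U + 1)
      (space eb B n3) (conc (sem d (sem c \<sigma>)))"
    by (rule runs_Seq)
  moreover have "1 \<le> ?U" using HSeq.prems by (simp add: unit_cost_def)
  ultimately show ?case by (auto simp: algebra_simps elim!: runs_mono)
next
  case (HIf b c d)
  let ?U = "\<kappa> * unit_cost B ot \<kappa>"
  have U: "bcost ot b (conc \<sigma>) + 1 \<le> ?U"
    using HIf fits_cells[OF HIf.prems(4,1)] by (intro command_cost_le) (auto simp: fits_def)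
  show ?case
  proof (cases "bval b (conc \<sigma>)")
    case True
    then have "runs ot eb (compile c) (conc \<sigma>) (cost c * ?U) (space eb B n3) (conc (sem c \<sigma>))"
      using HIf by auto
    then obtain t m where "exec ot eb (compile c) (conc \<sigma>) t m (conc (sem c \<sigma>))" "t \<le> cost c * ?U"
      "m \<le> space eb B n3"
      by (auto simp: runs_def)
    moreover have "cost c * ?U + ?U \<le> cost (HIf b c d) * ?U" by (simp add: algebra_simps)
    with calculation U have "bcost ot b (conc \<sigma>) + t + 1 \<le> cost (HIf b c d) * ?U" by linarith
    ultimately show ?thesis using True unfolding compile.simps
      by (intro runsI[OF exec.IfTrue]) simp_all
  next
    case False
    then have "runs ot eb (compile d) (conc \<sigma>) (cost d * ?U) (space eb B n3) (conc (sem d \<sigma>))"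
      using HIf by auto
    then obtain t m where "exec ot eb (compile d) (conc \<sigma>) t m (conc (sem d \<sigma>))" "t \<le> cost d * ?U"
      "m \<le> space eb B n3"
      by (auto simp: runs_def)
    moreover have "cost d * ?U + ?U \<le> cost (HIf b c d) * ?U" by (simp add: algebra_simps)
    with calculation U have "bcost ot b (conc \<sigma>) + t + 1 \<le> cost (HIf b c d) * ?U" by linarith
    ultimately show ?thesis using False unfolding compile.simps
      by (intro runsI[OF exec.IfFalse]) simp_all
  qed
next
  case (HFor x y c)
  let ?U = "\<kappa> * unit_cost B ot \<kappa>"
  let ?it = "\<lambda>j. iter (\<lambda>j \<tau>. sem c (setV x j \<tau>)) j \<sigma>"
  \<comment> \<open>The store at the loop test: \<open>j\<close> iterations are complete and the
    counter has already been advanced to \<open>j\<close>.\<close>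
  let ?st = "\<lambda>j. setV x j (?it j)"
  let ?S = "space eb B n3"
  have wf: "x < nvars" "y < nvars" "x \<noteq> y" "x \<notin> mods c" "y \<notin> mods c" "wf_hcom c"
    using HFor.prems by auto
  have agr: "agree (HFor x y c) \<sigma> (?it j)" for j by (intro agree_For_iter agree_sem)
  have "vars \<sigma> y \<le> bd y" "bd y \<le> bd x" using HFor.prems by (auto simp: good_def)
  then have Vy: "vars \<sigma> y \<le> bd x" by linarith
  \<comment> \<open>Two independent indices, because the final reset puts the counter 0 on the store
    after all iterations.\<close>
  have good_st: "good (setV x i (?it j))" if "j \<le> vars \<sigma> y" "i \<le> vars \<sigma> y" for i j
  proof -
    from that(1) have "good (?it j)"
    proof (induction j)
      case (Suc j)
      then have "good (?st j)" using Vy by (auto simp: good_def)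
      then show ?case using HFor.prems Suc.prems by (auto intro!: good_sem)
    qed (use HFor in simp)
    then show ?thesis using that Vy by (auto simp: good_def)
  qed
  have fits_st: "fits B n3 (setV x i (?it j))" for i j
    using agr[of j] by (intro fits_agree[OF HFor.prems(4)]) (auto simp: agree_def)
  have 1: "runs ot eb (IStore (var_addr x) (INum 0)) (conc \<sigma>) ?U ?S (conc (?st 0))"
    using HFor.prems good_st[of 0 0] wf by (intro runs_IStore) (auto simp: conc_updates)
  have body: "runs ot eb (Seq (compile c) (IStore (var_addr x) (IPlus (Rd x) (INum 1))))
      (conc (?st i)) (cost c * ?U + ?U + 1) ?S (conc (?st (Suc i)))" if "i < vars \<sigma> y" for i
  proof (rule runs_Seq)
    show "runs ot eb (compile c) (conc (?st i)) (cost c * ?U) ?S (conc (sem c (?st i)))"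
      using HFor.prems good_st[of i i] fits_st[of i i] that by (intro HFor.IH) auto
    have Vx: "vars (sem c (?st i)) x = i"
      using agree_sem[of c "?st i"] wf by (auto simp: agree_def)
    have low: "low (?it i) = low (sem c (?st i))"
      using agree_sem[of c "?st i"] by (auto simp: agree_def low_def)
    show "runs ot eb (IStore (var_addr x) (IPlus (Rd x) (INum 1))) (conc (sem c (?st i))) ?U ?S
       (conc (?st (Suc i)))"
    proof (rule runs_IStore)
      show "fits B n3 (sem c (?st i))" by (intro fits_sem fits_st)
      show "good (sem c (?st i))"
        using HFor.prems good_st[of i i] that by (intro good_sem) auto
      show "good (?st (Suc i))" using good_st[of "Suc i" "Suc i"] that by simp
      show "csz (IStore (var_addr x) (IPlus (Rd x) (INum 1))) \<le> \<kappa>"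
        using HFor.prems(5) by simp
      show "conc (?st (Suc i)) = conc (sem c (?st i))
         \<lparr>ints := (ints (conc (sem c (?st i))))(ival (var_addr x) (conc (sem c (?st i))) :=
            ival (IPlus (Rd x) (INum 1)) (conc (sem c (?st i))))\<rparr>"
        using wf Vx by (simp add: conc_updates)
    qed simp
  qed
  have 2: "runs ot eb (While (Less (Rd x) (Rd y))
             (Seq (compile c) (IStore (var_addr x) (IPlus (Rd x) (INum 1)))))
       (conc (?st 0)) ((vars \<sigma> y - 0) * (cost c * ?U + ?U + 1 + ?U) + ?U) ?S (conc (?st (vars \<sigma> y)))"
  proof (rule runs_While[of 0 _ _ "\<lambda>j. conc (?st j)"])
    have Vy': "vars (?it i) y = vars \<sigma> y" for i
      using agr[of i] wf by (auto simp: agree_def)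
    then have lessi: "bval (Less (Rd x) (Rd y)) (conc (?st i)) \<longleftrightarrow> i < vars \<sigma> y" for i
      using wf by simp
    show "bval (Less (Rd x) (Rd y)) (conc (?st i)) \<and>
         runs ot eb (Seq (compile c) (IStore (var_addr x) (IPlus (Rd x) (INum 1)))) (conc (?st i))
          (cost c * ?U + ?U + 1) ?S (conc (?st (Suc i)))" if "i < vars \<sigma> y" for i
      using body[OF that] lessi[of i] that by blast
    show "\<not> bval (Less (Rd x) (Rd y)) (conc (?st (vars \<sigma> y)))" using lessi by blast
    show "state_space eb (conc (?st (vars \<sigma> y))) \<le> ?S"
      by (intro fits_space fits_st good_st) auto
    show "bcost ot (Less (Rd x) (Rd y)) (conc (?st i)) + 1 \<le> ?U" if "i \<le> vars \<sigma> y" for i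
      using HFor.prems fits_cells[OF fits_st good_st[OF that that]]
      by (intro command_cost_le) (auto simp: fits_def)
  qed simp
  have 3: "runs ot eb (IStore (var_addr x) (INum 0)) (conc (?st (vars \<sigma> y))) ?U ?S
      (conc (sem (HFor x y c) \<sigma>))"
  proof (rule runs_IStore)
    show "good (sem (HFor x y c) \<sigma>)" using good_st[of "vars \<sigma> y" 0] by simp
    have "ival (var_addr x) (conc (?st (vars \<sigma> y))) = low (?it (vars \<sigma> y)) + x" by simp
    then show "conc (sem (HFor x y c) \<sigma>) = (conc (?st (vars \<sigma> y)))\<lparr>ints :=
        (ints (conc (?st (vars \<sigma> y))))(ival (var_addr x) (conc (?st (vars \<sigma> y))) :=
          ival (INum 0) (conc (?st (vars \<sigma> y))))\<rparr>"
      using wf by (simp add: conc_updates)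
  qed (use HFor.prems fits_st good_st[of "vars \<sigma> y" "vars \<sigma> y"] in auto)
  have "runs ot eb (compile (HFor x y c)) (conc \<sigma>)
     (?U + ((vars \<sigma> y - 0) * (cost c * ?U + ?U + 1 + ?U) + ?U + ?U + 1) + 1) ?S (conc (sem (HFor x y c) \<sigma>))"
    unfolding compile.simps by (intro runs_Seq[OF 1] runs_Seq[OF 2] 3)
  then show ?case
  proof (rule runs_mono)
    have U1: "1 \<le> ?U" using HFor.prems by (simp add: unit_cost_def)
    have "cost c * ?U + ?U + 1 + ?U \<le> (cost c + 3) * ?U" using U1 by (simp add: algebra_simps)
    moreover have "vars \<sigma> y \<le> bd y" using HFor.prems wf by (auto simp: good_def)
    ultimately have "vars \<sigma> y * (cost c * ?U + ?U + 1 + ?U) \<le> bd y * ((cost c + 3) * ?U)"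
      by (intro mult_mono) auto
    moreover have eq: "cost (HFor x y c) * ?U = bd y * ((cost c + 3) * ?U) + 5 * ?U"
      by (simp add: algebra_simps)
    ultimately show "?U + ((vars \<sigma> y - 0) * (cost c * ?U + ?U + 1 + ?U) + ?U + ?U + 1) + 1 \<le> cost (HFor x y c) * ?U"
      unfolding diff_zero using U1 eq by linarith
  qed
qed

end

section \<open>The algorithm\<close>

definition num_groups :: "nat \<Rightarrow> nat" where "num_groups k = k div 3 + 1"
definition num_colors :: "nat \<Rightarrow> nat" where "num_colors k = 4 * num_groups k"
text \<open>The summand \<open>2 * n\<close> makes the isolation lemma fail with probability at most
  1/2. The summand \<open>2 * k * num_colors k\<close> limits the bias of reducing a random number
  modulo the number of colors: over \<open>k\<close> variables it costs at most a factor 1/2. Colors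
  and weights are drawn from numbers of the same length.\<close>

definition weight_target :: "nat \<Rightarrow> nat \<Rightarrow> nat" where
  "weight_target n k = 2 * n + 2 * k * num_colors k + 1"
definition log_ceil :: "nat \<Rightarrow> nat" where "log_ceil m = (LEAST l. m \<le> 2 ^ l)"
definition weight_bits :: "nat \<Rightarrow> nat \<Rightarrow> nat" where "weight_bits n k = log_ceil (weight_target n k)"
definition max_weight :: "nat \<Rightarrow> nat \<Rightarrow> nat" where "max_weight n k = 2 ^ weight_bits n k"
definition stride :: "nat \<Rightarrow> nat \<Rightarrow> nat" where "stride n k = k * max_weight n k + 1"
definition trunc :: "nat \<Rightarrow> nat \<Rightarrow> nat" where "trunc n k = (k + 1) * stride n k"

text \<open>Multiplication by 161/32 in integer arithmetic; the added 1 outweighs what the division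
  cuts off, so the number of trials is never too small.\<close>

primrec trials_aux :: "nat \<Rightarrow> nat \<Rightarrow> nat" where
  "trials_aux r 0 = r"
| "trials_aux r (Suc i) = trials_aux r i * 161 div 32 + 1"

definition trials :: "nat \<Rightarrow> nat" where
  "trials k = trials_aux (16 * num_groups k) (num_groups k)"

abbreviation (input) "var_n \<equiv> 0 :: nat"
abbreviation (input) "var_k \<equiv> 1 :: nat"
abbreviation (input) "var_s \<equiv> 2 :: nat"
abbreviation (input) "var_j \<equiv> 3 :: nat"
abbreviation (input) "var_K \<equiv> 4 :: nat"
abbreviation (input) "var_K1 \<equiv> 5 :: nat"
abbreviation (input) "var_q \<equiv> 6 :: nat"
abbreviation (input) "var_X \<equiv> 7 :: nat"
abbreviation (input) "var_W \<equiv> 8 :: nat"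
abbreviation (input) "var_l \<equiv> 9 :: nat"
abbreviation (input) "var_D \<equiv> 10 :: nat"
abbreviation (input) "var_L \<equiv> 11 :: nat"
abbreviation (input) "var_P \<equiv> 12 :: nat"
abbreviation (input) "var_R \<equiv> 13 :: nat"
abbreviation (input) "var_found \<equiv> 14 :: nat"
abbreviation (input) "ctr_trial \<equiv> 15 :: nat"
abbreviation (input) "ctr_draw \<equiv> 16 :: nat"
abbreviation (input) "ctr_bit \<equiv> 17 :: nat"
abbreviation (input) "ctr_subset \<equiv> 18 :: nat"
abbreviation (input) "ctr_color \<equiv> 19 :: nat"
abbreviation (input) "ctr_gate \<equiv> 20 :: nat"
abbreviation (input) "ctr_exp \<equiv> 21 :: nat"
abbreviation (input) "ctr_conv \<equiv> 22 :: nat"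
abbreviation (input) "tmp_rand \<equiv> 23 :: nat"
abbreviation (input) "tmp_mask \<equiv> 24 :: nat"
abbreviation (input) "tmp_z \<equiv> 25 :: nat"
abbreviation (input) "tmp_binom \<equiv> 26 :: nat"
abbreviation (input) "tmp_color \<equiv> 27 :: nat"
abbreviation (input) "tmp_op \<equiv> 28 :: nat"
abbreviation (input) "tmp_arg1 \<equiv> 29 :: nat"
abbreviation (input) "tmp_arg2 \<equiv> 30 :: nat"
abbreviation (input) "tmp_len \<equiv> 31 :: nat"

lemma less_nvars [simp]:
  "0 < nvars" "Suc 0 < nvars" "1 < nvars" "numeral w < nvars \<longleftrightarrow> numeral w < (32 :: nat)"
  by (simp_all add: nvars_def)

notation HSeq (infixr ";;" 60)

definition odd_test :: "iexp \<Rightarrow> bexp" where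
  "odd_test d = Less (INum 0) (IMinus d (ITimes (INum 2) (IDiv d (INum 2))))"

lemma bval_odd_test [simp]: "bval (odd_test d) s \<longleftrightarrow> odd (ival d s)"
  unfolding odd_test_def by (simp add: minus_mult_div_eq_mod[of _ 2] odd_iff_mod_2_eq_one)

definition prog_sample :: hcom where
  "prog_sample = HAssign tmp_rand (INum 0) ;;
     HFor ctr_bit var_l (HFlip tmp_z ;; HAssign tmp_rand (IPlus (ITimes (INum 2) (Rd tmp_rand)) (Rd tmp_z)))"

text \<open>Storing \<open>2 ^ c\<close> instead of the color \<open>c\<close> reduces the
  membership of \<open>c\<close> in a set of colors to one division and a parity test.\<close>

definition prog_draw :: hcom where
  "prog_draw = HFor ctr_draw var_n (
     prog_sample ;;
     HAssign tmp_color (IMinus (Rd tmp_rand) (ITimes (IDiv (Rd tmp_rand) (Rd var_K)) (Rd var_K))) ;;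
     HAssign tmp_mask (INum 1) ;;
     HFor ctr_bit tmp_color (HAssign tmp_mask (ITimes (INum 2) (Rd tmp_mask))) ;;
     HAStore (Rd ctr_draw) (Rd tmp_mask) ;;
     prog_sample ;;
     HAStore (IPlus (Rd var_n) (Rd ctr_draw)) (Rd tmp_rand))"

text \<open>
  Layout of the memory, where \<open>s\<close> is the size of the circuit: \<open>arr i\<close> is \<open>2 ^ c\<close> for the color \<open>c\<close> of the
  i-th variable and \<open>arr (n + i)\<close> is its weight. The field memory contains the scalars of the circuit
  in the cells below \<open>s\<close>, the sign and the coefficient of the current set of colors in the cells
  \<open>s\<close> and \<open>s + 1\<close>, then the sum of the series computed so far in this trial, and then the truncated
  series of the gates. A set of colors is represented by the number with these binary digits.
\<close>

definition acc :: "iexp \<Rightarrow> iexp" where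
  "acc e = IPlus (IPlus (Rd var_s) (INum 2)) e"

definition vec :: "iexp \<Rightarrow> iexp \<Rightarrow> iexp" where
  "vec g e = acc (IPlus (ITimes (IPlus g (INum 1)) (Rd var_L)) e)"

definition sgn_addr :: iexp where "sgn_addr = Rd var_s"
definition coef_addr :: iexp where "coef_addr = IPlus (Rd var_s) (INum 1)"

definition prog_zeros :: hcom where
  "prog_zeros = HAssign tmp_z (INum 0) ;; HAssign tmp_mask (INum 1) ;; HFStore sgn_addr FOne ;;
     HFor ctr_color var_K (
       HIf (odd_test (IDiv (Rd ctr_subset) (Rd tmp_mask))) HSkip
         (HAssign tmp_z (IPlus (Rd tmp_z) (INum 1)) ;; HFStore sgn_addr (FMinus FZero (FMem sgn_addr))) ;;
       HAssign tmp_mask (ITimes (INum 2) (Rd tmp_mask)))"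

definition prog_binomial :: hcom where
  "prog_binomial = HAssign tmp_binom (INum 1) ;;
     HFor ctr_color var_q (HAssign tmp_binom
       (IDiv (ITimes (Rd tmp_binom) (IMinus (Rd tmp_z) (Rd ctr_color))) (IPlus (Rd ctr_color) (INum 1))))"

text \<open>Integers cannot be moved to the field memory directly. The binomial coefficient is
  rebuilt in the field from its binary digits while the sign is doubled repeatedly, which takes
  \<open>K + 1\<close> rounds instead of exponentially many additions of 1.\<close>

definition prog_embed :: hcom where
  "prog_embed = HFStore coef_addr FZero ;;
     HFor ctr_color var_K1 (
       HIf (odd_test (Rd tmp_binom)) (HFStore coef_addr (FPlus (FMem coef_addr) (FMem sgn_addr))) HSkip ;;
       HFStore sgn_addr (FPlus (FMem sgn_addr) (FMem sgn_addr)) ;;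
       HAssign tmp_binom (IDiv (Rd tmp_binom) (INum 2)))"

definition code_cell :: "nat \<Rightarrow> iexp" where
  "code_cell i = IMem (IPlus (INum (3 + i)) (ITimes (INum 3) (Rd ctr_gate)))"

definition prog_entry :: hcom where
  "prog_entry =
     HIf (Less (Rd tmp_op) (INum 1))
       (HIf (And (odd_test (IDiv (Rd ctr_subset) (RdA (Rd tmp_arg1))))
              (And (Not (Less (Rd ctr_exp) (IPlus (Rd var_D) (RdA (IPlus (Rd var_n) (Rd tmp_arg1))))))
                (Not (Less (IPlus (Rd var_D) (RdA (IPlus (Rd var_n) (Rd tmp_arg1)))) (Rd ctr_exp)))))
         (HFStore (vec (Rd ctr_gate) (Rd ctr_exp)) FOne)
         (HFStore (vec (Rd ctr_gate) (Rd ctr_exp)) FZero))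
     (HIf (Less (Rd tmp_op) (INum 2))
       (HIf (Less (Rd ctr_exp) (INum 1))
         (HFStore (vec (Rd ctr_gate) (Rd ctr_exp)) (FMem (Rd ctr_gate)))
         (HFStore (vec (Rd ctr_gate) (Rd ctr_exp)) FZero))
     (HIf (Less (Rd tmp_op) (INum 3))
       (HFStore (vec (Rd ctr_gate) (Rd ctr_exp))
         (FPlus (FMem (vec (Rd tmp_arg1) (Rd ctr_exp))) (FMem (vec (Rd tmp_arg2) (Rd ctr_exp)))))
       (HFStore (vec (Rd ctr_gate) (Rd ctr_exp)) FZero ;;
        HAssign tmp_len (IPlus (Rd ctr_exp) (INum 1)) ;;
        HFor ctr_conv tmp_len (HFStore (vec (Rd ctr_gate) (Rd ctr_exp))
          (FPlus (FMem (vec (Rd ctr_gate) (Rd ctr_exp)))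
            (FTimes (FMem (vec (Rd tmp_arg1) (Rd ctr_conv))) (FMem (vec (Rd tmp_arg2) (IMinus (Rd ctr_exp) (Rd ctr_conv))))))))))"

definition prog_gate :: hcom where
  "prog_gate = HAssign tmp_op (code_cell 0) ;; HAssign tmp_arg1 (code_cell 1) ;; HAssign tmp_arg2 (code_cell 2) ;;
     HFor ctr_exp var_L prog_entry"

definition prog_subset :: hcom where
  "prog_subset = prog_zeros ;; prog_binomial ;; prog_embed ;;
     HFor ctr_gate var_s prog_gate ;;
     HFor ctr_exp var_L (HFStore (acc (Rd ctr_exp))
       (FPlus (FMem (acc (Rd ctr_exp)))
         (FTimes (FMem coef_addr) (FMem (vec (IMinus (Rd var_s) (INum 1)) (Rd ctr_exp))))))"

definition prog_trial :: hcom where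
  "prog_trial = prog_draw ;;
     HFor ctr_exp var_L (HFStore (acc (Rd ctr_exp)) FZero) ;;
     HFor ctr_subset var_P prog_subset ;;
     HFor ctr_exp var_D (HIf (IsZero (FMem (acc (IPlus (ITimes (Rd var_k) (Rd var_D)) (Rd ctr_exp)))))
       HSkip (HAssign var_found (INum 1)))"

definition prog_setup :: hcom where
  "prog_setup =
     HAssign var_n (IMem (INum 0)) ;; HAssign var_k (IMem (INum 1)) ;; HAssign var_s (IMem (INum 2)) ;;
     HAssign var_j (IPlus (IDiv (Rd var_k) (INum 3)) (INum 1)) ;;
     HAssign var_K (ITimes (INum 4) (Rd var_j)) ;;
     HAssign var_K1 (IPlus (Rd var_K) (INum 1)) ;;
     HAssign var_q (IMinus (Rd var_K) (Rd var_k)) ;;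
     HAssign var_X (IPlus (IPlus (ITimes (INum 2) (Rd var_n)) (ITimes (ITimes (INum 2) (Rd var_k)) (Rd var_K))) (INum 1)) ;;
     HAssign var_W (INum 1) ;; HAssign var_l (INum 0) ;;
     HFor ctr_draw var_X (HIf (Less (Rd var_W) (Rd var_X))
       (HAssign var_W (ITimes (INum 2) (Rd var_W)) ;; HAssign var_l (IPlus (Rd var_l) (INum 1))) HSkip) ;;
     HAssign var_D (IPlus (ITimes (Rd var_k) (Rd var_W)) (INum 1)) ;;
     HAssign var_L (ITimes (IPlus (Rd var_k) (INum 1)) (Rd var_D)) ;;
     HAssign tmp_binom (INum 1) ;;
     HFor ctr_draw var_K (HAssign tmp_binom (ITimes (INum 2) (Rd tmp_binom))) ;;
     HAssign var_P (Rd tmp_binom) ;;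
     HAssign tmp_binom (ITimes (INum 16) (Rd var_j)) ;;
     HFor ctr_draw var_j (HAssign tmp_binom (IPlus (IDiv (ITimes (Rd tmp_binom) (INum 161)) (INum 32)) (INum 1))) ;;
     HAssign var_R (Rd tmp_binom)"

definition prog_main :: hcom where
  "prog_main = prog_setup ;; HFor ctr_trial var_R prog_trial"

text \<open>The answer goes into cell 0. This cell belongs to the input part of the memory, which
  the loop language cannot write, so the last command is one of the machine itself.\<close>

definition kmmd_program :: com where
  "kmmd_program = Seq (compile prog_main) (IStore (INum 0) (Rd var_found))"

lemmas prog_defs = prog_sample_def prog_draw_def prog_zeros_def prog_binomial_def prog_embed_def
  prog_entry_def prog_gate_def prog_subset_def prog_trial_def prog_setup_def prog_main_def

lemma wf_prog_main: "wf_hcom prog_main"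
  by (simp add: prog_defs)

section \<open>Evaluating circuits in truncated power series\<close>

text \<open>These polynomials are not truncated. The program may nevertheless keep only the first
  \<open>L\<close> coefficients, because a coefficient of a sum or product depends on coefficients
  of at most the same index.\<close>

fun gate_val :: "(nat \<Rightarrow> bool) \<Rightarrow> (nat \<Rightarrow> nat) \<Rightarrow> 'f::field poly list \<Rightarrow> 'f gate \<Rightarrow> 'f poly" where
  "gate_val sel v gs (Var i) = (if sel i then monom 1 (v i) else 0)"
| "gate_val sel v gs (Const c) = [:c:]"
| "gate_val sel v gs (Add a b) = gs ! a + gs ! b"
| "gate_val sel v gs (Mul a b) = gs ! a * gs ! b"

definition gate_vals :: "(nat \<Rightarrow> bool) \<Rightarrow> (nat \<Rightarrow> nat) \<Rightarrow> 'f::field circuit \<Rightarrow> 'f poly list" where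
  "gate_vals sel v C = foldl (\<lambda>gs g. gs @ [gate_val sel v gs g]) [] C"

lemma foldl_append_length: "length (foldl (\<lambda>var_s g. var_s @ [f var_s g]) ys C) = length ys + length C"
  by (induction C arbitrary: ys) auto

lemma foldl_append_take:
  "m \<le> length C \<Longrightarrow> take m (foldl (\<lambda>var_s g. var_s @ [f var_s g]) [] C) = foldl (\<lambda>var_s g. var_s @ [f var_s g]) [] (take m C)"
proof (induction C rule: rev_induct)
  case (snoc g C)
  then show ?case by (cases "m \<le> length C") (auto simp: foldl_append_length)
qed simp

lemma foldl_append_nth:
  assumes "m < length C"
  shows "foldl (\<lambda>var_s g. var_s @ [f var_s g]) [] C ! m =
    f (take m (foldl (\<lambda>var_s g. var_s @ [f var_s g]) [] C)) (C ! m)"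
proof -
  let ?G = "\<lambda>C. foldl (\<lambda>var_s g. var_s @ [f var_s g]) [] C"
  have "?G C ! m = take (Suc m) (?G C) ! m" by simp
  also have "\<dots> = ?G (take (Suc m) C) ! m" using assms by (simp add: foldl_append_take)
  also have "\<dots> = f (?G (take m C)) (C ! m)"
    using assms by (simp add: take_Suc_conv_app_nth nth_append foldl_append_length)
  also have "?G (take m C) = take m (?G C)" using assms by (simp add: foldl_append_take)
  finally show ?thesis .
qed

lemma length_gate_vals [simp]: "length (gate_vals sel v C) = length C"
  by (simp add: gate_vals_def foldl_append_length)

text \<open>A gate refers only to earlier gates, so the prefix it was evaluated in may be replaced
  by the complete list.\<close>

lemma gate_vals_nth:
  assumes "wf_circuit n C" "j < length C"
  shows "gate_vals sel v C ! j = gate_val sel v (gate_vals sel v C) (C ! j)"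
proof -
  have "wf_gate n j (C ! j)" using assms by (simp add: wf_circuit_def)
  then show ?thesis
    unfolding gate_vals_def using assms(2)
    by (subst foldl_append_nth) (cases "C ! j"; simp)+
qed

lemma length_gate_code [simp]: "length (gate_code g) = 3"
  by (cases g) auto

lemma length_concat_codes: "length (concat (map gate_code C)) = 3 * length C"
  by (induction C) auto

lemma nth_concat_codes:
  "j < length C \<Longrightarrow> i < 3 \<Longrightarrow> concat (map gate_code C) ! (3 * j + i) = gate_code (C ! j) ! i"
proof (induction C arbitrary: j)
  case (Cons g C)
  then show ?case by (cases j) (auto simp: nth_append)
qed simp

lemma nth_input_ints:
  assumes "j < length C" "i < 3"
  shows "input_ints n k C ! (3 + 3 * j + i) = gate_code (C ! j) ! i"
proof -
  have "input_ints n k C ! (3 + 3 * j + i) = concat (map gate_code C) ! (3 * j + i)"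
    by (simp add: input_ints_def nth_append numeral_3_eq_3)
  then show ?thesis using nth_concat_codes[OF assms] by simp
qed

lemma length_input_ints [simp]: "length (input_ints n k C) = 3 + 3 * length C"
  by (simp add: input_ints_def length_concat_codes)

primrec coin_number :: "nat \<Rightarrow> bool stream \<Rightarrow> nat" where
  "coin_number 0 w = 0"
| "coin_number (Suc l) w = 2 * coin_number l w + of_bool (w !! l)"

lemma coin_number_less: "coin_number l w < 2 ^ l"
  by (induction l) auto

primrec zeros :: "nat \<Rightarrow> nat \<Rightarrow> nat" where
  "zeros S 0 = 0"
| "zeros S (Suc c) = zeros S c + of_bool (even (S div 2 ^ c))"

lemma zeros_le: "zeros S c \<le> c"
  by (induction c) auto

definition subset_coef :: "nat \<Rightarrow> nat \<Rightarrow> nat \<Rightarrow> 'f::field" where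
  "subset_coef K q S = (-1) ^ zeros S K * of_nat (zeros S K choose q)"

lemma log_ceil: "m \<le> 2 ^ log_ceil m" "l < log_ceil m \<Longrightarrow> 2 ^ l < m" "log_ceil m \<le> m"
proof -
  have "m \<le> 2 ^ m" by (rule less_imp_le) (rule less_exp)
  then show "m \<le> 2 ^ log_ceil m" "log_ceil m \<le> m"
    unfolding log_ceil_def by (rule LeastI, rule Least_le)
  show "l < log_ceil m \<Longrightarrow> 2 ^ l < m" unfolding log_ceil_def using not_less_Least not_le by blast
qed

lemma less_log_ceil_iff: "2 ^ l < m \<longleftrightarrow> l < log_ceil m"
proof
  assume "2 ^ l < m"
  show "l < log_ceil m"
  proof (rule ccontr)
    assume "\<not> l < log_ceil m"
    then have "(2::nat) ^ log_ceil m \<le> 2 ^ l" by (intro power_increasing) auto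
    with log_ceil(1)[of m] \<open>2 ^ l < m\<close> show False by linarith
  qed
qed (rule log_ceil)

lemma power_log_ceil_le: "m \<ge> 1 \<Longrightarrow> 2 ^ log_ceil m \<le> 2 * m"
proof (cases "log_ceil m")
  case (Suc l)
  then have "2 ^ l < m" by (intro log_ceil) simp
  then show ?thesis using Suc by simp
qed simp

section \<open>Correctness of the program: setup values and random draws\<close>

locale kmmd =
  fixes n k :: nat and C :: "'f::field circuit"
  assumes wf: "wf_circuit n C"
begin

abbreviation "sz \<equiv> length C"
abbreviation "K \<equiv> num_colors k"
abbreviation "q \<equiv> K - k"
abbreviation "W \<equiv> max_weight n k"
abbreviation "wb \<equiv> weight_bits n k"
abbreviation "D \<equiv> stride n k"
abbreviation "L \<equiv> trunc n k"
abbreviation "block \<equiv> 2 * n * wb"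

definition small :: nat where
  "small = n + k + sz + K + weight_target n k + W + L + wb + 5"

text \<open>Exponential bounds are reserved for the numbers of trials and of color sets, their loop
  counters, and the two scratch variables that hold powers of two, binomial coefficients and, during
  the setup, the number of trials. All other loops thus contribute polynomial factors only.\<close>

definition var_bound :: "nat \<Rightarrow> nat" where
  "var_bound x = (if x = var_R \<or> x = ctr_trial then trials k
     else if x = var_P \<or> x = ctr_subset then 2 ^ K
     else if x = tmp_mask \<or> x = tmp_binom then 2 ^ K + trials k
     else small)"

definition arr_bound :: nat where "arr_bound = 2 ^ K + small"
definition arr_size :: nat where "arr_size = 2 * n"
definition fld_size :: nat where "fld_size = sz + 2 + (sz + 1) * L"

sublocale bounded var_bound arr_bound arr_size fld_size .

definition inp :: "nat \<Rightarrow> nat" where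
  "inp a = (if a < length (input_ints n k C) then input_ints n k C ! a else 0)"

definition setup_done :: "'f store \<Rightarrow> bool" where
  "setup_done s \<longleftrightarrow> inputs s = inp \<and> vars s var_n = n \<and> vars s var_k = k \<and> vars s var_s = sz \<and> vars s var_K = K \<and>
     vars s var_K1 = K + 1 \<and> vars s var_q = q \<and> vars s var_l = wb \<and> vars s var_D = D \<and> vars s var_L = L \<and>
     vars s var_P = 2 ^ K \<and> vars s var_R = trials k"

text \<open>The constants of the setup live in variables below 14, and everything executed later
  writes only variables from 14 on.\<close>

lemma setup_done_agree:
  "agree c s t \<Longrightarrow> setup_done s \<Longrightarrow> (\<forall>x<14. x \<notin> mods c) \<Longrightarrow> setup_done t"
  by (simp add: agree_def setup_done_def)

lemma setup_done_set [simp]: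
  "14 \<le> x \<Longrightarrow> setup_done (setV x v s) = setup_done s"
  "setup_done (setA i v s) = setup_done s"
  "setup_done (setF i u s) = setup_done s"
  "setup_done (s\<lparr>toss := w\<rparr>) = setup_done s"
  by (simp_all add: setup_done_def)

lemma var_bound_simps [simp]:
  "var_bound var_R = trials k" "var_bound ctr_trial = trials k" "var_bound var_P = 2 ^ K" "var_bound ctr_subset = 2 ^ K"
  "var_bound tmp_mask = 2 ^ K + trials k" "var_bound tmp_binom = 2 ^ K + trials k"
  "var_bound var_n = small" "var_bound var_k = small" "var_bound (Suc 0) = small"
  "\<lbrakk>numeral x \<noteq> var_R; numeral x \<noteq> ctr_trial; numeral x \<noteq> var_P; numeral x \<noteq> ctr_subset; numeral x \<noteq> tmp_mask; numeral x \<noteq> tmp_binom\<rbrakk>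
    \<Longrightarrow> var_bound (numeral x) = small"
  by (simp_all add: var_bound_def)

lemma sample_correct:
  assumes "setup_done s"
  shows "hoare prog_sample s (\<lambda>t. vars t tmp_rand = coin_number wb (toss s) \<and> toss t = sdrop wb (toss s))"
proof -
  define s' where "s' = setV tmp_rand 0 s"
  have l: "vars s var_l = wb" using assms by (simp add: setup_done_def)
  have "hoare (HFor ctr_bit var_l (HFlip tmp_z ;; HAssign tmp_rand (IPlus (ITimes (INum 2) (Rd tmp_rand)) (Rd tmp_z)))) s'
      (\<lambda>t. vars t tmp_rand = coin_number wb (toss s) \<and> toss t = sdrop wb (toss s))"
  proof (rule hoare_For[where I = "\<lambda>l t. vars t tmp_rand = coin_number l (toss s) \<and> toss t = sdrop l (toss s)"], goal_cases)
    case (3 l t)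
    then have "l < wb" using l by (simp add: s'_def)
    have "coin_number (Suc l) (toss s) < 2 ^ Suc l" by (rule coin_number_less)
    also have "\<dots> \<le> (2::nat) ^ wb" using \<open>l < wb\<close> by (intro power_increasing) auto
    also have "\<dots> \<le> small" by (simp add: small_def max_weight_def)
    finally have "coin_number (Suc l) (toss s) \<le> small" by simp
    moreover have "1 \<le> small" by (simp add: small_def)
    ultimately show ?case using 3
      by (simp add: hoare_simps snth.simps sdrop_stl[symmetric] del: sdrop_stl)
  qed (use l in \<open>simp_all add: s'_def\<close>)
  then show ?thesis unfolding prog_sample_def by (simp add: hoare_simps s'_def)
qed

text \<open>Each variable consumes two numbers of \<open>wb\<close> coins in the order in which they
  are read: the \<open>i\<close>-th color starts at coin \<open>2 * i * wb\<close>, the weight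
  follows directly. A trial uses \<open>block\<close> coins.\<close>

definition color :: "bool stream \<Rightarrow> nat \<Rightarrow> nat" where
  "color w i = coin_number wb (sdrop (2 * i * wb) w) mod K"

definition weight :: "bool stream \<Rightarrow> nat \<Rightarrow> nat" where
  "weight w i = coin_number wb (sdrop ((2 * i + 1) * wb) w)"

lemma num_colors_pos: "0 < K" and num_colors_gt: "k < K"
  by (auto simp: num_colors_def num_groups_def)

lemma color_less: "color w i < K"
  using num_colors_pos by (simp add: color_def)

lemma weight_less: "weight w i < W"
  by (simp add: weight_def max_weight_def coin_number_less)

definition drawn :: "bool stream \<Rightarrow> 'f store \<Rightarrow> bool" where
  "drawn w s \<longleftrightarrow> (\<forall>i<n. arr s i = 2 ^ color w i) \<and> (\<forall>i<n. arr s (n + i) = weight w i)"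

lemma mask_correct:
  assumes "vars s tmp_color = c" "vars s tmp_mask = 1" "c \<le> K"
  shows "hoare (HFor ctr_bit tmp_color (HAssign tmp_mask (ITimes (INum 2) (Rd tmp_mask)))) s (\<lambda>t. vars t tmp_mask = 2 ^ c)"
proof (rule hoare_For[where I = "\<lambda>i t. vars t tmp_mask = 2 ^ i"], goal_cases)
  case (3 i t)
  then have "2 ^ Suc i \<le> (2::nat) ^ K" using assms by (intro power_increasing) auto
  then show ?case using 3 by (simp add: hoare_simps)
qed (use assms in simp_all)

lemma draw_correct:
  assumes "setup_done s"
  shows "hoare prog_draw s (\<lambda>t. drawn (toss s) t \<and> toss t = sdrop block (toss s))"
  unfolding prog_draw_def
proof (rule hoare_For[where I = "\<lambda>i t. (\<forall>i'<i. arr t i' = 2 ^ color (toss s) i') \<and>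
     (\<forall>i'<i. arr t (n + i') = weight (toss s) i') \<and> toss t = sdrop (2 * i * wb) (toss s)"], goal_cases)
  case (3 i t)
  let ?c = "color (toss s) i" and ?w = "weight (toss s) i"
  let ?I = "\<lambda>t. (\<forall>i'<Suc i. arr t i' = 2 ^ color (toss s) i') \<and>
     (\<forall>i'<Suc i. arr t (n + i') = weight (toss s) i') \<and> toss t = sdrop (2 * Suc i * wb) (toss s)"
  have i: "i < n" using 3 assms by (simp add: setup_done_def)
  have cK: "?c < K" by (rule color_less)
  then have pow: "(2::nat) ^ ?c \<le> 2 ^ K" by (intro power_increasing) auto
  have cst: "setup_done (setV ctr_draw i t)"
    using 3(3) setup_done_agree[OF _ assms] by (auto simp: prog_sample_def)
  show ?case
  proof (rule hoare_Seq, rule hoare_conseq[OF sample_correct[OF cst]], goal_cases)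
    case (1 t1)
    have cst1: "setup_done t1"
      using 1(2) by (rule setup_done_agree[OF _ cst]) (auto simp: prog_sample_def)
    have c: "vars t1 tmp_rand mod K = ?c" using 1 3 by (simp add: color_def)
    have ctr_draw: "vars t1 ctr_draw = i" and A1: "arr t1 = arr t" using 1 by (auto simp: agree_def prog_sample_def)
    define t2 where "t2 = setV tmp_mask 1 (setV tmp_color ?c t1)"
    have cst2: "setup_done t2" using cst1 by (simp add: t2_def)
    have "hoare (HFor ctr_bit tmp_color (HAssign tmp_mask (ITimes (INum 2) (Rd tmp_mask))) ;; HAStore (Rd ctr_draw) (Rd tmp_mask) ;;
        prog_sample ;; HAStore (IPlus (Rd var_n) (Rd ctr_draw)) (Rd tmp_rand)) t2 ?I"
    proof (rule hoare_Seq, rule hoare_conseq[OF mask_correct[of _ ?c]], goal_cases)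
      case (4 t3)
      define t4 where "t4 = setA i (2 ^ ?c) t3"
      have "setup_done t3" using setup_done_agree[OF 4(2) cst2] by simp
      then have cst4: "setup_done t4" by (simp add: t4_def)
      have ii3: "vars t3 ctr_draw = i" and A3: "arr t3 = arr t" and Co3: "toss t3 = toss t1"
        using 4 ctr_draw A1 by (auto simp: agree_def t2_def)
      have "hoare (prog_sample ;; HAStore (IPlus (Rd var_n) (Rd ctr_draw)) (Rd tmp_rand)) t4 ?I"
      proof (rule hoare_Seq, rule hoare_conseq[OF sample_correct[OF cst4]], goal_cases)
        case (1 t5)
        have "setup_done t5"
          using 1(2) by (rule setup_done_agree[OF _ cst4]) (auto simp: prog_sample_def)
        then have "arr t5 = (arr t)(i := 2 ^ ?c)" "vars t5 ctr_draw = i" "vars t5 var_n = n"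
          using 1(2) ii3 A3 by (auto simp: agree_def prog_sample_def t4_def setup_done_def)
        moreover have "vars t5 tmp_rand = ?w" "toss t5 = sdrop (2 * Suc i * wb) (toss s)"
          using 1(1) Co3 \<open>vars t1 tmp_rand = _ \<and> _\<close> \<open>_ \<and> _ \<and> toss t = _\<close>
          by (simp_all add: t4_def weight_def algebra_simps)
        moreover have "?w \<le> arr_bound"
          using weight_less[of "toss s" i] by (simp add: arr_bound_def small_def)
        ultimately show ?case unfolding hoare_simps using i 3(2) by (auto simp: arr_size_def less_Suc_eq)
      qed
      moreover have "i < arr_size" using i by (simp add: arr_size_def)
      moreover have "2 ^ ?c \<le> arr_bound" unfolding arr_bound_def using pow by linarith
      ultimately show ?case using 4(1) ii3 by (simp add: hoare_simps t4_def)
    qed (use cK in \<open>simp_all add: t2_def\<close>)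
    moreover have "vars t1 var_K = K" using cst1 by (simp add: setup_done_def)
    moreover have "?c \<le> small" using cK by (simp add: small_def)
    ultimately show ?case using c
      by (simp add: hoare_simps t2_def minus_div_mult_eq_mod Suc_le_eq)
  qed
next
  case (4 t)
  then show ?case using assms by (simp add: setup_done_def drawn_def)
qed (use assms in simp_all)

end

section \<open>Correctness of the program: one set of colors, one trial, the main loop\<close>

context kmmd
begin

lemma pos2K: "Suc 0 \<le> 2 ^ K + (x :: nat)"
  by (simp add: Suc_le_eq)

lemma zeros_correct:
  assumes "setup_done s" and S: "vars s ctr_subset = S"
  shows "hoare prog_zeros s (\<lambda>t. vars t tmp_z = zeros S K \<and> fld t sz = (-1) ^ zeros S K \<and>
     (\<forall>a. a \<noteq> sz \<longrightarrow> fld t a = fld s a))"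
proof -
  have c: "vars s var_s = sz" "vars s var_K = K" using assms by (auto simp: setup_done_def)
  have nf: "sz < fld_size" by (simp add: fld_size_def)
  define s' where "s' = setF sz 1 (setV tmp_mask 1 (setV tmp_z 0 s))"
  have "hoare (HFor ctr_color var_K (
       HIf (odd_test (IDiv (Rd ctr_subset) (Rd tmp_mask))) HSkip
         (HAssign tmp_z (IPlus (Rd tmp_z) (INum 1)) ;; HFStore sgn_addr (FMinus FZero (FMem sgn_addr))) ;;
       HAssign tmp_mask (ITimes (INum 2) (Rd tmp_mask)))) s' (\<lambda>t. vars t tmp_z = zeros S K \<and> fld t sz = (-1) ^ zeros S K \<and>
     (\<forall>a. a \<noteq> sz \<longrightarrow> fld t a = fld s a))"
  proof (rule hoare_For[where I = "\<lambda>c t. vars t tmp_mask = 2 ^ c \<and> vars t tmp_z = zeros S c \<and>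
      fld t sz = (-1) ^ zeros S c \<and> (\<forall>a. a \<noteq> sz \<longrightarrow> fld t a = fld s a)"], goal_cases)
    case (3 c t)
    then have "c < K" using c by (simp add: s'_def)
    have "2 ^ Suc c \<le> (2::nat) ^ K" using \<open>c < K\<close> by (intro power_increasing) auto
    then have "2 * 2 ^ c \<le> 2 ^ K + trials k" by simp
    moreover have "Suc (zeros S c) \<le> small"
      using zeros_le[of S c] \<open>c < K\<close> by (simp add: small_def)
    moreover have "vars t ctr_subset = S" "vars t var_s = sz" using 3 c S by (auto simp: agree_def s'_def)
    ultimately show ?case using 3 nf by (simp add: hoare_simps sgn_addr_def)
  qed (use c S in \<open>simp_all add: s'_def\<close>)
  then show ?thesis
    unfolding prog_zeros_def using nf c pos2K
    by (simp add: hoare_simps s'_def sgn_addr_def)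
qed

lemma binomial_le_bound:
  assumes "z \<le> K" shows "z choose i \<le> 2 ^ K"
proof -
  have "z choose i \<le> 2 ^ z" by (rule binomial_le_pow2)
  also have "\<dots> \<le> 2 ^ K" using assms by (intro power_increasing) auto
  finally show ?thesis .
qed

lemma binomial_correct:
  assumes "setup_done s" and "vars s tmp_z = z" "z \<le> K"
  shows "hoare prog_binomial s (\<lambda>t. vars t tmp_binom = z choose q)"
proof -
  have c: "vars s var_q = q" using assms by (auto simp: setup_done_def)
  define s' where "s' = setV tmp_binom 1 s"
  have "hoare (HFor ctr_color var_q (HAssign tmp_binom
       (IDiv (ITimes (Rd tmp_binom) (IMinus (Rd tmp_z) (Rd ctr_color))) (IPlus (Rd ctr_color) (INum 1))))) s'
       (\<lambda>t. vars t tmp_binom = z choose q)"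
  proof (rule hoare_For[where I = "\<lambda>i t. vars t tmp_binom = z choose i"], goal_cases)
    case (3 i t)
    \<comment> \<open>This makes the integer division of the program exact. For
      \<open>i \<ge> z\<close> the truncated subtraction yields 0, which is the correct value of the
      next binomial coefficient.\<close>
    have "(z choose i) * (z - i) = (z choose Suc i) * Suc i"
      by (metis binomial_absorb_comp binomial_absorption mult.commute)
    then have "(z choose i) * (z - i) div Suc i = z choose Suc i" by (metis nonzero_mult_div_cancel_right nat.distinct(1))
    moreover have "vars t tmp_z = z" using 3 assms by (auto simp: agree_def s'_def)
    ultimately show ?case using 3 binomial_le_bound[OF assms(3), of "Suc i"] by (simp add: hoare_simps)
  qed (use c in \<open>simp_all add: s'_def\<close>)
  then show ?thesis
    unfolding prog_binomial_def using c pos2K by (simp add: hoare_simps s'_def)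
qed

lemma embed_correct:
  assumes "setup_done s" and b: "vars s tmp_binom = b" "b \<le> 2 ^ K"
  shows "hoare prog_embed s (\<lambda>t. fld t (sz + 1) = fld s sz * of_nat b \<and>
     (\<forall>a. a \<noteq> sz \<and> a \<noteq> sz + 1 \<longrightarrow> fld t a = fld s a))"
proof -
  have c: "vars s var_s = sz" "vars s var_K1 = K + 1" using assms by (auto simp: setup_done_def)
  have nf: "sz < fld_size" "Suc sz < fld_size" by (simp_all add: fld_size_def)
  define s' where "s' = setF (sz + 1) 0 s"
  have "hoare (HFor ctr_color var_K1 (
       HIf (odd_test (Rd tmp_binom)) (HFStore coef_addr (FPlus (FMem coef_addr) (FMem sgn_addr))) HSkip ;;
       HFStore sgn_addr (FPlus (FMem sgn_addr) (FMem sgn_addr)) ;;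
       HAssign tmp_binom (IDiv (Rd tmp_binom) (INum 2)))) s'
      (\<lambda>t. fld t (sz + 1) = fld s sz * of_nat b \<and> (\<forall>a. a \<noteq> sz \<and> a \<noteq> sz + 1 \<longrightarrow> fld t a = fld s a))"
  \<comment> \<open>After \<open>i\<close> rounds the \<open>i\<close> lowest digits of
    \<open>b\<close> have been transferred, and the cell of the sign holds the value of the next
    digit.\<close>
  proof (rule hoare_For[where I = "\<lambda>i t. vars t tmp_binom = b div 2 ^ i \<and> fld t sz = fld s sz * 2 ^ i \<and>
     fld t (sz + 1) = fld s sz * of_nat (b mod 2 ^ i) \<and> (\<forall>a. a \<noteq> sz \<and> a \<noteq> sz + 1 \<longrightarrow> fld t a = fld s a)"], goal_cases)
    case (3 i t)
    have "b div 2 ^ Suc i \<le> b" by simp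
    also have "\<dots> \<le> 2 ^ K + trials k" using b by simp
    finally have "b div 2 ^ Suc i \<le> 2 ^ K + trials k" .
    moreover have "b div 2 ^ i div 2 = b div 2 ^ Suc i" by (simp add: div_mult2_eq[symmetric] mult.commute)
    moreover have "b mod 2 ^ Suc i = b mod 2 ^ i + of_bool (odd (b div 2 ^ i)) * 2 ^ i"
      by (simp add: mod_mult2_eq[of b "2 ^ i" 2, unfolded mult.commute[of "2 ^ i" 2]] mod_2_eq_odd)
    moreover have "vars t var_s = sz" using 3 c by (auto simp: agree_def s'_def)
    ultimately show ?case using 3 nf
      by (simp add: hoare_simps sgn_addr_def coef_addr_def algebra_simps)
  next
    case (4 t)
    \<comment> \<open>The value \<open>2 ^ K\<close> itself is allowed and has \<open>K + 1\<close>
      digits, hence \<open>K + 1\<close> rounds.\<close>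
    have "b < 2 ^ (K + 1)" using b by (simp add: le_less_trans)
    then show ?case using 4 c by (simp add: s'_def)
  qed (use c b in \<open>simp_all add: s'_def\<close>)
  then show ?thesis
    unfolding prog_embed_def using nf c by (simp add: hoare_simps s'_def coef_addr_def)
qed

definition vec_addr :: "nat \<Rightarrow> nat \<Rightarrow> nat" where
  "vec_addr j e = sz + 2 + (j + 1) * L + e"

lemma vec_addr_less: "j < sz \<Longrightarrow> e < L \<Longrightarrow> vec_addr j e < fld_size"
proof -
  assume "j < sz" "e < L"
  then have "(j + 1) * L + e < (j + 2) * L" by (simp add: algebra_simps)
  also have "\<dots> \<le> (sz + 1) * L" using \<open>j < sz\<close> by (intro mult_right_mono) auto
  finally show ?thesis by (simp add: vec_addr_def fld_size_def)
qed

lemma vec_addr_before: "j' < j \<Longrightarrow> e' < L \<Longrightarrow> vec_addr j' e' < vec_addr j e"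
proof -
  assume "j' < j" "e' < L"
  then have "(j' + 1) * L + e' < (j' + 2) * L" by (simp add: algebra_simps)
  also have "\<dots> \<le> (j + 1) * L" using \<open>j' < j\<close> by (intro mult_right_mono) auto
  finally show ?thesis by (simp add: vec_addr_def)
qed

lemma ival_vec:
  "vars s var_s = sz \<Longrightarrow> vars s var_L = L \<Longrightarrow> ival (vec g e) (conc s) = vec_addr (ival g (conc s)) (ival e (conc s))"
  by (simp add: vec_def acc_def vec_addr_def)

lemma ival_code_cell:
  assumes "inputs s = inp" "vars s ctr_gate = j" "j < sz" "i < 3"
  shows "ival (code_cell i) (conc s) = gate_code (C ! j) ! i"
proof -
  have l: "low s = 3 + 3 * sz"
    using assms(1) by (simp add: low_def inp_def) (simp add: input_ints_def numeral_2_eq_2)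
  have "ival (code_cell i) (conc s) = inputs s (3 + 3 * j + i)"
    unfolding code_cell_def using assms l by (subst ival_input) (simp_all add: add_ac)
  also have "\<dots> = gate_code (C ! j) ! i"
    using assms nth_input_ints[of j C i n k] by (simp add: inp_def)
  finally show ?thesis .
qed


definition sel :: "bool stream \<Rightarrow> nat \<Rightarrow> nat \<Rightarrow> bool" where
  "sel w S i \<longleftrightarrow> odd (S div 2 ^ color w i)"

definition expo :: "bool stream \<Rightarrow> nat \<Rightarrow> nat" where
  "expo w i = D + weight w i"

abbreviation gvals :: "bool stream \<Rightarrow> nat \<Rightarrow> 'f poly list" where
  "gvals w S \<equiv> gate_vals (sel w S) (expo w) C"

definition scalars :: "'f store \<Rightarrow> bool" where
  "scalars s \<longleftrightarrow> (\<forall>a<sz. fld s a = gate_scalar (C ! a))"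

definition vecs_done :: "bool stream \<Rightarrow> nat \<Rightarrow> nat \<Rightarrow> 'f store \<Rightarrow> bool" where
  "vecs_done w S j s \<longleftrightarrow> (\<forall>a<j. \<forall>e<L. fld s (vec_addr a e) = coeff (gvals w S ! a) e)"

lemma entry_correct:
  assumes cst: "setup_done s" and dr: "drawn w s" and sc: "scalars s" and vd: "vecs_done w S j s"
    and vars: "vars s ctr_subset = S" "vars s ctr_gate = j" "vars s ctr_exp = e" "vars s tmp_op = gate_code (C ! j) ! 0"
      "vars s tmp_arg1 = gate_code (C ! j) ! 1" "vars s tmp_arg2 = gate_code (C ! j) ! 2"
    and j: "j < sz" and e: "e < L"
  shows "hoare prog_entry s (\<lambda>t. fld t (vec_addr j e) = coeff (gvals w S ! j) e \<and>
     (\<forall>a. a \<noteq> vec_addr j e \<longrightarrow> fld t a = fld s a))"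
proof -
  have c: "vars s var_s = sz" "vars s var_L = L" "vars s var_D = D" "vars s var_n = n" using cst by (auto simp: setup_done_def)
  have gv: "gvals w S ! j = gate_val (sel w S) (expo w) (gvals w S) (C ! j)"
    using wf j by (rule gate_vals_nth)
  have wfg: "wf_gate n j (C ! j)" using wf j by (simp add: wf_circuit_def)
  have nf: "vec_addr j e < fld_size" using j e by (rule vec_addr_less)
  note [simp] = ival_vec[OF c(1,2)] vars c nf
  show ?thesis
  proof (cases "C ! j")
    case (Var i)
    then have "arr s i = 2 ^ color w i" "arr s (n + i) = weight w i"
      using wfg dr by (simp_all add: drawn_def)
    then show ?thesis unfolding prog_entry_def using Var gv
      by (simp add: hoare_simps sel_def expo_def not_less)
  next
    case (Const x)
    then have "fld s j = x" using sc j by (simp add: scalars_def)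
    then show ?thesis unfolding prog_entry_def using Const gv nf
      by (cases e) (simp_all add: hoare_simps coeff_pCons)
  next
    case (Add a b)
    then have "a < j" "b < j" using wfg by simp_all
    then show ?thesis unfolding prog_entry_def using Add gv vd e
      by (simp add: hoare_simps vecs_done_def)
  next
    case (Mul a b)
    then have ab: "a < j" "b < j" using wfg by simp_all
    define s' where "s' = setV tmp_len (Suc e) (setF (vec_addr j e) 0 s)"
    have "hoare (HFor ctr_conv tmp_len (HFStore (vec (Rd ctr_gate) (Rd ctr_exp))
          (FPlus (FMem (vec (Rd ctr_gate) (Rd ctr_exp)))
            (FTimes (FMem (vec (Rd tmp_arg1) (Rd ctr_conv))) (FMem (vec (Rd tmp_arg2) (IMinus (Rd ctr_exp) (Rd ctr_conv)))))))) s'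
       (\<lambda>t. fld t (vec_addr j e) = coeff (gvals w S ! j) e \<and>
         (\<forall>a. a \<noteq> vec_addr j e \<longrightarrow> fld t a = fld s a))"
    proof (rule hoare_For[where I = "\<lambda>d t. fld t (vec_addr j e) =
          (\<Sum>d'<d. coeff (gvals w S ! a) d' * coeff (gvals w S ! b) (e - d')) \<and>
        (\<forall>a. a \<noteq> vec_addr j e \<longrightarrow> fld t a = fld s a)"], goal_cases)
      case (3 d t)
      have d: "d < Suc e" using 3 by (simp add: s'_def)
      have c': "vars t var_s = sz" "vars t var_L = L" "vars t ctr_gate = j" "vars t ctr_exp = e" "vars t tmp_arg1 = a" "vars t tmp_arg2 = b"
        using 3 Mul by (auto simp: agree_def s'_def)
      \<comment> \<open>The operands belong to earlier gates, so their cells differ from the one in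
        which the convolution is accumulated.\<close>
      have "vec_addr a d < vec_addr j e" "vec_addr b (e - d) < vec_addr j e"
        using d e by (intro vec_addr_before ab; simp)+
      then have "fld t (vec_addr a d) = coeff (gvals w S ! a) d"
        "fld t (vec_addr b (e - d)) = coeff (gvals w S ! b) (e - d)"
        using 3 vd ab d e by (simp_all add: vecs_done_def)
      then show ?case using 3 c' by (simp add: hoare_simps ival_vec)
    next
      case (4 t)
      have "coeff (gvals w S ! j) e = (\<Sum>d'<Suc e. coeff (gvals w S ! a) d' * coeff (gvals w S ! b) (e - d'))"
        using gv Mul by (simp only: gate_val.simps coeff_mult lessThan_Suc_atMost)
      then show ?case using 4 by (simp add: s'_def)
    qed (auto simp: s'_def)
    moreover have "Suc e \<le> small" using e by (simp add: small_def)
    ultimately show ?thesis unfolding prog_entry_def using Mul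
      by (simp add: hoare_simps s'_def)
  qed
qed

lemma gate_correct:
  assumes cst: "setup_done s" and dr: "drawn w s" and sc: "scalars s" and vd: "vecs_done w S j s"
    and vars: "vars s ctr_subset = S" "vars s ctr_gate = j" and j: "j < sz"
  shows "hoare prog_gate s (\<lambda>t. vecs_done w S (Suc j) t \<and> (\<forall>a < vec_addr 0 0. fld t a = fld s a))"
proof -
  let ?g = "gate_code (C ! j)"
  define s1 where "s1 = setV tmp_op (?g ! 0) s"
  define s2 where "s2 = setV tmp_arg1 (?g ! 1) s1"
  define s3 where "s3 = setV tmp_arg2 (?g ! 2) s2"
  have inp: "inputs s = inp" "inputs s1 = inp" "inputs s2 = inp"
    using cst by (simp_all add: setup_done_def s1_def s2_def)
  have ctr_gate: "vars s1 ctr_gate = j" "vars s2 ctr_gate = j" using vars by (simp_all add: s1_def s2_def)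
  have cells: "ival (code_cell 0) (conc s) = ?g ! 0" "ival (code_cell 1) (conc s1) = ?g ! 1"
    "ival (code_cell 2) (conc s2) = ?g ! 2"
    using ival_code_cell[OF inp(1) vars(2) j, of 0] ival_code_cell[OF inp(2) ctr_gate(1) j, of 1]
      ival_code_cell[OF inp(3) ctr_gate(2) j, of 2] by simp_all
  have "wf_gate n j (C ! j)" using wf j by (simp add: wf_circuit_def)
  then have b: "?g ! 0 \<le> small" "?g ! 1 \<le> small" "?g ! 2 \<le> small"
    using j by (cases "C ! j"; simp add: small_def)+
  have cst3: "setup_done s3" using cst by (simp add: s1_def s2_def s3_def)
  have "hoare (HFor ctr_exp var_L prog_entry) s3
     (\<lambda>t. vecs_done w S (Suc j) t \<and> (\<forall>a < vec_addr 0 0. fld t a = fld s a))"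
  proof (rule hoare_For[where I = "\<lambda>e t. (\<forall>e'<e. fld t (vec_addr j e') = coeff (gvals w S ! j) e') \<and>
       (\<forall>a < vec_addr j 0. fld t a = fld s a)"], goal_cases)
    case (3 e t)
    have e: "e < L" using 3(1) cst3 by (simp add: setup_done_def)
    let ?t = "setV ctr_exp e t"
    have agr: "vars t ctr_subset = S" "vars t ctr_gate = j" "vars t tmp_op = ?g ! 0" "vars t tmp_arg1 = ?g ! 1" "vars t tmp_arg2 = ?g ! 2" "arr t = arr s"
      using 3(3) vars by (auto simp: agree_def prog_entry_def s1_def s2_def s3_def)
    have "setup_done t" using 3(3) by (rule setup_done_agree[OF _ cst3]) (auto simp: prog_entry_def)
    then have cst': "setup_done ?t" by simp
    have before: "a < vec_addr j 0 \<Longrightarrow> fld ?t a = fld s a" for a using 3 by simp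
    have "a < sz \<Longrightarrow> a < vec_addr j 0" for a by (simp add: vec_addr_def)
    then have sc': "scalars ?t" using sc before by (simp add: scalars_def)
    have vd': "vecs_done w S j ?t"
      using vd before vec_addr_before[of _ j _ 0] by (simp add: vecs_done_def)
    have "drawn w ?t" using dr agr by (simp add: drawn_def)
    from entry_correct[OF cst' this sc' vd' _ _ _ _ _ _ j e] agr
    have "hoare prog_entry ?t (\<lambda>t'. fld t' (vec_addr j e) = coeff (gvals w S ! j) e \<and>
      (\<forall>a. a \<noteq> vec_addr j e \<longrightarrow> fld t' a = fld ?t a))" by simp
    then show ?case
    proof (rule hoare_conseq, goal_cases)
      case (1 t')
      have "fld t' (vec_addr j e') = coeff (gvals w S ! j) e'" if "e' < Suc e" for e'
        using 1(1) 3(2) that by (cases "e' = e") (auto simp: vec_addr_def)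
      moreover have "fld t' a = fld s a" if "a < vec_addr j 0" for a
        using 1(1) 3(2) that by (auto simp: vec_addr_def)
      ultimately show ?case by blast
    qed
  next
    case (4 t)
    have L: "vars s3 var_L = L" using cst3 by (simp add: setup_done_def)
    have "fld t (vec_addr a e) = coeff (gvals w S ! a) e" if "a < Suc j" "e < L" for a e
      using 4(1) L that vd vec_addr_before[of a j e 0] by (cases "a = j") (auto simp: vecs_done_def)
    moreover have "vec_addr 0 0 \<le> vec_addr j 0" by (simp add: vec_addr_def)
    ultimately show ?case using 4(1) by (auto simp: vecs_done_def)
  qed (use cst3 vars in \<open>simp_all add: s1_def s2_def s3_def\<close>)
  then show ?thesis
    unfolding prog_gate_def hoare_simps cells b var_bound_simps using b cells
    by (simp add: hoare_simps s1_def s2_def s3_def)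
qed

lemma subset_coef_correct:
  assumes cst: "setup_done s" and S: "vars s ctr_subset = S"
  shows "hoare (prog_zeros ;; prog_binomial ;; prog_embed) s (\<lambda>t. fld t (sz + 1) = subset_coef K q S \<and>
     (\<forall>a. a \<noteq> sz \<and> a \<noteq> sz + 1 \<longrightarrow> fld t a = fld s a))"
proof (rule hoare_Seq, rule hoare_conseq[OF zeros_correct[OF cst S]], goal_cases)
  case (1 t1)
  have cst1: "setup_done t1"
    using 1(2) by (rule setup_done_agree[OF _ cst]) (auto simp: prog_zeros_def)
  show ?case
  proof (rule hoare_Seq, rule hoare_conseq[OF binomial_correct[OF cst1 refl]], goal_cases)
    case 1
    then show ?case using \<open>vars t1 tmp_z = zeros S K \<and> _\<close> zeros_le[of S K] by simp
  next
    case (2 t2)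
    have cst2: "setup_done t2"
      using 2(2) by (rule setup_done_agree[OF _ cst1]) (auto simp: prog_binomial_def)
    have F2: "fld t2 = fld t1" using 2(2) by (simp add: agree_def prog_binomial_def)
    have z: "vars t1 tmp_z = zeros S K" using 1 by simp
    have "vars t2 tmp_binom \<le> 2 ^ K" using 2 z zeros_le[of S K] by (simp add: binomial_le_bound)
    from embed_correct[OF cst2 refl this] show ?case
      by (rule hoare_conseq) (use 1 2 F2 z in \<open>auto simp: subset_coef_def\<close>)
  qed
qed


lemma subset_correct:
  assumes cst: "setup_done s" and dr: "drawn w s" and sc: "scalars s" and S: "vars s ctr_subset = S"
  shows "hoare prog_subset s (\<lambda>t. scalars t \<and>
     (\<forall>e<L. fld t (sz + 2 + e) = fld s (sz + 2 + e) + subset_coef K q S * coeff (last (gvals w S)) e))"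
proof -
  \<comment> \<open>Sequencing nests to the right; the first three programs are bracketed so that
    \<open>subset_coef_correct\<close> applies to them as a whole.\<close>
  have assoc: "hoare prog_subset s Q = hoare ((prog_zeros ;; prog_binomial ;; prog_embed) ;;
     HFor ctr_gate var_s prog_gate ;;
     HFor ctr_exp var_L (HFStore (acc (Rd ctr_exp))
       (FPlus (FMem (acc (Rd ctr_exp)))
         (FTimes (FMem coef_addr) (FMem (vec (IMinus (Rd var_s) (INum 1)) (Rd ctr_exp))))))) s Q" for Q
    by (simp add: hoare_simps prog_subset_def)
  have sz: "0 < sz" and last: "last (gvals w S) = gvals w S ! (sz - 1)"
    using wf by (auto simp: wf_circuit_def last_conv_nth simp flip: length_greater_0_conv)
  show ?thesis unfolding assoc
  proof (rule hoare_Seq, rule hoare_conseq[OF subset_coef_correct[OF cst S]], goal_cases)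
    case (1 t1)
    let ?c = "subset_coef K q S :: 'f"
    have cst1: "setup_done t1"
      using 1(2) by (rule setup_done_agree[OF _ cst])
        (auto simp: prog_zeros_def prog_binomial_def prog_embed_def)
    have S1: "vars t1 ctr_subset = S" and A1: "arr t1 = arr s"
      using 1(2) S by (auto simp: agree_def prog_zeros_def prog_binomial_def prog_embed_def)
    have F1: "fld t1 (sz + 1) = ?c" and F1': "a \<noteq> sz \<Longrightarrow> a \<noteq> sz + 1 \<Longrightarrow> fld t1 a = fld s a" for a
      using 1(1) by auto
    show ?case
    proof (rule hoare_Seq, rule hoare_For[where I = "\<lambda>j t. vecs_done w S j t \<and>
         (\<forall>a < vec_addr 0 0. fld t a = fld t1 a)"], goal_cases)
      case (3 j t)
      have j: "j < sz" using 3(1) cst1 by (simp add: setup_done_def)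
      have "setup_done t" using 3(3) by (rule setup_done_agree[OF _ cst1])
        (auto simp: prog_gate_def prog_entry_def)
      then have "setup_done (setV ctr_gate j t)" by simp
      moreover have "drawn w (setV ctr_gate j t)" "vars (setV ctr_gate j t) ctr_subset = S"
        using 3(3) dr A1 S1 by (auto simp: agree_def drawn_def prog_gate_def prog_entry_def)
      moreover have "scalars (setV ctr_gate j t)"
        using 3(2) sc F1' by (auto simp: scalars_def vec_addr_def)
      moreover have "vecs_done w S j (setV ctr_gate j t)" using 3(2) by (simp add: vecs_done_def)
      ultimately have "hoare prog_gate (setV ctr_gate j t) (\<lambda>t'. vecs_done w S (Suc j) t' \<and>
         (\<forall>a < vec_addr 0 0. fld t' a = fld (setV ctr_gate j t) a))"
        using j by (intro gate_correct) auto
      then show ?case by (rule hoare_conseq) (use 3(2) in auto)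
    next
      case (4 t2)
      have cst2: "setup_done (setV ctr_gate 0 t2)" using setup_done_agree[OF 4(2) cst1]
        by (auto simp: prog_gate_def prog_entry_def)
      have vd: "vecs_done w S sz t2" using 4(1) cst1 by (simp add: setup_done_def)
      have c: "vars t2 var_s = sz" "vars t2 var_L = L" using cst2 by (auto simp: setup_done_def)
      have F2: "fld t2 a = fld t1 a" if "a < sz + 2 + L" for a
        using 4(1) that by (simp add: vec_addr_def)
      show ?case
      proof (rule hoare_For[where I = "\<lambda>e t. (\<forall>e'<e. fld t (sz + 2 + e') = fld s (sz + 2 + e') +
             ?c * coeff (last (gvals w S)) e') \<and>
           (\<forall>a. a < sz + 2 \<or> sz + 2 + e \<le> a \<longrightarrow> fld t a = fld t2 a)"], goal_cases)
        case (3 e t)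
        have e: "e < L" using 3(1) c by simp
        have c': "vars t var_s = sz" "vars t var_L = L" using 3(3) c by (auto simp: agree_def)
        have nf: "sz + 2 + e < fld_size" using e by (simp add: fld_size_def)
        have "fld t (vec_addr (sz - 1) e) = coeff (last (gvals w S)) e"
        proof -
          have "sz + 2 + e \<le> vec_addr (sz - 1) e" by (simp add: vec_addr_def)
          then have "fld t (vec_addr (sz - 1) e) = fld t2 (vec_addr (sz - 1) e)" using 3(2) by simp
          then show ?thesis using vd sz e last by (simp add: vecs_done_def)
        qed
        moreover have "fld t (sz + 1) = ?c" "fld t (sz + 2 + e) = fld s (sz + 2 + e)"
          using 3(2) F2[of "sz + 1"] F2[of "sz + 2 + e"] F1 F1' e by simp_all
        ultimately show ?case using 3(2) c' nf
          by (auto simp: hoare_simps ival_vec acc_def coef_addr_def less_Suc_eq)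
      next
        case (4 t)
        have "scalars t" using 4(1) F2 F1' sc by (simp add: scalars_def)
        then show ?case using 4(1) c by (simp add: scalars_def)
      qed simp_all
    qed (use cst1 in \<open>simp_all add: vecs_done_def\<close>)
  qed
qed

definition score :: "bool stream \<Rightarrow> nat \<Rightarrow> 'f" where
  "score w e = (\<Sum>S<2 ^ K. subset_coef K q S * coeff (last (gvals w S)) e)"

definition hit :: "bool stream \<Rightarrow> bool" where
  "hit w \<longleftrightarrow> (\<exists>e<D. score w (k * D + e) \<noteq> 0)"

lemma trial_correct:
  assumes cst: "setup_done s" and sc: "scalars s" and fd: "vars s var_found = of_bool b"
  shows "hoare prog_trial s (\<lambda>t. scalars t \<and> toss t = sdrop block (toss s) \<and>
     vars t var_found = of_bool (b \<or> hit (toss s)))"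
  unfolding prog_trial_def
proof (rule hoare_Seq, rule hoare_conseq[OF draw_correct[OF cst]], goal_cases)
  case (1 t1)
  define w where "w = toss s"
  have cst1: "setup_done t1"
    using 1(2) by (rule setup_done_agree[OF _ cst]) (auto simp: prog_draw_def prog_sample_def)
  have fd1: "vars t1 var_found = of_bool b" and sc1: "scalars t1"
    using 1(2) fd sc by (auto simp: agree_def scalars_def prog_draw_def prog_sample_def)
  have dr1: "drawn w t1" and Co1: "toss t1 = sdrop block w" using 1(1) by (simp_all add: w_def)
  show ?case unfolding w_def[symmetric]
  proof (rule hoare_Seq, rule hoare_For[where I = "\<lambda>e t. (\<forall>e'<e. fld t (sz + 2 + e') = 0) \<and> scalars t"], goal_cases)
    case (3 e t)
    have e: "e < L" using 3(1) cst1 by (simp add: setup_done_def)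
    have c': "vars t var_s = sz" using 3(3) cst1 by (auto simp: agree_def setup_done_def)
    have "sz + 2 + e < fld_size" using e by (simp add: fld_size_def)
    then show ?case using 3(2) c' by (auto simp: hoare_simps acc_def less_Suc_eq scalars_def)
  next
    case (4 t2)
    have cst2: "setup_done (setV ctr_exp 0 t2)" using setup_done_agree[OF 4(2) cst1] by simp
    have fd2: "vars t2 var_found = of_bool b" and dr2: "drawn w t2" and Co2: "toss t2 = sdrop block w"
      using 4(2) fd1 dr1 Co1 by (auto simp: agree_def drawn_def)
    show ?case
    proof (rule hoare_Seq, rule hoare_For[where I = "\<lambda>S t. scalars t \<and> (\<forall>e<L. fld t (sz + 2 + e) =
          (\<Sum>S'<S. subset_coef K q S' * coeff (last (gvals w S')) e))"], goal_cases)
      case 2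
      then show ?case using 4(1) cst1 by (simp add: setup_done_def scalars_def)
    next
      case (3 S t)
      have "setup_done t" using 3(3) by (rule setup_done_agree[OF _ cst2])
        (auto simp: prog_defs)
      then have "setup_done (setV ctr_subset S t)" by simp
      moreover have "drawn w (setV ctr_subset S t)"
        using 3(3) dr2 by (auto simp: agree_def drawn_def prog_defs)
      ultimately have "hoare prog_subset (setV ctr_subset S t) (\<lambda>t'. scalars t' \<and>
         (\<forall>e<L. fld t' (sz + 2 + e) = fld (setV ctr_subset S t) (sz + 2 + e) +
           subset_coef K q S * coeff (last (gvals w S)) e))"
        using 3(2) by (intro subset_correct) (auto simp: scalars_def)
      then show ?case by (rule hoare_conseq) (use 3(2) in auto)
    next
      case (4 t3)
      have cst3: "setup_done (setV ctr_subset 0 t3)" using setup_done_agree[OF 4(2) cst2]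
        by (auto simp: prog_defs)
      have fd3: "vars t3 var_found = of_bool b" and Co3: "toss t3 = sdrop block w"
        using 4(2) fd2 Co2 by (auto simp: agree_def prog_defs)
      have F3: "fld t3 (sz + 2 + e) = score w e" if "e < L" for e
        using 4(1) cst2 that by (simp add: setup_done_def score_def)
      show ?case
      proof (rule hoare_For[where I = "\<lambda>e t. vars t var_found = of_bool (b \<or> (\<exists>e'<e. score w (k * D + e') \<noteq> 0))"], goal_cases)
        case (3 e t)
        have e: "e < D" using 3(1) cst3 by (simp add: setup_done_def)
        then have "k * D + e < L" by (simp add: trunc_def)
        then have "fld t (sz + 2 + (k * D + e)) = score w (k * D + e)"
          using 3(3) F3 by (simp add: agree_def)
        moreover have "vars t var_s = sz" "vars t var_k = k" "vars t var_D = D"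
          using 3(3) cst3 by (auto simp: agree_def setup_done_def)
        moreover have "1 \<le> small" by (simp add: small_def)
        ultimately show ?case using 3(2)
          by (auto simp: hoare_simps acc_def less_Suc_eq)
      next
        case (4 t4)
        have "toss t4 = sdrop block w" "scalars t4"
          using 4(2) Co3 \<open>scalars t3 \<and> _\<close> by (auto simp: agree_def scalars_def)
        then show ?case using 4(1) cst3 by (simp add: setup_done_def hit_def scalars_def)
      qed (use fd3 in simp_all)
    qed simp
  qed (use sc1 in simp_all)
qed

lemma trials_aux_mono: "16 \<le> r \<Longrightarrow> i \<le> i' \<Longrightarrow> trials_aux r i \<le> trials_aux r i'"
proof (rule lift_Suc_mono_le[of "trials_aux r"])
  fix i
  have "trials_aux r i \<le> trials_aux r i * 161 div 32" by linarith
  then show "trials_aux r i \<le> trials_aux r (Suc i)" by simp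
qed

lemma hoare_AssignI:
  "ival e (conc s) = v \<Longrightarrow> v \<le> var_bound x \<Longrightarrow> Q (setV x v s) \<Longrightarrow> hoare (HAssign x e) s Q"
  by (simp add: hoare_simps)

lemma ints_conc_header: "a < 3 \<Longrightarrow> ints (conc s) a = inputs s a"
  by (simp add: conc_def low_def)

text \<open>A bounded loop cannot stop early. It makes \<open>weight_target n k\<close> rounds,
  which suffice since \<open>log_ceil m \<le> m\<close>, and idles once the target is reached; hence
  \<open>min i wb\<close> in the invariant.\<close>

lemma setup_weight_correct:
  assumes "vars s var_X = weight_target n k" "vars s var_W = 1" "vars s var_l = 0"
  shows "hoare (HFor ctr_draw var_X (HIf (Less (Rd var_W) (Rd var_X))
       (HAssign var_W (ITimes (INum 2) (Rd var_W)) ;; HAssign var_l (IPlus (Rd var_l) (INum 1))) HSkip)) s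
     (\<lambda>t. vars t var_W = W \<and> vars t var_l = wb)"
proof (rule hoare_For[where I = "\<lambda>i t. vars t var_l = min i wb \<and> vars t var_W = 2 ^ vars t var_l"], goal_cases)
  case (3 i t)
  have Rd: "vars t var_X = weight_target n k" using 3(3) assms by (simp add: agree_def)
  have iff: "2 ^ min i wb < weight_target n k \<longleftrightarrow> i < wb"
    unfolding weight_bits_def less_log_ceil_iff by auto
  have "2 * 2 ^ i \<le> W" if "i < wb"
  proof -
    have "2 ^ Suc i \<le> (2::nat) ^ wb" using that by (intro power_increasing) auto
    then show ?thesis by (simp add: max_weight_def)
  qed
  then show ?case using 3(2) Rd iff by (auto simp: hoare_simps small_def)
next
  case (4 t)
  have "wb \<le> weight_target n k" unfolding weight_bits_def by (rule log_ceil)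
  then show ?case using 4(1) assms by (simp add: max_weight_def)
qed (use assms in simp_all)

lemma setup_power_correct:
  assumes "vars s var_K = K" "vars s tmp_binom = 1"
  shows "hoare (HFor ctr_draw var_K (HAssign tmp_binom (ITimes (INum 2) (Rd tmp_binom)))) s (\<lambda>t. vars t tmp_binom = 2 ^ K)"
proof (rule hoare_For[where I = "\<lambda>i t. vars t tmp_binom = 2 ^ i"], goal_cases)
  case (3 i t)
  then have "2 ^ Suc i \<le> (2::nat) ^ K" using assms by (intro power_increasing) auto
  then show ?case using 3 by (simp add: hoare_simps)
qed (use assms in simp_all)

lemma setup_trials_correct:
  assumes "vars s var_j = num_groups k" "vars s tmp_binom = 16 * num_groups k"
  shows "hoare (HFor ctr_draw var_j (HAssign tmp_binom (IPlus (IDiv (ITimes (Rd tmp_binom) (INum 161)) (INum 32)) (INum 1)))) s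
     (\<lambda>t. vars t tmp_binom = trials k)"
proof (rule hoare_For[where I = "\<lambda>i t. vars t tmp_binom = trials_aux (16 * num_groups k) i"], goal_cases)
  case (3 i t)
  then have "trials_aux (16 * num_groups k) (Suc i) \<le> trials k"
    using assms unfolding trials_def by (intro trials_aux_mono) (auto simp: num_groups_def)
  then show ?case using 3 by (simp add: hoare_simps)
qed (use assms in \<open>simp_all add: trials_def\<close>)

lemma setup_correct:
  assumes "inputs s = inp"
  shows "hoare prog_setup s (\<lambda>t. setup_done t \<and> vars t var_found = vars s var_found)"
proof -
  have inp: "inp 0 = n" "inp (Suc 0) = k" "inp 2 = sz"
    by (simp_all add: inp_def input_ints_def numeral_2_eq_2)
  let ?Q = "\<lambda>t. setup_done t \<and> vars t var_found = vars s var_found"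
  have j: "num_groups k \<le> K" by (simp add: num_colors_def)
  have DL: "D \<le> L" by (simp add: trunc_def)
  show ?thesis
    unfolding prog_setup_def
    apply (rule hoare_Seq, rule hoare_AssignI[where v = n], simp add: ints_conc_header assms inp, simp add: small_def)
    apply (rule hoare_Seq, rule hoare_AssignI[where v = k], simp add: ints_conc_header assms inp, simp add: small_def)
    apply (rule hoare_Seq, rule hoare_AssignI[where v = sz], simp add: ints_conc_header assms inp, simp add: small_def)
    apply (rule hoare_Seq, rule hoare_AssignI[where v = "num_groups k"], simp add: num_groups_def,
      use j in \<open>simp add: small_def\<close>)
    apply (rule hoare_Seq, rule hoare_AssignI[where v = K], simp add: num_colors_def, simp add: small_def)
    apply (rule hoare_Seq, rule hoare_AssignI[where v = "K + 1"], simp, simp add: small_def)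
    apply (rule hoare_Seq, rule hoare_AssignI[where v = q], simp, simp add: small_def)
    apply (rule hoare_Seq, rule hoare_AssignI[where v = "weight_target n k"], simp add: weight_target_def,
      simp add: small_def)
    apply (rule hoare_Seq, rule hoare_AssignI[where v = 1], simp, simp add: small_def)
    apply (rule hoare_Seq, rule hoare_AssignI[where v = 0], simp, simp)
    apply (rule hoare_Seq, rule hoare_conseq[OF setup_weight_correct], simp, simp, simp)
    apply (rule hoare_Seq, rule hoare_AssignI[where v = D], simp add: agree_def stride_def, use DL in \<open>simp add: small_def\<close>)
    apply (rule hoare_Seq, rule hoare_AssignI[where v = L], simp add: agree_def trunc_def, simp add: small_def)
    apply (rule hoare_Seq, rule hoare_AssignI[where v = 1], simp, simp add: Suc_le_eq)
    apply (rule hoare_Seq, rule hoare_conseq[OF setup_power_correct], simp add: agree_def, simp)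
    apply (rule hoare_Seq, rule hoare_AssignI[where v = "2 ^ K"], simp, simp)
    apply (rule hoare_Seq, rule hoare_AssignI[where v = "16 * num_groups k"], simp add: agree_def)
    subgoal using trials_aux_mono[of "16 * num_groups k" 0 "num_groups k"]
      by (simp add: trials_def num_groups_def)
    apply (rule hoare_Seq, rule hoare_conseq[OF setup_trials_correct], simp add: agree_def, simp)
    apply (rule hoare_AssignI[where v = "trials k"], simp, simp)
    apply (simp add: agree_def setup_done_def assms)
    done
qed

definition start :: "bool stream \<Rightarrow> 'f store" where
  "start w = \<lparr>inputs = inp, vars = (\<lambda>_. 0), arr = (\<lambda>_. 0),
     fld = (\<lambda>j. if j < sz then gate_scalar (C ! j) else 0), toss = w\<rparr>"

lemma conc_start: "conc (start w) = input_state n k C w"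
proof -
  have "low (start w) = 3 + 3 * sz" 
    by (simp add: low_def start_def inp_def input_ints_def numeral_2_eq_2)
  then show ?thesis
    by (auto simp: conc_def input_state_def start_def inp_def fun_eq_iff)
qed

lemma main_correct:
  "hoare prog_main (start w) (\<lambda>t. vars t var_found = of_bool (\<exists>r<trials k. hit (sdrop (r * block) w)))"
  unfolding prog_main_def
proof (rule hoare_Seq, rule hoare_conseq[OF setup_correct], simp add: start_def, goal_cases)
  case (1 s)
  have cst: "setup_done s" and fd: "vars s var_found = 0" using 1(1) by (simp_all add: start_def)
  have sc: "scalars s" and toss: "toss s = w"
    using 1(2) by (auto simp: agree_def scalars_def start_def prog_setup_def)
  show ?case
  proof (rule hoare_For[where I = "\<lambda>r t. scalars t \<and> toss t = sdrop (r * block) w \<and>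
     vars t var_found = of_bool (\<exists>r'<r. hit (sdrop (r' * block) w))"], goal_cases)
    case (3 r t)
    have "setup_done t" using 3(3) by (rule setup_done_agree[OF _ cst]) (auto simp: prog_defs)
    then have s: "setup_done (setV ctr_trial r t)" by simp
    have "scalars (setV ctr_trial r t)"
      "vars (setV ctr_trial r t) var_found = of_bool (\<exists>r'<r. hit (sdrop (r' * block) w))"
      using 3(2) by (simp_all add: scalars_def)
    from trial_correct[OF s this] show ?case
      by (rule hoare_conseq) (use 3(2) in \<open>auto simp: less_Suc_eq algebra_simps\<close>)
  next
    case (4 t)
    then show ?case using cst by (simp add: setup_done_def)
  qed (use sc toss fd in simp_all)
qed

end

section \<open>Running time of the program\<close>

context bounded
begin

text \<open>Since all bounds are at least 1, the overhead of 3 per iteration and 5 per loop can be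
  moved into the constant factor. The cost of nested loops then keeps the form of a constant times a
  product of bounds.\<close>

lemma cost_For_le:
  assumes "cost c \<le> a * y" "1 \<le> y" "1 \<le> bd u"
  shows "cost (HFor x u c) \<le> (a + 8) * (bd u * y)"
proof -
  have "bd u * (cost c + 3) \<le> bd u * (a * y + 3 * y)" using assms by (intro mult_left_mono) auto
  moreover have "1 * 1 \<le> bd u * y" using assms by (intro mult_mono) auto
  moreover have "(a + 8) * (bd u * y) = bd u * (a * y + 3 * y) + 5 * (bd u * y)"
    by (simp add: algebra_simps)
  ultimately show ?thesis unfolding cost.simps by linarith
qed

end

context kmmd
begin

lemma small_pos: "1 \<le> small"
  by (simp add: small_def)

lemma trials_pos: "1 \<le> trials k"
  using trials_aux_mono[of "16 * num_groups k" 0 "num_groups k"]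
  by (simp add: trials_def num_groups_def)

lemma cost_sample: "cost prog_sample \<le> 20 * small"
  using small_pos by (simp add: prog_sample_def)

lemma cost_draw: "cost prog_draw \<le> 80 * (small * small)"
proof -
  have "cost prog_draw \<le> (72 + 8) * (var_bound var_n * small)"
    unfolding prog_draw_def
    by (rule cost_For_le) (use cost_sample small_pos in simp_all)
  then show ?thesis by simp
qed

lemma cost_entry: "cost prog_entry \<le> 50 * small"
  using small_pos by (simp add: prog_entry_def)

lemma cost_gate: "cost prog_gate \<le> 70 * (small * small)"
proof -
  define y where "y = small * small"
  have "var_bound var_L = small" by simp
  then have "cost (HFor ctr_exp var_L prog_entry) \<le> 58 * y"
    unfolding y_def using cost_For_le[OF cost_entry, of var_L ctr_exp] small_pos by simp
  moreover have "1 \<le> y" unfolding y_def using small_pos by simp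
  moreover have "cost prog_gate = cost (HFor ctr_exp var_L prog_entry) + 6" by (simp add: prog_gate_def)
  ultimately show ?thesis unfolding y_def[symmetric] by linarith
qed

lemma cost_subset: "cost prog_subset \<le> 200 * (small * (small * small))"
proof -
  define y where "y = small * (small * small)"
  have 1: "small \<le> y" unfolding y_def using small_pos by simp
  have "var_bound var_s = small" by simp
  then have "cost (HFor ctr_gate var_s prog_gate) \<le> 78 * y"
    unfolding y_def using cost_For_le[OF cost_gate, of var_s ctr_gate] small_pos by simp
  moreover have "cost prog_subset \<le> cost (HFor ctr_gate var_s prog_gate) + 100 * small"
    using small_pos by (simp add: prog_subset_def prog_zeros_def prog_binomial_def prog_embed_def)
  ultimately show ?thesis using 1 unfolding y_def[symmetric] by linarith
qed

lemma cost_trial: "cost prog_trial \<le> 400 * (2 ^ K * (small * (small * small)))"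
proof -
  define z where "z = small * (small * small)"
  define y where "y = 2 ^ K * z"
  have "small * small \<le> z" using small_pos by (simp add: z_def)
  then have 1: "cost prog_draw \<le> 80 * z" using cost_draw by linarith
  have 2: "small \<le> z" unfolding z_def using small_pos by simp
  have "1 * z \<le> 2 ^ K * z" by (intro mult_right_mono) auto
  then have z: "z \<le> y" by (simp add: y_def)
  have "cost (HFor ctr_subset var_P prog_subset) \<le> 208 * y"
    unfolding y_def z_def using cost_For_le[OF cost_subset, of var_P ctr_subset] small_pos by simp
  moreover have "cost prog_trial \<le> cost prog_draw + cost (HFor ctr_subset var_P prog_subset) + 60 * small"
    using small_pos by (simp add: prog_trial_def)
  ultimately show ?thesis using 1 2 z unfolding z_def[symmetric] y_def[symmetric] by linarith
qed

lemma cost_main: "cost prog_main \<le> 600 * (trials k * (2 ^ K * (small * (small * small))))"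
proof -
  define z where "z = 2 ^ K * (small * (small * small))"
  define y where "y = trials k * z"
  have "small * 1 \<le> small * (small * small)" using small_pos by (intro mult_left_mono) auto
  also have "1 * (small * (small * small)) \<le> z" unfolding z_def by (intro mult_right_mono) auto
  finally have 1: "small \<le> z" by simp
  have "1 * z \<le> trials k * z" using trials_pos by (intro mult_right_mono) auto
  then have 2: "z \<le> y" by (simp add: y_def)
  have P: "1 \<le> z" using 1 small_pos by linarith
  have "cost (HFor ctr_trial var_R prog_trial) \<le> 408 * y"
    unfolding y_def z_def using cost_For_le[OF cost_trial, of var_R ctr_trial] P trials_pos by (simp add: z_def)
  moreover have "cost prog_setup \<le> 100 * small" using small_pos by (simp add: prog_setup_def)
  moreover have "cost prog_main = cost prog_setup + cost (HFor ctr_trial var_R prog_trial) + 1"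
    by (simp add: prog_main_def)
  ultimately show ?thesis using 1 2 P unfolding z_def[symmetric] y_def[symmetric] by linarith
qed

text \<open>The summand \<open>20 * K\<close> accommodates the exponential values, all built from
  \<open>2 ^ K\<close> and \<open>trials k \<le> 2 ^ (19 * K)\<close>. The other summands cover
  addresses and short variables, for which \<open>x < 2 ^ x\<close> is good enough.\<close>

definition cell_bits :: nat where
  "cell_bits = 20 * K + small + fld_size + 3 * sz + 2 * n + 50"

text \<open>Deliberately crude, with 8 in place of 161/32: it only serves to bound a number of bits.
  The running time relies on \<open>trials_aux_le_real\<close>.\<close>

lemma trials_aux_le: "trials_aux r i \<le> (r + 1) * 8 ^ i"
proof -
  have "trials_aux r i + 1 \<le> (r + 1) * 8 ^ i"
  proof (induction i)
    case (Suc i)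
    have "trials_aux r i * 161 div 32 * 32 \<le> trials_aux r i * 161"
      by (rule div_times_less_eq_dividend)
    moreover have "d * 32 \<le> a * 161 \<Longrightarrow> d + 2 \<le> 8 * a + 8" for a d :: nat by linarith
    ultimately have "trials_aux r i * 161 div 32 + 2 \<le> 8 * trials_aux r i + 8" by blast
    also have "\<dots> = 8 * (trials_aux r i + 1)" by simp
    also have "\<dots> \<le> 8 * ((r + 1) * 8 ^ i)" using Suc by simp
    finally show ?case by (simp add: algebra_simps)
  qed simp
  then show ?thesis by simp
qed

lemma trials_le_power: "trials k \<le> 2 ^ (19 * K)"
proof -
  let ?j = "num_groups k"
  have "16 * ?j + 1 \<le> 2 ^ (16 * ?j)"
    using less_exp[of "16 * ?j"] by linarith
  moreover have "(8::nat) ^ ?j = 2 ^ (3 * ?j)" by (simp add: power_mult)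
  ultimately have "trials k \<le> 2 ^ (16 * ?j) * 2 ^ (3 * ?j)"
    using trials_aux_le[of "16 * ?j" ?j] unfolding trials_def
    by (metis mult_le_mono1 order_trans)
  also have "\<dots> = 2 ^ (19 * ?j)" by (simp flip: power_add)
  also have "\<dots> \<le> (2::nat) ^ (19 * K)" by (intro power_increasing) (auto simp: num_colors_def)
  finally show ?thesis .
qed

lemma gate_code_le_small:
  assumes "j < sz" "i < 3" shows "gate_code (C ! j) ! i \<le> small"
proof -
  have "wf_gate n j (C ! j)" using wf assms by (simp add: wf_circuit_def)
  then have "x \<le> n + sz + 3" if "x \<in> set (gate_code (C ! j))" for x
    using that assms(1) by (cases "C ! j") auto
  moreover have "gate_code (C ! j) ! i \<in> set (gate_code (C ! j))" using assms(2) by simp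
  ultimately have "gate_code (C ! j) ! i \<le> n + sz + 3" by blast
  also have "\<dots> \<le> small" by (simp add: small_def)
  finally show ?thesis .
qed

lemma inp_le_small: "inp a \<le> small"
proof -
  consider "a = 0" | "a = 1" | "a = 2" | "3 + 3 * sz \<le> a" | "3 \<le> a" "a < 3 + 3 * sz" by linarith
  then show ?thesis
  proof cases
    case 5
    define j i where "j = (a - 3) div 3" and "i = (a - 3) mod 3"
    have a: "a = 3 + 3 * j + i" and ij: "j < sz" "i < 3"
      using 5 by (auto simp: j_def i_def)
    have "inp a = gate_code (C ! j) ! i"
      using nth_input_ints[OF ij, of n k] 5 by (simp add: inp_def a)
    then show ?thesis using gate_code_le_small[OF ij] by simp
  qed (simp_all add: inp_def input_ints_def numeral_2_eq_2 small_def length_concat_codes)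
qed

lemma fits_start: "fits cell_bits (3 * sz + 3) (start w)"
proof -
  let ?B = cell_bits
  have lin: "x < 2 ^ ?B" if "x \<le> ?B" for x
    using that less_exp[of ?B] by linarith
  have two: "x * 2 ^ (19 * K) + y < 2 ^ ?B" if "x \<le> 2" "y \<le> small" for x y :: nat
  proof -
    have "x * 2 ^ (19 * K) \<le> 2 ^ (19 * K + 1)" using that by simp
    moreover have "y < 2 ^ small" using that less_exp[of small] by linarith
    moreover have "(2::nat) ^ (19 * K + 1) \<le> 2 ^ (?B - 1)" "(2::nat) ^ small \<le> 2 ^ (?B - 1)"
      by (intro power_increasing; simp add: cell_bits_def)+
    moreover have "(2::nat) ^ ?B = 2 ^ (?B - 1) + 2 ^ (?B - 1)"
      by (subst power_eq_if) (simp add: cell_bits_def)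
    ultimately show ?thesis by linarith
  qed
  have K: "(2::nat) ^ K \<le> 2 ^ (19 * K)" by (intro power_increasing) auto
  have "var_bound x < 2 ^ ?B" for x
  proof -
    have "2 ^ K + trials k < 2 ^ ?B" using trials_le_power K two[of 2 0] by linarith
    moreover have "(2::nat) ^ K < 2 ^ ?B" using calculation by linarith
    moreover have "small < 2 ^ ?B" using two[of 0 small] by simp
    ultimately show ?thesis unfolding var_bound_def by (simp del: power_strict_increasing_iff)
  qed
  moreover have "arr_bound < 2 ^ ?B"
  proof -
    have "1 * 2 ^ (19 * K) + small < 2 ^ ?B" using two[OF one_le_numeral order_refl] .
    then show ?thesis using K unfolding arr_bound_def by linarith
  qed
  moreover have "inp a < 2 ^ ?B" for a
    using inp_le_small[of a] by (intro lin) (simp add: cell_bits_def)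
  moreover have "fld_size < 2 ^ ?B" "3 * sz + 3 + nvars + arr_size < 2 ^ ?B"
    by (intro lin; simp add: cell_bits_def nvars_def arr_size_def)+
  moreover have "low (start w) = 3 * sz + 3"
    by (simp add: low_def start_def inp_def input_ints_def numeral_2_eq_2)
  moreover have "?B \<ge> 1" by (simp add: cell_bits_def)
  moreover have "inputs (start w) = inp" by (simp add: start_def)
  ultimately show ?thesis unfolding fits_def by simp
qed

theorem program_correct:
  fixes ot eb :: nat
  defines "\<kappa> \<equiv> csz kmmd_program"
  shows "\<exists>t m s'. exec ot eb kmmd_program (input_state n k C w) t m s' \<and>
    t \<le> 602 * (trials k * (2 ^ K * small ^ 3)) * (\<kappa> * unit_cost cell_bits ot \<kappa>) \<and>
    m \<le> space eb cell_bits (3 * sz + 3) \<and>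
    (accepting s' \<longleftrightarrow> (\<exists>r<trials k. hit (sdrop (r * block) w)))"
proof -
  let ?B = cell_bits and ?U = "\<kappa> * unit_cost cell_bits ot \<kappa>" and ?\<sigma> = "sem prog_main (start w)"
  have good: "good (start w)" by (auto simp: good_def start_def) (simp add: fld_size_def)
  have safe: "safe prog_main (start w)"
    and found: "vars ?\<sigma> var_found = of_bool (\<exists>r<trials k. hit (sdrop (r * block) w))"
    using main_correct[of w] by (simp_all add: hoare_def)
  have good': "good ?\<sigma>" using good safe wf_prog_main by (rule good_sem)
  have fits': "fits ?B (3 * sz + 3) ?\<sigma>" by (intro fits_sem fits_start)
  have sz1: "csz (compile prog_main) \<le> \<kappa>" "csz (IStore (INum 0) (Rd var_found)) \<le> \<kappa>"
    by (simp_all add: \<kappa>_def kmmd_program_def)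
  have 1: "runs ot eb (compile prog_main) (conc (start w)) (cost prog_main * ?U)
      (space eb ?B (3 * sz + 3)) (conc ?\<sigma>)"
    by (rule compile_correct[OF good safe wf_prog_main fits_start sz1(1)])
  \<comment> \<open>Overwriting cell 0 does not move the boundary \<open>low\<close>, which depends
    on cell 2 alone; so the final state still has the form \<open>conc \<tau>\<close>.\<close>
  define \<tau> where "\<tau> = ?\<sigma>\<lparr>inputs := (inputs ?\<sigma>)(0 := vars ?\<sigma> var_found)\<rparr>"
  have low: "low \<tau> = low ?\<sigma>" by (simp add: \<tau>_def low_def)
  have conc: "conc \<tau> = (conc ?\<sigma>)\<lparr>ints := (ints (conc ?\<sigma>))(0 := vars ?\<sigma> var_found)\<rparr>"
    using low by (auto simp: conc_def \<tau>_def fun_eq_iff low_def)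
  have "good \<tau>" using good' by (simp add: good_def \<tau>_def)
  moreover have "vars ?\<sigma> var_found < 2 ^ ?B"
  proof -
    have "vars ?\<sigma> var_found \<le> 1" unfolding found by simp
    moreover have "(1::nat) < 2 ^ ?B" by (rule one_less_power) (auto simp: cell_bits_def)
    ultimately show ?thesis by linarith
  qed
  then have "fits ?B (3 * sz + 3) \<tau>"
    using fits' low by (simp add: fits_def) (simp add: \<tau>_def)
  ultimately have space: "state_space eb (conc \<tau>) \<le> space eb ?B (3 * sz + 3)"
    by (intro fits_space)
  have space': "state_space eb (conc ?\<sigma>) \<le> space eb ?B (3 * sz + 3)"
    by (intro fits_space fits' good')
  have 2: "runs ot eb (IStore (INum 0) (Rd var_found)) (conc ?\<sigma>) ?U (space eb ?B (3 * sz + 3)) (conc \<tau>)"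
  proof (rule runsI)
    show "exec ot eb (IStore (INum 0) (Rd var_found)) (conc ?\<sigma>)
       (icost (INum 0) (conc ?\<sigma>) + icost (Rd var_found) (conc ?\<sigma>) + 1)
       (max (state_space eb (conc ?\<sigma>)) (state_space eb (conc \<tau>))) (conc \<tau>)"
      by (rule exec.IStore) (simp add: conc)
    show "icost (INum 0) (conc ?\<sigma>) + icost (Rd var_found) (conc ?\<sigma>) + 1 \<le> ?U"
      using fits_cells[OF fits' good'] sz1 fits' by (intro command_cost_le) (auto simp: fits_def)
  qed (use space space' in simp)
  have "runs ot eb kmmd_program (input_state n k C w) (cost prog_main * ?U + ?U + 1)
     (space eb ?B (3 * sz + 3)) (conc \<tau>)"
    unfolding kmmd_program_def conc_start[symmetric] by (rule runs_Seq[OF 1 2])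
  then obtain t m where tmp_mask: "exec ot eb kmmd_program (input_state n k C w) t m (conc \<tau>)"
    "t \<le> cost prog_main * ?U + ?U + 1" "m \<le> space eb ?B (3 * sz + 3)"
    by (auto simp: runs_def)
  have "t \<le> 602 * (trials k * (2 ^ K * small ^ 3)) * ?U"
  proof -
    let ?Y = "trials k * (2 ^ K * small ^ 3)"
    have "1 \<le> \<kappa>" using sz1 by simp
    then have U: "1 \<le> ?U" by (simp add: unit_cost_def)
    have "1 \<le> ?Y" using trials_pos small_pos by simp
    then have Y: "1 * ?U \<le> ?Y * ?U" by (intro mult_right_mono) auto
    have "cost prog_main \<le> 600 * ?Y" using cost_main by (simp add: power3_eq_cube mult.assoc)
    then have "cost prog_main * ?U \<le> 600 * ?Y * ?U" by (intro mult_right_mono) auto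
    \<comment> \<open>One additional unit pays for the final store and one for the
      sequencing.\<close>
    moreover have "602 * ?Y * ?U = 600 * ?Y * ?U + ?Y * ?U + ?Y * ?U" by (simp add: algebra_simps)
    ultimately show ?thesis using tmp_mask(2) Y U by linarith
  qed
  moreover have "accepting (conc \<tau>) \<longleftrightarrow> (\<exists>r<trials k. hit (sdrop (r * block) w))"
    unfolding accepting_def conc using found by simp
  ultimately show ?thesis using tmp_mask by blast
qed

end

abbreviation (input) keys :: "('a \<Rightarrow>\<^sub>0 'b::zero) \<Rightarrow> 'a set" where "keys \<equiv> Poly_Mapping.keys"
abbreviation (input) lookup :: "('a \<Rightarrow>\<^sub>0 'b::zero) \<Rightarrow> 'a \<Rightarrow> 'b" where "lookup \<equiv> Poly_Mapping.lookup"

section \<open>Substituting powers of one variable\<close>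

definition mweight :: "(nat \<Rightarrow> nat) \<Rightarrow> monomial \<Rightarrow> nat" where
  "mweight v m = (\<Sum>i\<in>keys m. lookup m i * v i)"

lemma mweight_superset:
  assumes "finite M" "keys m \<subseteq> M"
  shows "mweight v m = (\<Sum>i\<in>M. lookup m i * v i)"
  unfolding mweight_def using assms by (intro sum.mono_neutral_left) (auto simp: in_keys_iff)

lemma keys_add_monomial:
  "keys (m + m' :: monomial) = keys m \<union> keys m'"
  by (auto simp: in_keys_iff lookup_add)

lemma mweight_add: "mweight v (m + m') = mweight v m + mweight v m'"
proof -
  let ?A = "keys m \<union> keys m'"
  show ?thesis
    by (subst (1 2 3) mweight_superset[of ?A])
      (auto simp: keys_add_monomial lookup_add sum.distrib algebra_simps)
qed

definition subst_monomial :: "(nat \<Rightarrow> bool) \<Rightarrow> (nat \<Rightarrow> nat) \<Rightarrow> monomial \<Rightarrow> 'f::field poly" where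
  "subst_monomial sel v m = (if \<forall>i\<in>keys m. sel i then monom 1 (mweight v m) else 0)"

lemma subst_monomial_add:
  "subst_monomial sel v (m + m') = subst_monomial sel v m * (subst_monomial sel v m' :: 'f::field poly)"
  by (auto simp: subst_monomial_def keys_add_monomial mweight_add mult_monom)

text \<open>The ring homomorphism that sends the \<open>i\<close>-th variable to
  \<open>u ^ v i\<close> if it is selected and to 0 otherwise. Because it is one, it commutes with
  the evaluation of circuits gate by gate.\<close>

definition subst_poly :: "(nat \<Rightarrow> bool) \<Rightarrow> (nat \<Rightarrow> nat) \<Rightarrow> 'f::field mpoly \<Rightarrow> 'f poly" where
  "subst_poly sel v f =
     (\<Sum>m\<in>keys f. smult (lookup f m) (subst_monomial sel v m))"

lemma subst_poly_superset:
  assumes "finite M" "keys f \<subseteq> M"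
  shows "subst_poly sel v f = (\<Sum>m\<in>M. smult (lookup f m) (subst_monomial sel v m))"
  unfolding subst_poly_def using assms by (intro sum.mono_neutral_left) (auto simp: in_keys_iff)

lemma subst_poly_add: "subst_poly sel v (f + g) = subst_poly sel v f + subst_poly sel v g"
proof -
  let ?A = "keys f \<union> keys g"
  show ?thesis
    by (subst (1 2 3) subst_poly_superset[of ?A])
      (use keys_add[of f g] in \<open>auto simp: lookup_add sum.distrib smult_add_left\<close>)
qed

lemma subst_poly_sum: "subst_poly sel v (\<Sum>x\<in>I. f x) = (\<Sum>x\<in>I. subst_poly sel v (f x))"
  by (induction I rule: infinite_finite_induct) (auto simp: subst_poly_add subst_poly_def[of _ _ 0])

lemma subst_poly_single: "subst_poly sel v (Poly_Mapping.single m a) = smult a (subst_monomial sel v m)"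
  by (subst subst_poly_superset[of "{m}"]) auto

lemma sum_singles: "f = (\<Sum>m\<in>keys f. Poly_Mapping.single m (lookup f m))"
proof (rule poly_mapping_eqI)
  fix m'
  show "lookup f m' = lookup
      (\<Sum>m\<in>keys f. Poly_Mapping.single m (lookup f m)) m'"
    by (cases "m' \<in> keys f")
      (auto simp: lookup_sum lookup_single when_def in_keys_iff sum.If_cases)
qed

lemma subst_poly_mult: "subst_poly sel v (f * g) = subst_poly sel v f * subst_poly sel v g"
proof -
  have "f * g = (\<Sum>m\<in>keys f. \<Sum>m'\<in>keys g.
      Poly_Mapping.single (m + m') (lookup f m * lookup g m'))"
    by (subst sum_singles[of f], subst sum_singles[of g]) (simp add: sum_product mult_single)
  then have "subst_poly sel v (f * g) = (\<Sum>m\<in>keys f. \<Sum>m'\<in>keys g.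
      smult (lookup f m * lookup g m')
        (subst_monomial sel v m * subst_monomial sel v m'))"
    by (simp add: subst_poly_sum subst_poly_single subst_monomial_add)
  also have "\<dots> = subst_poly sel v f * subst_poly sel v g"
    by (simp add: subst_poly_def sum_product mult.commute)
  finally show ?thesis .
qed

lemma subst_poly_gate:
  assumes "wf_gate n (length fs) g"
  shows "subst_poly sel v (gate_poly fs g) = gate_val sel v (map (subst_poly sel v) fs) g"
proof (cases g)
  case (Var i)
  then show ?thesis by (simp add: mvar_def subst_poly_single subst_monomial_def mweight_def)
next
  case (Const c)
  then show ?thesis
    by (simp add: mconst_def subst_poly_single subst_monomial_def mweight_def monom_0 pCons_one)
qed (use assms in \<open>simp_all add: subst_poly_add subst_poly_mult\<close>)

lemma length_gate_polys [simp]: "length (gate_polys C) = length C"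
  by (simp add: gate_polys_def foldl_append_length)

lemma wf_circuit_snoc: "C \<noteq> [] \<Longrightarrow> wf_circuit n (C @ [g]) \<longleftrightarrow> wf_circuit n C \<and> wf_gate n (length C) g"
  by (auto simp: wf_circuit_def nth_append less_Suc_eq)

lemma subst_poly_gate_polys:
  "C = [] \<or> wf_circuit n C \<Longrightarrow> map (subst_poly sel v) (gate_polys C) = gate_vals sel v C"
proof (induction C rule: rev_induct)
  case Nil
  then show ?case by (simp add: gate_polys_def gate_vals_def)
next
  case (snoc g C)
  have "C = [] \<or> wf_circuit n C" and "wf_gate n (length (gate_polys C)) g"
    using snoc.prems wf_circuit_snoc[of C n g] by (auto simp: wf_circuit_def)
  then show ?case using snoc.IH subst_poly_gate[of n "gate_polys C" g sel v]
    by (simp add: gate_polys_def gate_vals_def)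
qed

text \<open>Only variables below \<open>n\<close> receive colors and weights in a trial. That no
  others occur is what makes a trial depend on its own block of coins only, and what bounds the
  ground set of the isolation lemma by \<open>n\<close> elements.\<close>

lemma keys_gate_polys:
  "C = [] \<or> wf_circuit n C \<Longrightarrow> f \<in> set (gate_polys C) \<Longrightarrow> m \<in> keys f \<Longrightarrow>
    keys m \<subseteq> {..<n}"
proof (induction C arbitrary: f m rule: rev_induct)
  case (snoc g C)
  have wf: "C = [] \<or> wf_circuit n C" "wf_gate n (length (gate_polys C)) g"
    using snoc.prems wf_circuit_snoc[of C n g] by (auto simp: wf_circuit_def)
  have eq: "gate_polys (C @ [g]) = gate_polys C @ [gate_poly (gate_polys C) g]"
    by (simp add: gate_polys_def)
  have IH: "keys m' \<subseteq> {..<n}" if "m' \<in> keys (gate_polys C ! a)" "a < length (gate_polys C)" for m' a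
    using snoc.IH[OF wf(1)] that by (meson nth_mem)
  show ?case
  proof (cases "f \<in> set (gate_polys C)")
    case True
    then show ?thesis using snoc.IH[OF wf(1)] snoc.prems by blast
  next
    case False
    then have f: "f = gate_poly (gate_polys C) g" using snoc.prems eq by simp
    show ?thesis
    proof (cases g)
      case (Add a b)
      then show ?thesis using f snoc.prems(3) wf(2) IH keys_add[of "gate_polys C ! a" "gate_polys C ! b"]
        by auto blast
    next
      case (Mul a b)
      then obtain m1 m2 where "m = m1 + m2" "m1 \<in> keys (gate_polys C ! a)"
        "m2 \<in> keys (gate_polys C ! b)"
        using f snoc.prems(3) keys_mult[of "gate_polys C ! a" "gate_polys C ! b"] by auto
      then show ?thesis using IH wf(2) Mul by (auto simp: keys_add_monomial)
    qed (use f snoc.prems(3) wf(2) in \<open>auto simp: mvar_def mconst_def split: if_splits\<close>)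
  qed
qed (simp add: gate_polys_def)

section \<open>Inclusion-exclusion\<close>

text \<open>With \<open>y = card Y\<close> this is the coefficient of \<open>x ^ q\<close> in
  \<open>(1 - (1 + x)) ^ y = (- x) ^ y\<close>. In the induction, \<open>T\<close> is paired with
  \<open>insert a T\<close>, and Pascal's rule lowers \<open>q\<close> by one; no division occurs,
  so the identity holds in every commutative ring.\<close>

lemma sum_Pow_alternating_binomial:
  assumes "finite Y"
  shows "(\<Sum>T\<in>Pow Y. (-1) ^ card T * of_nat (card T choose q)) =
    (if card Y = q then (-1) ^ q else (0 :: 'a::comm_ring_1))"
  using assms
proof (induction Y arbitrary: q)
  case (insert a Y)
  let ?g = "\<lambda>T. (-1) ^ card T * of_nat (card T choose q) :: 'a"
  have fin: "finite T" "a \<notin> T" if "T \<in> Pow Y" for T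
    using that insert.hyps by (auto intro: finite_subset)
  have "sum ?g (Pow (insert a Y)) = sum ?g (Pow Y) + sum ?g (insert a ` Pow Y)"
    unfolding Pow_insert using insert.hyps by (intro sum.union_disjoint) auto
  also have "sum ?g (insert a ` Pow Y) = (\<Sum>T\<in>Pow Y. ?g (insert a T))"
  proof -
    have "inj_on (insert a) (Pow Y)"
      using insert.hyps by (intro inj_onI) (metis PowD insert_ident subsetD)
    then show ?thesis by (simp add: sum.reindex)
  qed
  also have "\<dots> = (\<Sum>T\<in>Pow Y. - ((-1) ^ card T * of_nat (Suc (card T) choose q)))"
    using fin by (intro sum.cong) auto
  also have "sum ?g (Pow Y) + \<dots> = (\<Sum>T\<in>Pow Y. - ((-1) ^ card T * (of_nat (Suc (card T) choose q) - of_nat (card T choose q))))"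
    by (simp add: sum.distrib[symmetric] algebra_simps)
  also have "\<dots> = (if card (insert a Y) = q then (-1) ^ q else 0)"
  proof (cases q)
    case (Suc q')
    then show ?thesis using insert.IH[of q'] insert.hyps by (simp add: sum_negf)
  qed (use insert.hyps in simp)
  finally show ?case .
next
  case empty
  show ?case by (cases q) auto
qed

lemma set_decode_subset: "S < 2 ^ K \<Longrightarrow> set_decode S \<subseteq> {..<K}"
proof
  fix x assume S: "S < 2 ^ K" and "x \<in> set_decode S"
  then have "S div 2 ^ x \<noteq> 0" by (intro notI) (simp add: set_decode_def)
  then have "2 ^ x \<le> S" by (simp add: div_eq_0_iff)
  with S have "(2::nat) ^ x < 2 ^ K" by linarith
  then show "x \<in> {..<K}" by simp
qed

lemma set_encode_less: "T \<subseteq> {..<K} \<Longrightarrow> set_encode T < 2 ^ K"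
proof -
  assume "T \<subseteq> {..<K}"
  then have "set_encode T \<le> (\<Sum>i<K. 2 ^ i)" unfolding set_encode_def by (intro sum_mono2) auto
  also have "\<dots> < 2 ^ K" by (induction K) auto
  finally show ?thesis .
qed

lemma zeros_eq_card: "zeros S K = card ({..<K} - set_decode S)"
proof (induction K)
  case (Suc K)
  have "{..<Suc K} - set_decode S = (if odd (S div 2 ^ K) then {..<K} - set_decode S
      else insert K ({..<K} - set_decode S))"
    by (auto simp: set_decode_def less_Suc_eq)
  then show ?case using Suc by simp
qed simp

lemma sum_subset_coef:
  assumes "U \<subseteq> {..<K}" "card U \<le> k" "k \<le> K"
  shows "(\<Sum>S<2 ^ K. subset_coef K (K - k) S * of_bool (\<forall>c\<in>U. odd (S div 2 ^ c))) =
    (if card U = k then (-1) ^ (K - k) else (0 :: 'f::field))"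
proof -
  let ?q = "K - k"
  have "(\<Sum>S<2 ^ K. subset_coef K ?q S * of_bool (\<forall>c\<in>U. odd (S div 2 ^ c))) =
    (\<Sum>S\<in>{S. S < 2 ^ K \<and> U \<subseteq> set_decode S}. (subset_coef K ?q S :: 'f))"
    by (rule sum.mono_neutral_cong_right) (auto simp: set_decode_def)
  \<comment> \<open>Passing to the set \<open>T\<close> of colors missing from \<open>S\<close>
    turns the condition that \<open>S\<close> contains \<open>U\<close> into \<open>T\<close>
    ranging over a full power set.\<close>
  also have "\<dots> = (\<Sum>T\<in>Pow ({..<K} - U). (-1) ^ card T * of_nat (card T choose ?q))"
  proof (rule sum.reindex_bij_witness[where i = "\<lambda>T. set_encode ({..<K} - T)"
      and j = "\<lambda>S. {..<K} - set_decode S"], goal_cases)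
    case (1 S)
    then have "{..<K} - ({..<K} - set_decode S) = set_decode S"
      using set_decode_subset[of S K] by auto
    then show ?case by simp
  next
    case (4 T)
    then have "U \<subseteq> {..<K} - T" using assms by auto
    then show ?case by (simp add: set_encode_less)
  qed (auto simp: subset_coef_def zeros_eq_card)
  also have "\<dots> = (if card ({..<K} - U) = ?q then (-1) ^ ?q else 0)"
    by (rule sum_Pow_alternating_binomial) simp
  also have "card ({..<K} - U) = K - card U" using assms by (simp add: card_Diff_subset finite_subset)
  also have "K - card U = ?q \<longleftrightarrow> card U = k"
  proof -
    have "card U \<le> K" using assms card_mono[of "{..<K}" U] by simp
    then show ?thesis using assms by auto
  qed
  finally show ?thesis .
qed

section \<open>The score of a trial\<close>

lemma monomial_degree_multilinear:
  assumes "multilinear m"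
  shows "lookup m i = of_bool (i \<in> keys m)"
    and "monomial_degree m = card (keys m)"
proof -
  have 1: "lookup m i = of_bool (i \<in> keys m)" for i
  proof -
    have "lookup m i \<le> 1" using assms by (simp add: multilinear_def)
    then show ?thesis by (auto simp: in_keys_iff)
  qed
  then show "lookup m i = of_bool (i \<in> keys m)" .
  show "monomial_degree m = card (keys m)" by (simp add: monomial_degree_def 1)
qed

lemma multilinear_keys_inj:
  assumes "multilinear m" "multilinear m'" "keys m = keys m'"
  shows "m = m'"
  by (rule poly_mapping_eqI) (use assms monomial_degree_multilinear(1) in metis)

lemma card_keys_le_degree: "card (keys m) \<le> monomial_degree m"
proof -
  have "(\<Sum>i\<in>keys m. 1) \<le> monomial_degree m"
    unfolding monomial_degree_def by (intro sum_mono) (auto simp: in_keys_iff)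
  then show ?thesis by simp
qed

lemma multilinearI:
  assumes "card (keys m) = monomial_degree m"
  shows "multilinear m"
proof (rule ccontr)
  assume "\<not> multilinear m"
  then obtain i where i: "lookup m i > 1" by (auto simp: multilinear_def not_le)
  then have "(\<Sum>i\<in>keys m. 1) < monomial_degree m"
    unfolding monomial_degree_def
    by (intro sum_strict_mono_ex1) (auto simp: in_keys_iff intro!: bexI[of _ i])
  with assms show False by simp
qed

section \<open>What the coefficients computed in a trial reveal about the polynomial\<close>

context kmmd
begin

abbreviation "f \<equiv> circuit_poly C"

lemma last_gvals: "last (gate_vals s v C) = subst_poly s v f"
proof -
  have "C \<noteq> []" using wf by (simp add: wf_circuit_def)
  then have "gate_polys C \<noteq> []" by (metis length_0_conv length_gate_polys)
  then show ?thesis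
    using subst_poly_gate_polys[of C n s v] wf by (metis circuit_poly_def last_map)
qed

lemma keys_f: "m \<in> keys f \<Longrightarrow> keys m \<subseteq> {..<n}"
proof -
  have "C \<noteq> []" using wf by (simp add: wf_circuit_def)
  then have "gate_polys C \<noteq> []" by (metis length_0_conv length_gate_polys)
  then have "f \<in> set (gate_polys C)" by (simp add: circuit_poly_def)
  then show "m \<in> keys f \<Longrightarrow> keys m \<subseteq> {..<n}"
    using keys_gate_polys[of C n f m] wf by blast
qed

lemma mweight_expo:
  "mweight (expo w) m = monomial_degree m * D + mweight (weight w) m"
  unfolding mweight_def expo_def monomial_degree_def sum_distrib_right distrib_left sum.distrib ..

lemma mweight_weight_le: "mweight (weight w) m \<le> monomial_degree m * W"
  unfolding mweight_def monomial_degree_def sum_distrib_right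
  by (intro sum_mono mult_le_mono2 less_imp_le weight_less)

text \<open>The weights are too small to bridge the gap between the strides of different degrees.\<close>

lemma degree_from_weight:
  assumes "mweight (expo w) m = k * D + r" "r < D"
  shows "monomial_degree m = k"
proof (rule antisym)
  let ?d = "monomial_degree m"
  show "?d \<le> k"
  proof (rule ccontr)
    assume "\<not> ?d \<le> k"
    then have "(k + 1) * D \<le> ?d * D" by (intro mult_right_mono) auto
    then show False using assms by (simp add: mweight_expo)
  qed
  show "k \<le> ?d"
  proof (rule ccontr)
    assume "\<not> k \<le> ?d"
    then have "(?d + 1) * D \<le> k * D" "?d * W \<le> k * W" by (intro mult_right_mono; simp)+
    moreover have "k * W < D" "(?d + 1) * D = ?d * D + D" by (simp_all add: stride_def)
    ultimately show False using assms mweight_weight_le[of w m] unfolding mweight_expo by linarith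
  qed
qed

definition colorful :: "(nat \<Rightarrow> nat) \<Rightarrow> monomial set" where
  "colorful col = {m \<in> keys f. multilinear m \<and> monomial_degree m = k \<and>
     inj_on col (keys m)}"

lemma finite_colorful [simp]: "finite (colorful col)"
  by (simp add: colorful_def)

text \<open>Within degree \<open>k\<close>, having \<open>k\<close> different colors forces
  \<open>k\<close> different variables, each with exponent 1. So counting colors detects
  multilinearity and injectivity of the coloring at once.\<close>

lemma colorful_iff:
  assumes "m \<in> keys f" "monomial_degree m = k"
  shows "m \<in> colorful col \<longleftrightarrow> card (col ` keys m) = k"
proof
  assume "m \<in> colorful col"
  then show "card (col ` keys m) = k"
    by (auto simp: colorful_def card_image monomial_degree_multilinear(2))
next
  assume "card (col ` keys m) = k"
  moreover have "card (col ` keys m) \<le> card (keys m)"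
    by (rule card_image_le) simp
  moreover have "card (keys m) \<le> k" using card_keys_le_degree[of m] assms by simp
  ultimately have "card (keys m) = k"
    "card (col ` keys m) = card (keys m)" by simp_all
  then show "m \<in> colorful col"
    using assms multilinearI[of m] by (simp add: colorful_def eq_card_imp_inj_on)
qed

lemma coeff_subst_poly:
  "coeff (subst_poly (sel w S) v g) e = (\<Sum>m\<in>keys g. lookup g m *
     (of_bool (mweight v m = e) * of_bool (\<forall>c\<in>color w ` keys m. odd (S div 2 ^ c))))"
  unfolding subst_poly_def coeff_sum
  by (intro sum.cong refl) (auto simp: subst_monomial_def coeff_monom sel_def)

text \<open>After exchanging the sums, \<open>degree_from_weight\<close> leaves only monomials of
  degree \<open>k\<close> at this exponent. These have at most \<open>k\<close> colors, so
  \<open>sum_subset_coef\<close> evaluates the sum over the sets of colors to a common sign or to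
  0.\<close>

lemma score_eq:
  assumes "r < D"
  shows "score w (k * D + r) =
    (-1) ^ q * (\<Sum>m | m \<in> colorful (color w) \<and> mweight (weight w) m = r. lookup f m)"
proof -
  let ?e = "k * D + r"
  let ?U = "\<lambda>m. color w ` keys m"
  let ?odd = "\<lambda>m S. \<forall>c\<in>?U m. odd (S div 2 ^ c)"
  have "score w ?e = (\<Sum>S<2 ^ K. \<Sum>m\<in>keys f. subset_coef K q S *
      (lookup f m * (of_bool (mweight (expo w) m = ?e) * of_bool (?odd m S))))"
    unfolding score_def last_gvals coeff_subst_poly sum_distrib_left ..
  also have "\<dots> = (\<Sum>m\<in>keys f. lookup f m * of_bool (mweight (expo w) m = ?e) *
      (\<Sum>S<2 ^ K. subset_coef K q S * of_bool (?odd m S)))"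
    by (subst sum.swap) (simp only: sum_distrib_left mult_ac)
  also have "\<dots> = (\<Sum>m\<in>keys f. if m \<in> colorful (color w) \<and> mweight (weight w) m = r
      then (-1) ^ q * lookup f m else 0)"
  proof (intro sum.cong refl)
    fix m assume m: "m \<in> keys f"
    show "lookup f m * of_bool (mweight (expo w) m = ?e) *
        (\<Sum>S<2 ^ K. subset_coef K q S * of_bool (?odd m S)) =
      (if m \<in> colorful (color w) \<and> mweight (weight w) m = r
      then (-1) ^ q * lookup f m else 0)"
    proof (cases "mweight (expo w) m = ?e")
      case True
      then have d: "monomial_degree m = k" using assms by (rule degree_from_weight)
      then have r: "mweight (weight w) m = r" using True by (simp add: mweight_expo)
      have "card (?U m) \<le> card (keys m)" by (rule card_image_le) simp
      then have "card (?U m) \<le> k" using card_keys_le_degree[of m] d by simp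
      moreover have "?U m \<subseteq> {..<K}" using color_less by auto
      ultimately have "(\<Sum>S<2 ^ K. subset_coef K q S * of_bool (?odd m S)) =
          (if card (?U m) = k then (-1) ^ q else (0 :: 'f))"
        using num_colors_gt by (intro sum_subset_coef) auto
      then show ?thesis using True r colorful_iff[OF m d, of "color w"] by simp
    next
      case False
      then have neg: "\<not> (m \<in> colorful (color w) \<and> mweight (weight w) m = r)"
        by (auto simp: colorful_def mweight_expo)
      show ?thesis unfolding if_not_P[OF neg] using False by simp
    qed
  qed
  also have "\<dots> = (\<Sum>m | m \<in> colorful (color w) \<and> mweight (weight w) m = r.
      (-1) ^ q * lookup f m)"
    by (rule sum.mono_neutral_cong_right) (auto simp: colorful_def)
  also have "\<dots> = (-1) ^ q * (\<Sum>m | m \<in> colorful (color w) \<and> mweight (weight w) m = r. lookup f m)"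
    unfolding sum_distrib_left ..
  finally show ?thesis .
qed

text \<open>The error is one-sided: a nonzero coefficient certifies a monomial of the desired kind,
  whatever the coins are.\<close>

lemma hit_imp_multilinear: "hit w \<Longrightarrow> has_multilinear_monomial k f"
proof -
  assume "hit w"
  then obtain r where "r < D" "score w (k * D + r) \<noteq> 0" by (auto simp: hit_def)
  then have "(\<Sum>m | m \<in> colorful (color w) \<and> mweight (weight w) m = r. lookup f m) \<noteq> 0"
    by (auto simp: score_eq)
  then obtain m where "m \<in> colorful (color w)" by (metis (mono_tags, lifting) mem_Collect_eq sum.not_neutral_contains_not_neutral)
  then show ?thesis by (auto simp: colorful_def has_multilinear_monomial_def in_keys_iff)
qed

lemma isolated_imp_hit:
  assumes m0: "m0 \<in> colorful (color w)"
    and iso: "\<And>m. m \<in> colorful (color w) \<Longrightarrow> m \<noteq> m0 \<Longrightarrow> mweight (weight w) m \<noteq> mweight (weight w) m0"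
  shows "hit w"
proof -
  let ?r = "mweight (weight w) m0"
  have "monomial_degree m0 = k" using m0 by (simp add: colorful_def)
  then have r: "?r < D" using mweight_weight_le[of w m0] by (simp add: stride_def)
  have "{m. m \<in> colorful (color w) \<and> mweight (weight w) m = ?r} = {m0}" using m0 iso by auto
  then have "score w (k * D + ?r) = (-1) ^ q * lookup f m0" by (simp add: score_eq[OF r])
  also have "\<dots> \<noteq> 0" using m0 by (simp add: colorful_def in_keys_iff)
  finally show ?thesis using r by (auto simp: hit_def)
qed

end

section \<open>The isolation lemma\<close>

text \<open>The ambiguous elements in the isolation argument of Mulmuley, Vazirani and Vazirani:
  minimality of \<open>S\<close> passes on to \<open>S'\<close>, so two lightest sets disagree about
  \<open>i\<close>.\<close>

definition tie :: "'a set set \<Rightarrow> 'a \<Rightarrow> ('a \<Rightarrow> nat) \<Rightarrow> bool" where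
  "tie \<F> i u \<longleftrightarrow> (\<exists>S\<in>\<F>. \<exists>S'\<in>\<F>. i \<in> S \<and> i \<notin> S' \<and> sum u S = sum u S' \<and>
     (\<forall>T\<in>\<F>. sum u S \<le> sum u T))"

text \<open>The weight that occurs only once need not be the minimum. Any such weight yields a
  coefficient in which nothing can cancel.\<close>

definition isolating :: "'a set set \<Rightarrow> ('a \<Rightarrow> nat) \<Rightarrow> bool" where
  "isolating \<F> u \<longleftrightarrow> (\<exists>S\<in>\<F>. \<forall>T\<in>\<F>. T \<noteq> S \<longrightarrow> sum u T \<noteq> sum u S)"

lemma not_isolating_imp_tie:
  assumes "finite \<F>" "\<F> \<noteq> {}" "\<Union>\<F> \<subseteq> I" "\<not> isolating \<F> u"
  shows "\<exists>i\<in>I. tie \<F> i u"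
proof -
  have "Min (sum u ` \<F>) \<in> sum u ` \<F>" using assms(1,2) by (intro Min_in) auto
  then obtain S where "S \<in> \<F>" and min: "Min (sum u ` \<F>) = sum u S" by auto
  have "sum u S \<le> sum u T" if "T \<in> \<F>" for T
    unfolding min[symmetric] using assms(1) that by (intro Min_le) auto
  note S = \<open>S \<in> \<F>\<close> this
  have "\<not> (\<forall>T\<in>\<F>. T \<noteq> S \<longrightarrow> sum u T \<noteq> sum u S)"
    using assms(4) S(1) unfolding isolating_def by (metis (no_types))
  then obtain T where T: "T \<in> \<F>" "T \<noteq> S" "sum u T = sum u S" by blast
  have le: "sum u T \<le> sum u R" if "R \<in> \<F>" for R using S T that by simp
  from T consider i where "i \<in> S" "i \<notin> T" | i where "i \<in> T" "i \<notin> S" by blast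
  then show ?thesis
  proof cases
    case 1
    then have "tie \<F> i u" unfolding tie_def using S T by (intro bexI[of _ S] bexI[of _ T]) auto
    then show ?thesis using 1 S assms(3) by blast
  next
    case 2
    then have "tie \<F> i u" unfolding tie_def using S T le by (intro bexI[of _ T] bexI[of _ S]) auto
    then show ?thesis using 2 T assms(3) by blast
  qed
qed

text \<open>Fix all weights except that of \<open>i\<close>. The least weight of a set avoiding
  \<open>i\<close> is then constant, while the least weight of a set containing \<open>i\<close>
  grows strictly with \<open>u i\<close>. A tie makes the two equal, so it determines
  \<open>u i\<close>.\<close>

lemma tie_less:
  assumes fin: "\<And>S. S \<in> \<F> \<Longrightarrow> finite S"
    and eq: "\<And>j. j \<noteq> i \<Longrightarrow> u j = u' j" and "u i < u' i"
  shows "\<not> (tie \<F> i u \<and> tie \<F> i u')"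
proof
  assume *: "tie \<F> i u \<and> tie \<F> i u'"
  from * have "tie \<F> i u" ..
  then obtain S S' where S: "S \<in> \<F>" "S' \<in> \<F>" "i \<in> S" "i \<notin> S'" "sum u S = sum u S'"
      and S_min: "\<forall>R\<in>\<F>. sum u S \<le> sum u R"
    unfolding tie_def by (elim bexE conjE)
  from * have "tie \<F> i u'" ..
  then obtain T T' where T: "T \<in> \<F>" "T' \<in> \<F>" "i \<in> T" "i \<notin> T'" "sum u' T = sum u' T'"
      and T_min: "\<forall>R\<in>\<F>. sum u' T \<le> sum u' R"
    unfolding tie_def by (elim bexE conjE)
  have same: "sum u R = sum u' R" if "i \<notin> R" for R
    by (intro sum.cong refl eq) (use that in blast)
  have "sum u T = u i + sum u (T - {i})" "sum u' T = u' i + sum u' (T - {i})"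
    using T fin by (simp_all add: sum.remove)
  moreover have "sum u (T - {i}) = sum u' (T - {i})" by (rule same) simp
  ultimately have "sum u T < sum u' T" using \<open>u i < u' i\<close> by simp
  moreover have "sum u' T \<le> sum u' S'" using S T_min by blast
  moreover have "sum u' S' = sum u S'" using S same by simp
  moreover have "sum u S \<le> sum u T" using S_min T by blast
  ultimately show False using S by simp
qed

lemma card_tie_le:
  assumes "finite I" "\<Union>\<F> \<subseteq> I" "i \<in> I"
  shows "card {u \<in> PiE I (\<lambda>_. {..<w}). tie \<F> i u} \<le> w ^ (card I - 1)"
proof -
  let ?B = "{u \<in> PiE I (\<lambda>_. {..<w}). tie \<F> i u}"
  let ?r = "\<lambda>u. restrict u (I - {i})"
  have fin: "finite S" if "S \<in> \<F>" for S
    by (rule finite_subset[OF _ assms(1)]) (use assms(2) that in blast)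
  have "inj_on ?r ?B"
  proof (rule inj_onI)
    fix u u' assume u: "u \<in> {u \<in> PiE I (\<lambda>_. {..<w}). tie \<F> i u}" and u': "u' \<in> {u \<in> PiE I (\<lambda>_. {..<w}). tie \<F> i u}" and r: "?r u = ?r u'"
    have uu: "u \<in> PiE I (\<lambda>_. {..<w})" "u' \<in> PiE I (\<lambda>_. {..<w})" using u u' by blast+
    have eq: "u j = u' j" if "j \<noteq> i" for j
    proof (cases "j \<in> I")
      case True
      have "?r u j = ?r u' j" by (rule fun_cong[OF r])
      then show ?thesis using True that by simp
    next
      case False
      show ?thesis using PiE_arb[OF uu(1) False] PiE_arb[OF uu(2) False] by (rule trans_sym)
    qed
    have ties: "tie \<F> i u" "tie \<F> i u'" using u u' by blast+
    have "u i = u' i"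
    proof (rule linorder_cases[of "u i" "u' i"])
      assume "u i < u' i"
      from tie_less[of \<F> i u u', OF fin eq this] ties show ?thesis by simp
    next
      assume "u' i < u i"
      from tie_less[of \<F> i u' u, OF fin eq[symmetric] this] ties show ?thesis by simp
    qed
    then show "u = u'" by (intro ext) (metis eq)
  qed
  moreover have "?r ` ?B \<subseteq> PiE (I - {i}) (\<lambda>_. {..<w})" by (rule image_subsetI) (simp add: PiE_iff)
  moreover have "finite (PiE (I - {i}) (\<lambda>_. {..<w}))" using assms by (intro finite_PiE) auto
  ultimately have "card ?B \<le> card (PiE (I - {i}) (\<lambda>_. {..<w}))" by (rule card_inj_on_le)
  also have "\<dots> = w ^ (card I - 1)" using assms by (simp add: card_PiE)
  finally show ?thesis .
qed

lemma isolation_lemma: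
  assumes "finite I" "finite \<F>" "\<F> \<noteq> {}" "\<Union>\<F> \<subseteq> I" "2 * card I \<le> w"
  shows "w ^ card I \<le> 2 * card {u \<in> PiE I (\<lambda>_. {..<w}). isolating \<F> u}"
proof -
  let ?P = "PiE I (\<lambda>_. {..<w})"
  let ?G = "{u \<in> ?P. isolating \<F> u}" and ?B = "\<lambda>i. {u \<in> ?P. tie \<F> i u}"
  have finP: "finite ?P" using assms by (intro finite_PiE) auto
  have "?P \<subseteq> ?G \<union> (\<Union>i\<in>I. ?B i)" using not_isolating_imp_tie[OF assms(2-4)] by auto
  then have "card ?P \<le> card (?G \<union> (\<Union>i\<in>I. ?B i))"
    using finP assms(1) by (intro card_mono) auto
  also have "\<dots> \<le> card ?G + card (\<Union>i\<in>I. ?B i)" by (rule card_Un_le)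
  also have "card (\<Union>i\<in>I. ?B i) \<le> (\<Sum>i\<in>I. card (?B i))" using assms(1) by (rule card_UN_le)
  also have "\<dots> \<le> (\<Sum>i\<in>I. w ^ (card I - 1))" using assms by (intro sum_mono card_tie_le) auto
  finally have "w ^ card I \<le> card ?G + card I * w ^ (card I - 1)"
    using assms(1) by (simp add: card_PiE)
  moreover have "2 * (card I * w ^ (card I - 1)) \<le> w ^ card I"
  proof (cases "card I")
    case (Suc c)
    then have "2 * card I * w ^ c \<le> w * w ^ c" using assms(5) by (intro mult_right_mono) auto
    then show ?thesis using Suc by simp
  qed simp
  ultimately show ?thesis by linarith
qed

section \<open>Random colorings\<close>

text \<open>Every complete period of length \<open>K\<close> below \<open>w\<close> contains each
  residue once; the incomplete last period is dropped.\<close>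

lemma card_residues_ge:
  fixes K w :: nat
  assumes "Z \<subseteq> {..<K}"
  shows "card Z * (w div K) \<le> card {y. y < w \<and> y mod K \<in> Z}"
proof -
  have "inj_on (\<lambda>(z, t). t * K + z) (Z \<times> {..<w div K})"
  proof (rule inj_onI, clarify)
    fix z t z' t' assume "z \<in> Z" "z' \<in> Z" and eq: "t * K + z = t' * K + z'"
    then have z: "z < K" "z' < K" using assms by auto
    from eq have "(t * K + z) mod K = (t' * K + z') mod K" "(t * K + z) div K = (t' * K + z') div K" by simp_all
    then show "z = z' \<and> t = t'" using z by simp
  qed
  moreover have "(\<lambda>(z, t). t * K + z) ` (Z \<times> {..<w div K}) \<subseteq> {y. y < w \<and> y mod K \<in> Z}"
  proof clarsimp
    fix z t assume "z \<in> Z" "t < w div K"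
    then have z: "z < K" using assms by auto
    have "t * K + z < (t + 1) * K" using z by simp
    also have "\<dots> \<le> (w div K) * K" using \<open>t < w div K\<close> by (intro mult_right_mono) auto
    also have "\<dots> \<le> w" by simp
    finally show "t * K + z < w \<and> z mod K \<in> Z" using z \<open>z \<in> Z\<close> by simp
  qed
  ultimately have "card (Z \<times> {..<w div K}) \<le> card {y. y < w \<and> y mod K \<in> Z}"
    by (intro card_inj_on_le) auto
  then show ?thesis by (simp add: card_cartesian_product)
qed

text \<open>The variables are added one at a time. A new variable of \<open>T\<close> has to avoid
  at most \<open>card (I \<inter> T)\<close> residues, each remaining one being attained at least
  \<open>w div K\<close> times; a variable outside \<open>T\<close> is unrestricted.\<close>

lemma card_injective_colorings:
  fixes K w :: nat
  assumes "finite I"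
  shows "w ^ card (I - T) * (\<Prod>j<card (I \<inter> T). (K - j) * (w div K)) \<le>
    card {a \<in> PiE I (\<lambda>_. {..<w}). inj_on (\<lambda>i. a i mod K) (I \<inter> T)}"
  using assms
proof (induction I)
  case (insert x I)
  let ?N = "{a \<in> PiE I (\<lambda>_. {..<w}). inj_on (\<lambda>i. a i mod K) (I \<inter> T)}"
  let ?N' = "{a \<in> PiE (insert x I) (\<lambda>_. {..<w}). inj_on (\<lambda>i. a i mod K) (insert x I \<inter> T)}"
  let ?Y = "\<lambda>g. {y. y < w \<and> (x \<in> T \<longrightarrow> y mod K \<notin> (\<lambda>i. g i mod K) ` (I \<inter> T))}"
  let ?up = "\<lambda>(g, y). g(x := y)"
  have "finite (PiE I (\<lambda>_. {..<w}))" "finite (PiE (insert x I) (\<lambda>_. {..<w}))"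
    using insert.hyps by (intro finite_PiE; simp)+
  then have finN: "finite ?N" "finite ?N'" by simp_all
  have inj: "inj_on ?up (Sigma ?N ?Y)"
  proof (rule inj_onI, clarify)
    fix g y g' y' assume g: "g \<in> PiE I (\<lambda>_. {..<w})" "g' \<in> PiE I (\<lambda>_. {..<w})" and eq: "g(x := y) = g'(x := y')"
    have upd: "(g(x := y)) j = (g'(x := y')) j" for j by (rule fun_cong[OF eq])
    have "g j = g' j" for j
    proof (cases "j = x")
      case True
      then have "j \<notin> I" using insert.hyps by simp
      show ?thesis using PiE_arb[OF g(1) \<open>j \<notin> I\<close>] PiE_arb[OF g(2) \<open>j \<notin> I\<close>] by (rule trans_sym)
    next
      case False
      then show ?thesis using upd[of j] by simp
    qed
    then show "g = g' \<and> y = y'" using upd[of x] by (intro conjI ext) simp_all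
  qed
  have sub: "?up ` Sigma ?N ?Y \<subseteq> ?N'"
  proof (rule image_subsetI)
    fix p assume p: "p \<in> Sigma ?N ?Y"
    obtain g y where gy: "p = (g, y)" by (cases p)
    have g: "g \<in> PiE I (\<lambda>_. {..<w})" "inj_on (\<lambda>i. g i mod K) (I \<inter> T)"
      and y: "y < w" "x \<in> T \<longrightarrow> y mod K \<notin> (\<lambda>i. g i mod K) ` (I \<inter> T)"
      using p gy by simp_all
    have mem: "g(x := y) \<in> PiE (insert x I) (\<lambda>_. {..<w})" using g y by (intro PiE_fun_upd) auto
    have inj: "inj_on (\<lambda>i. (g(x := y)) i mod K) (I \<inter> T)"
      using g insert.hyps by (subst inj_on_cong[of _ _ "\<lambda>i. g i mod K"]) auto
    have "inj_on (\<lambda>i. (g(x := y)) i mod K) (insert x I \<inter> T)"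
    proof (cases "x \<in> T")
      case True
      have "(\<lambda>i. (g(x := y)) i mod K) ` (I \<inter> T - {x}) = (\<lambda>i. g i mod K) ` (I \<inter> T)"
        using insert.hyps by (intro image_cong) auto
      then show ?thesis using inj True y by (simp add: Int_insert_left)
    qed (use inj in \<open>simp add: Int_insert_left\<close>)
    then show "?up p \<in> ?N'" using mem gy by simp
  qed
  have card': "card (Sigma ?N ?Y) \<le> card ?N'"
    using inj sub finN by (intro card_inj_on_le) auto
  have card_Sigma: "card (Sigma ?N ?Y) = (\<Sum>g\<in>?N. card (?Y g))"
    using finN by (intro card_SigmaI) auto
  show ?case
  proof (cases "x \<in> T")
    case True
    let ?c = "(K - card (I \<inter> T)) * (w div K)"
    have Y: "?c \<le> card (?Y g)" if "g \<in> ?N" for g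
    proof -
      let ?used = "(\<lambda>i. g i mod K) ` (I \<inter> T)"
      let ?Z = "{..<K} - ?used"
      have "card ?used \<le> card (I \<inter> T)" using insert.hyps by (intro card_image_le) auto
      then have "K - card (I \<inter> T) \<le> card {..<K} - card ?used" by simp
      also have "\<dots> \<le> card ?Z" using insert.hyps by (intro diff_card_le_card_Diff) auto
      finally have "?c \<le> card ?Z * (w div K)" by (intro mult_right_mono) auto
      also have "\<dots> \<le> card {y. y < w \<and> y mod K \<in> ?Z}" by (rule card_residues_ge) auto
      also have "\<dots> \<le> card (?Y g)" by (intro card_mono) auto
      finally show ?thesis .
    qed
    have "insert x I - T = I - T" "insert x I \<inter> T = insert x (I \<inter> T)" using True by auto
    moreover have "card (insert x (I \<inter> T)) = Suc (card (I \<inter> T))" using insert.hyps by simp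
    ultimately have "w ^ card (insert x I - T) * (\<Prod>j<card (insert x I \<inter> T). (K - j) * (w div K)) =
        w ^ card (I - T) * (\<Prod>j<card (I \<inter> T). (K - j) * (w div K)) * ?c" by simp
    also have "\<dots> \<le> card ?N * ?c" by (intro mult_right_mono insert.IH) simp
    also have "\<dots> = (\<Sum>g\<in>?N. ?c)" by simp
    also have "\<dots> \<le> card (Sigma ?N ?Y)" unfolding card_Sigma by (intro sum_mono Y)
    finally show ?thesis using card' by linarith
  next
    case False
    then have "insert x I - T = insert x (I - T)" "insert x I \<inter> T = I \<inter> T" by auto
    moreover have "card (insert x (I - T)) = Suc (card (I - T))" using insert.hyps by simp
    ultimately have "w ^ card (insert x I - T) * (\<Prod>j<card (insert x I \<inter> T). (K - j) * (w div K)) =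
        w ^ card (I - T) * (\<Prod>j<card (I \<inter> T). (K - j) * (w div K)) * w" by simp
    also have "\<dots> \<le> card ?N * w" by (intro mult_right_mono insert.IH) simp
    also have "\<dots> = (\<Sum>g\<in>?N. card (?Y g))"
    proof -
      have "?Y g = {..<w}" for g using False by auto
      then show ?thesis by simp
    qed
    finally show ?thesis using card' card_Sigma by linarith
  qed
qed simp

section \<open>Counting coin sequences\<close>

lemma measurable_stake_coin_space: "{\<omega>. P (stake N \<omega>)} \<in> sets coin_space"
proof -
  have eq: "sets coin_space = sets (stream_space (count_space UNIV :: bool measure))"
    unfolding coin_space_def by (rule sets_stream_space_cong) simp
  have "stake N -` {xs. P xs} \<inter> space (stream_space (count_space UNIV :: bool measure))
     \<in> sets (stream_space (count_space UNIV :: bool measure))"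
    by (rule measurable_sets[OF measurable_stake]) simp
  moreover have "stake N -` {xs. P xs} \<inter> space (stream_space (count_space UNIV :: bool measure)) = {\<omega>. P (stake N \<omega>)}"
    by (auto simp: space_stream_space)
  ultimately show ?thesis using eq by (simp only:)
qed

lemma prob_space_coin_space: "prob_space coin_space"
  unfolding coin_space_def by (intro prob_space.prob_space_stream_space measure_pmf.prob_space_axioms)

lemma measure_stake_Suc:
  "measure coin_space {\<omega>. P (stake (Suc N) \<omega>)} =
    (measure coin_space {\<omega>. P (True # stake N \<omega>)} + measure coin_space {\<omega>. P (False # stake N \<omega>)}) / 2"
proof -
  interpret prob_space coin_space by (rule prob_space_coin_space)
  let ?M = "measure_pmf (bernoulli_pmf (1 / 2))"
  have sp: "space coin_space = UNIV" by (simp add: coin_space_def space_stream_space)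
  have "emeasure coin_space {\<omega>. P (stake (Suc N) \<omega>)} =
      (\<integral>\<^sup>+t. emeasure coin_space {\<omega>. P (t # stake N \<omega>)} \<partial>?M)"
    using measurable_stake_coin_space[of P "Suc N"] sp unfolding coin_space_def
    by (subst prob_space.emeasure_stream_space[OF measure_pmf.prob_space_axioms]) auto
  also have "\<dots> = emeasure coin_space {\<omega>. P (True # stake N \<omega>)} * ennreal (1 / 2) +
      emeasure coin_space {\<omega>. P (False # stake N \<omega>)} * ennreal (1 / 2)"
    by (subst nn_integral_bernoulli_pmf) auto
  also have "\<dots> = ennreal ((measure coin_space {\<omega>. P (True # stake N \<omega>)} +
      measure coin_space {\<omega>. P (False # stake N \<omega>)}) / 2)"
  proof -
    have "ennreal a * ennreal (1 / 2) + ennreal b * ennreal (1 / 2) = ennreal ((a + b) / 2)"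
      if "0 \<le> a" "0 \<le> b" for a b
    proof -
      have half: "0 \<le> (1 / 2 :: real)" by simp
      have "ennreal ((a + b) / 2) = ennreal (a * (1 / 2) + b * (1 / 2))" by (simp add: add_divide_distrib)
      also have "\<dots> = ennreal (a * (1 / 2)) + ennreal (b * (1 / 2))"
        using that by (intro ennreal_plus) auto
      finally show ?thesis unfolding ennreal_mult[OF that(1) half] ennreal_mult[OF that(2) half] ..
    qed
    then show ?thesis unfolding emeasure_eq_measure by simp
  qed
  finally show ?thesis unfolding emeasure_eq_measure by (subst (asm) ennreal_inj) auto
qed

text \<open>Reduces events about finitely many coins to counting bit lists, so that independence
  becomes a product of cardinalities.\<close>

lemma measure_stake:
  "measure coin_space {\<omega>. P (stake N \<omega>)} = real (card {xs. length xs = N \<and> P xs}) / 2 ^ N"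
proof (induction N arbitrary: P)
  case 0
  interpret prob_space coin_space by (rule prob_space_coin_space)
  have sp: "space coin_space = UNIV" by (simp add: coin_space_def space_stream_space)
  have "{xs. xs = [] \<and> P xs} = (if P [] then {[]} else {})" by auto
  then show ?case using prob_space sp by auto
next
  case (Suc N)
  let ?S = "\<lambda>b. {xs. length xs = N \<and> P (b # xs)}"
  have fin: "finite (?S b)" for b
    by (rule finite_subset[OF _ finite_lists_length_eq[of "UNIV :: bool set" N]]) auto
  have "{xs. length xs = Suc N \<and> P xs} = (#) True ` ?S True \<union> (#) False ` ?S False"
  proof (rule set_eqI)
    fix xs
    show "xs \<in> {xs. length xs = Suc N \<and> P xs} \<longleftrightarrow> xs \<in> (#) True ` ?S True \<union> (#) False ` ?S False"
      by (cases xs; cases "hd xs") (simp_all add: image_iff)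
  qed
  moreover have "card ((#) True ` ?S True \<union> (#) False ` ?S False) = card (?S True) + card (?S False)"
    using fin by (subst card_Un_disjoint) (auto simp: card_image)
  ultimately have "card {xs. length xs = Suc N \<and> P xs} = card (?S True) + card (?S False)"
    by (simp only:)
  then show ?case
    unfolding measure_stake_Suc Suc.IH[of "\<lambda>xs. P (True # xs)"] Suc.IH[of "\<lambda>xs. P (False # xs)"]
    by (simp add: add_divide_distrib)
qed

lemma card_append_lists:
  "card {xs :: bool list. length xs = a + b \<and> P (take a xs) \<and> Q (drop a xs)} =
    card {xs. length xs = a \<and> P xs} * card {xs. length xs = b \<and> Q xs}"
proof -
  let ?f = "\<lambda>p. fst p @ snd p :: bool list"
  let ?M = "{xs. length xs = a \<and> P xs} \<times> {xs. length xs = b \<and> Q xs}"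
  have "{xs :: bool list. length xs = a + b \<and> P (take a xs) \<and> Q (drop a xs)} = ?f ` ?M" (is "?L = ?R")
  proof
    show "?L \<subseteq> ?R"
    proof
      fix xs assume "xs \<in> ?L"
      then show "xs \<in> ?R" by (intro image_eqI[of _ _ "(take a xs, drop a xs)"]) simp_all
    qed
    show "?R \<subseteq> ?L" by (rule image_subsetI) (simp add: mem_Times_iff)
  qed
  moreover have "inj_on ?f ?M"
  proof (rule inj_onI)
    fix p p' assume "p \<in> ?M" "p' \<in> ?M" "?f p = ?f p'"
    then have "fst p = fst p' \<and> snd p = snd p'" by (simp add: mem_Times_iff append_eq_append_conv)
    then show "p = p'" by (simp add: prod_eq_iff)
  qed
  ultimately show ?thesis by (simp only: card_image card_cartesian_product)
qed

text \<open>Independence of the trials in terms of counting: they read disjoint blocks of coins, and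
  a list of \<open>R * b\<close> bits splits uniquely into \<open>R\<close> such blocks.\<close>

lemma card_independent_failures:
  "card {xs :: bool list. length xs = R * b \<and> (\<forall>r<R. P (take b (drop (r * b) xs)))} =
    card {xs. length xs = b \<and> P xs} ^ R"
proof (induction R)
  case 0
  have "{xs :: bool list. xs = []} = {[]}" by auto
  then show ?case by simp
next
  case (Suc R)
  have "(\<forall>r<Suc R. P (take b (drop (r * b) xs))) \<longleftrightarrow>
     P (take b xs) \<and> (\<forall>r<R. P (take b (drop (r * b) (drop b xs))))" for xs :: "bool list"
    unfolding All_less_Suc2 by (simp add: add.commute)
  then have "{xs :: bool list. length xs = Suc R * b \<and> (\<forall>r<Suc R. P (take b (drop (r * b) xs)))} =
    {xs. length xs = b + R * b \<and> P (take b xs) \<and> (\<forall>r<R. P (take b (drop (r * b) (drop b xs))))}"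
    by simp
  then show ?case
    unfolding power_Suc Suc[symmetric] by (simp only: card_append_lists[of b "R * b" P "\<lambda>xs. \<forall>r<R. P (take b (drop (r * b) xs))"])
qed

section \<open>Numerical bounds\<close>

text \<open>The quotient of \<open>n ^ n\<close> and \<open>n!\<close> is a single term of the
  exponential series at \<open>n\<close>, all of whose terms are nonnegative.\<close>

lemma power_div_fact_le_exp: "real n ^ n \<le> fact n * exp (real n)"
proof -
  have "real n ^ n / fact n \<le> (\<Sum>i\<le>n. real n ^ i / fact i)"
    by (rule member_le_sum) auto
  also have "\<dots> = (\<Sum>i\<le>n. inverse (fact i) * real n ^ i)" by (simp add: divide_inverse mult.commute)
  also have "\<dots> \<le> suminf (\<lambda>i. inverse (fact i) * real n ^ i)"
    using summable_exp[of "real n"] by (intro sum_le_suminf) auto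
  also have "\<dots> = exp (real n)" by (simp add: exp_def scaleR_conv_of_real)
  finally show ?thesis by (simp add: field_simps)
qed

text \<open>An upper Stirling bound. The induction step amounts to
  \<open>e \<le> (1 + 1 / n) ^ (n + 1)\<close>, which follows from \<open>1 + x \<le> exp x\<close>
  at \<open>x = - 1 / (n + 1)\<close>.\<close>

lemma fact_le_power: "n \<ge> 1 \<Longrightarrow> fact n * exp (real n) \<le> exp 1 * real n * real n ^ n"
proof (induction n rule: nat_induct_at_least)
  case (Suc n)
  let ?x = "real n" and ?y = "real (Suc n)"
  have "?x / ?y = 1 + (- 1 / ?y)" by (simp add: field_simps)
  also have "\<dots> \<le> exp (- 1 / ?y)" by (rule exp_ge_add_one_self)
  finally have "(?x / ?y) ^ Suc n \<le> exp (- 1 / ?y) ^ Suc n" by (intro power_mono) auto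
  also have "\<dots> = exp (?y * (- 1 / ?y))" by (rule exp_of_nat_mult[symmetric])
  also have "\<dots> = exp (- 1)" by simp
  finally have "exp 1 * (?x / ?y) ^ Suc n \<le> exp 1 * exp (- 1)" by (intro mult_left_mono) auto
  also have "\<dots> = 1" by (simp flip: exp_add)
  finally have "exp 1 * ?x ^ Suc n / ?y ^ Suc n \<le> 1"
    by (simp only: power_divide times_divide_eq_right)
  moreover have "0 < ?y ^ Suc n" by (rule zero_less_power) simp
  ultimately have *: "exp 1 * ?x ^ Suc n \<le> ?y ^ Suc n" by (simp only: pos_divide_le_eq mult_1_left)
  have "fact (Suc n) * exp ?y = ?y * exp 1 * (fact n * exp ?x)" by (simp add: exp_add algebra_simps)
  also have "\<dots> \<le> ?y * exp 1 * (exp 1 * ?x * ?x ^ n)" using Suc.IH by (intro mult_left_mono) auto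
  also have "\<dots> = exp 1 * ?y * (exp 1 * ?x ^ Suc n)" by (simp add: algebra_simps)
  also have "\<dots> \<le> exp 1 * ?y * ?y ^ Suc n" using * by (intro mult_left_mono) auto
  finally show ?case .
qed simp

lemma prod_falling_fact: "m \<le> N \<Longrightarrow> (\<Prod>i<m. real N - real i) * fact (N - m) = fact N"
proof (induction m)
  case (Suc m)
  have "fact (N - m) = (real N - real m) * fact (N - Suc m)"
    using Suc.prems by (simp add: fact_reduce of_nat_diff)
  then have "(\<Prod>i<Suc m. real N - real i) * fact (N - Suc m) = (\<Prod>i<m. real N - real i) * fact (N - m)"
    by simp
  then show ?case using Suc by simp
qed simp

text \<open>The birthday probability: \<open>m\<close> independent uniform choices among
  \<open>N\<close> colors are pairwise different.\<close>

definition rainbow :: "nat \<Rightarrow> nat \<Rightarrow> real" where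
  "rainbow N m = (\<Prod>i<m. 1 - real i / real N)"

lemma rainbow_antimono: "m \<le> m' \<Longrightarrow> m' \<le> N \<Longrightarrow> rainbow N m' \<le> rainbow N m"
proof (induction m' rule: dec_induct)
  case (step m')
  have "0 \<le> rainbow N m'" unfolding rainbow_def
    using step.prems by (intro prod_nonneg) (auto simp: field_simps)
  then have "rainbow N m' * (1 - real m' / real N) \<le> rainbow N m' * 1"
    by (intro mult_left_mono) auto
  then show ?case using step by (simp add: rainbow_def)
qed simp

text \<open>Here \<open>rainbow (4 * j) (3 * j)\<close> equals
  \<open>(4j)! / (j! * (4j) ^ (3j))\<close>. Bounding \<open>(4j)!\<close> from below and
  \<open>j!\<close> from above by the two preceding estimates leaves \<open>(4 / e ^ 3) ^ j\<close>,
  up to the factor \<open>e * j\<close> lost in the second one.\<close>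

lemma rainbow_three_quarters:
  assumes "j \<ge> 1"
  shows "(4 / exp 3) ^ j \<le> exp 1 * real j * rainbow (4 * j) (3 * j)"
proof -
  let ?N = "4 * j"
  have N: "real ?N > 0" using assms by simp
  have "rainbow ?N (3 * j) * real ?N ^ (3 * j) = (\<Prod>i<3 * j. (1 - real i / real ?N) * real ?N)"
    by (simp add: rainbow_def prod.distrib)
  also have "\<dots> = (\<Prod>i<3 * j. real ?N - real i)" using N by (intro prod.cong) (auto simp: field_simps)
  finally have "rainbow ?N (3 * j) * real ?N ^ (3 * j) * fact j = fact ?N"
    using prod_falling_fact[of "3 * j" ?N] by simp
  then have "real ?N ^ ?N \<le> rainbow ?N (3 * j) * real ?N ^ (3 * j) * fact j * exp (real ?N)"
    using power_div_fact_le_exp[of ?N] by simp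
  moreover have "real ?N ^ (3 * j + j) = real ?N ^ (3 * j) * (4 ^ j * real j ^ j)"
    unfolding power_add by (simp add: power_mult_distrib)
  then have "real ?N ^ ?N = real ?N ^ (3 * j) * (4 ^ j * real j ^ j)" by simp
  ultimately have "real ?N ^ (3 * j) * (4 ^ j * real j ^ j) \<le>
      real ?N ^ (3 * j) * (rainbow ?N (3 * j) * fact j * exp (real ?N))"
    by (simp only: mult_ac)
  then have "4 ^ j * real j ^ j \<le> rainbow ?N (3 * j) * fact j * exp (real ?N)"
    using N by (subst (asm) mult_le_cancel_left_pos) auto
  also have "exp (real ?N) = exp (3 * real j) * exp (real j)" by (simp flip: exp_add)
  also have "rainbow ?N (3 * j) * fact j * (exp (3 * real j) * exp (real j)) =
      rainbow ?N (3 * j) * exp (3 * real j) * (fact j * exp (real j))"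
    by (simp only: mult_ac)
  also have "\<dots> \<le> rainbow ?N (3 * j) * exp (3 * real j) * (exp 1 * real j * real j ^ j)"
  proof (intro mult_left_mono fact_le_power assms mult_nonneg_nonneg)
    show "0 \<le> rainbow ?N (3 * j)" unfolding rainbow_def
      using assms by (intro prod_nonneg) (auto simp: field_simps)
  qed auto
  finally have "real j ^ j * 4 ^ j \<le> real j ^ j * (exp 1 * real j * rainbow ?N (3 * j) * exp (3 * real j))"
    by (simp only: mult_ac)
  then have "4 ^ j \<le> exp 1 * real j * rainbow ?N (3 * j) * exp (3 * real j)"
    using assms by (subst (asm) mult_le_cancel_left_pos) auto
  moreover have "exp (3 * real j) = exp 3 ^ j" by (simp add: exp_of_nat_mult mult.commute)
  ultimately show ?thesis by (simp add: power_divide field_simps)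
qed

lemma exp_one_bounds: "exp 1 \<le> (2.72 :: real)"
  using e_less_272 by simp

text \<open>The origin of the constant 161: \<open>2.72 ^ 3 = 20.123648\<close> lies just below
  \<open>161 / 8 = 20.125\<close>, so \<open>161 / 32\<close> is a rational upper bound for
  \<open>e ^ 3 / 4\<close>.\<close>

lemma exp_three_le: "exp 3 \<le> (161 / 8 :: real)"
proof -
  have "exp 3 = (exp 1 :: real) ^ 3" by (simp flip: exp_of_nat_mult)
  also have "\<dots> \<le> 2.72 ^ 3" using exp_one_bounds by (intro power_mono) auto
  also have "\<dots> \<le> 161 / 8" by (simp add: power3_eq_cube)
  finally show ?thesis .
qed

lemma trials_aux_ge: "real r * (161 / 32) ^ i \<le> real (trials_aux r i)"
proof (induction i)
  case (Suc i)
  have "trials_aux r i * 161 \<le> trials_aux r i * 161 div 32 * 32 + 32"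
    using div_mult_mod_eq[of "trials_aux r i * 161" 32] mod_less_divisor[of 32 "trials_aux r i * 161"]
    by linarith
  then have "trials_aux r i * 161 \<le> trials_aux r (Suc i) * 32" by simp
  then have "real (trials_aux r i) * 161 \<le> real (trials_aux r (Suc i)) * 32"
    by (metis of_nat_le_iff of_nat_mult of_nat_numeral)
  then show ?case using Suc by simp
qed simp

lemma trials_aux_le_real: "real (trials_aux r i) \<le> (real r + 1) * (161 / 32) ^ i"
proof -
  \<comment> \<open>The added 1 strengthens the induction hypothesis: the rounding is absorbed
    because \<open>c * x + 2 \<le> c * (x + 1)\<close> for \<open>c = 161 / 32\<close>.\<close>
  have "real (trials_aux r i) + 1 \<le> (real r + 1) * (161 / 32) ^ i"
  proof (induction i)
    case (Suc i)
    have "trials_aux r i * 161 div 32 * 32 \<le> trials_aux r i * 161" by (rule div_times_less_eq_dividend)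
    then have "real (trials_aux r i * 161 div 32) * 32 \<le> real (trials_aux r i) * 161"
      by (metis of_nat_le_iff of_nat_mult of_nat_numeral)
    then show ?case using Suc by simp
  qed simp
  then show ?thesis by simp
qed

lemma num_groups_pos: "1 \<le> num_groups k" and num_groups_bounds: "k \<le> 3 * num_groups k" "3 * num_groups k \<le> k + 3"
  by (auto simp: num_groups_def)

text \<open>A trial will succeed with probability at least a quarter of \<open>rainbow\<close>, so 5
  amounts to 5/4 expected successes. The initial value \<open>16 * num_groups k\<close> of the
  trials is chosen for this: one factor cancels the loss of \<open>e * j\<close> in
  \<open>rainbow_three_quarters\<close>, and \<open>16 / e > 5\<close>.\<close>

lemma trials_rainbow: "5 \<le> trials k * rainbow (num_colors k) k"
proof -
  let ?j = "num_groups k"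
  have j: "1 \<le> ?j" by (rule num_groups_pos)
  have r: "rainbow (4 * ?j) (3 * ?j) \<le> rainbow (4 * ?j) k"
    using num_groups_bounds(1) by (intro rainbow_antimono) auto
  have "1 \<le> (161 / 32 * (4 / exp 3) :: real)" using exp_three_le by (simp add: field_simps)
  then have "1 \<le> (161 / 32 * (4 / exp 3) :: real) ^ ?j" by (rule one_le_power)
  then have "16 * real ?j * 1 \<le> 16 * real ?j * (161 / 32 * (4 / exp 3)) ^ ?j"
    by (intro mult_left_mono) auto
  also have "\<dots> = (16 * real ?j * (161 / 32) ^ ?j) * (4 / exp 3) ^ ?j" by (simp only: power_mult_distrib mult_ac)
  also have "\<dots> \<le> (16 * real ?j * (161 / 32) ^ ?j) * (exp 1 * real ?j * rainbow (4 * ?j) k)"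
  proof (intro mult_left_mono)
    have "exp 1 * real ?j * rainbow (4 * ?j) (3 * ?j) \<le> exp 1 * real ?j * rainbow (4 * ?j) k"
      using r by (intro mult_left_mono) auto
    then show "(4 / exp 3) ^ ?j \<le> exp 1 * real ?j * rainbow (4 * ?j) k"
      using rainbow_three_quarters[OF j] by linarith
  qed auto
  also have "\<dots> \<le> real (trials k) * (exp 1 * real ?j * rainbow (4 * ?j) k)"
  proof (intro mult_right_mono)
    show "16 * real ?j * (161 / 32) ^ ?j \<le> real (trials k)"
      using trials_aux_ge[of "16 * ?j" ?j] by (simp add: trials_def)
    have "0 \<le> rainbow (4 * ?j) k" unfolding rainbow_def
      using num_groups_bounds(1)[of k] j by (intro prod_nonneg) (auto simp: field_simps)
    then show "0 \<le> exp 1 * real ?j * rainbow (4 * ?j) k" by simp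
  qed
  also have "\<dots> = real ?j * (exp 1 * (real (trials k) * rainbow (num_colors k) k))"
    by (simp add: num_colors_def)
  finally have "real ?j * 16 \<le> real ?j * (exp 1 * (real (trials k) * rainbow (num_colors k) k))" by simp
  then have *: "16 \<le> exp 1 * (real (trials k) * rainbow (num_colors k) k)"
    using j by (subst (asm) mult_le_cancel_left_pos) auto
  show ?thesis
  proof (rule ccontr)
    assume "\<not> 5 \<le> trials k * rainbow (num_colors k) k"
    then have "exp 1 * (real (trials k) * rainbow (num_colors k) k) \<le> exp 1 * 5"
      by (intro mult_left_mono) auto
    also have "\<dots> \<le> 2.72 * 5" using exp_one_bounds by simp
    finally show False using * by simp
  qed
qed

text \<open>The threshold 5/4 works since \<open>1 + 5/4 + (5/4)^2 / 2 = 97/32\<close>, a lower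
  bound for \<open>exp (5/4)\<close>, exceeds 3.\<close>

lemma failure_le_third:
  fixes x :: real
  assumes "0 \<le> x" "x \<le> 1" "5 / 4 \<le> real R * x"
  shows "(1 - x) ^ R \<le> 1 / 3"
proof -
  have "1 - x \<le> exp (- x)" using exp_ge_add_one_self[of "- x"] by simp
  then have "(1 - x) ^ R \<le> exp (- x) ^ R" using assms by (intro power_mono) auto
  also have "exp (- x) ^ R = exp (real R * - x)" by (rule exp_of_nat_mult[symmetric])
  also have "\<dots> = inverse (exp (real R * x))" by (simp add: exp_minus)
  also have "\<dots> \<le> inverse 3"
  proof (rule le_imp_inverse_le)
    have "(5 / 4) * (5 / 4) \<le> (real R * x) * (real R * x)" using assms by (intro mult_mono) auto
    then have "3 \<le> 1 + real R * x + (real R * x)\<^sup>2 / 2" using assms by (simp add: power2_eq_square)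
    also have "\<dots> \<le> exp (real R * x)" using assms by (intro exp_lower_Taylor_quadratic) auto
    finally show "3 \<le> exp (real R * x)" .
  qed simp
  finally show ?thesis by (simp add: inverse_eq_divide)
qed

lemma trials_times_subsets:
  "real (trials k) * 2 ^ num_colors k \<le> 81 * (16 * real k + 65) * 4.32 ^ k"
proof -
  let ?j = "num_groups k"
  have "real (trials k) \<le> (16 * real ?j + 1) * (161 / 32) ^ ?j"
    using trials_aux_le_real[of "16 * ?j" ?j] by (simp add: trials_def)
  then have "real (trials k) * 2 ^ num_colors k \<le> (16 * real ?j + 1) * (161 / 32) ^ ?j * 16 ^ ?j"
    by (intro mult_mono) (auto simp: num_colors_def power_mult)
  also have "\<dots> = (16 * real ?j + 1) * (161 / 2) ^ ?j" by (simp flip: power_mult_distrib)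
  \<comment> \<open>The exponential base fits narrowly: \<open>161 / 2 = 80.5\<close> against
    \<open>4.32 ^ 3 = 80.621568\<close>.\<close>
  also have "\<dots> \<le> (16 * real ?j + 1) * (4.32 ^ 3) ^ ?j"
    by (intro mult_left_mono power_mono) (auto simp: power3_eq_cube)
  also have "\<dots> = (16 * real ?j + 1) * 4.32 ^ (3 * ?j)" by (simp only: power_mult)
  also have "\<dots> \<le> (16 * real k + 65) * 4.32 ^ (k + 3)"
  proof (intro mult_mono power_increasing)
    have "real ?j \<le> real (k + 1)" by (subst of_nat_le_iff) (simp add: num_groups_def)
    then show "16 * real ?j + 1 \<le> 16 * real k + 65" by simp
  qed (use num_groups_bounds in auto)
  also have "(4.32 :: real) ^ (k + 3) \<le> 81 * 4.32 ^ k" by (simp add: power_add power3_eq_cube)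
  then have "(16 * real k + 65) * 4.32 ^ (k + 3) \<le> (16 * real k + 65) * (81 * 4.32 ^ k)"
    by (intro mult_left_mono) auto
  finally show ?thesis by (simp only: mult_ac)
qed

section \<open>The probability of success\<close>

lemma coin_number_cong:
  "(\<And>p. p < l \<Longrightarrow> w !! p = w' !! p) \<Longrightarrow> coin_number l w = coin_number l w'"
  by (induction l) auto

lemma coin_number_bits:
  assumes "x < 2 ^ l" and bits: "\<And>p. p < l \<Longrightarrow> w !! p = odd (x div 2 ^ (l - 1 - p))"
  shows "coin_number l w = x"
proof -
  have "coin_number p w = x div 2 ^ (l - p)" if "p \<le> l" for p
    using that
  proof (induction p)
    case (Suc p)
    let ?y = "x div 2 ^ (l - Suc p)"
    have "l - p = Suc (l - Suc p)" using Suc.prems by simp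
    then have "coin_number p w = ?y div 2"
      using Suc by (simp add: div_mult2_eq[symmetric] mult.commute)
    then show ?case using bits[of p] Suc.prems by simp
  qed (use assms in simp)
  from this[of l] show ?thesis by simp
qed

context kmmd
begin

lemma snth_eq_if_stake_eq:
  assumes "stake N w = stake N w'" "p < N"
  shows "w !! p = w' !! p"
  using assms stake_nth by metis

lemma color_weight_cong:
  assumes "stake block w = stake block w'" "i < n"
  shows "color w i = color w' i" "weight w i = weight w' i"
proof -
  have "(2 * i + 2) * wb \<le> 2 * n * wb" using assms(2) by (intro mult_right_mono) auto
  then have "2 * i * wb + p < block" "(2 * i + 1) * wb + p < block" if "p < wb" for p
    using that by (simp_all add: algebra_simps)
  then have "sdrop (2 * i * wb) w !! p = sdrop (2 * i * wb) w' !! p"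
      "sdrop ((2 * i + 1) * wb) w !! p = sdrop ((2 * i + 1) * wb) w' !! p" if "p < wb" for p
    unfolding sdrop_snth using snth_eq_if_stake_eq[OF assms(1)] that by blast+
  then have "coin_number wb (sdrop (2 * i * wb) w) = coin_number wb (sdrop (2 * i * wb) w')"
    "coin_number wb (sdrop ((2 * i + 1) * wb) w) = coin_number wb (sdrop ((2 * i + 1) * wb) w')"
    by (intro coin_number_cong; blast)+
  then show "color w i = color w' i" "weight w i = weight w' i"
    unfolding color_def weight_def by (simp_all only:)
qed

lemma colorful_cong:
  assumes "\<And>i. i < n \<Longrightarrow> c i = c' i"
  shows "colorful c = colorful c'"
proof -
  have "inj_on c (keys m) = inj_on c' (keys m)" if "m \<in> keys f" for m
    using keys_f[OF that] assms by (intro inj_on_cong) auto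
  then show ?thesis unfolding colorful_def by auto
qed

lemma mweight_cong:
  assumes "\<And>i. i < n \<Longrightarrow> u i = u' i" "m \<in> colorful c"
  shows "mweight u m = mweight u' m"
proof -
  have "keys m \<subseteq> {..<n}" using assms(2) keys_f by (simp add: colorful_def)
  then show ?thesis unfolding mweight_def using assms(1) by (intro sum.cong) auto
qed

text \<open>By \<open>score_eq\<close> a hit is determined by the colors and weights of the
  variables below \<open>n\<close>, and these are read from the first \<open>block\<close>
  coins.\<close>

lemma hit_cong:
  assumes "stake block w = stake block w'"
  shows "hit w = hit w'"
proof -
  have c: "colorful (color w) = colorful (color w')"
    by (rule colorful_cong) (rule color_weight_cong[OF assms])
  have "mweight (weight w) m = mweight (weight w') m" if "m \<in> colorful (color w')" for m
    by (rule mweight_cong[OF _ that]) (rule color_weight_cong[OF assms])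
  then have "{m. m \<in> colorful (color w) \<and> mweight (weight w) m = r} =
      {m. m \<in> colorful (color w') \<and> mweight (weight w') m = r}" for r
    unfolding c by auto
  then show ?thesis unfolding hit_def by (simp add: score_eq cong: conj_cong)
qed

text \<open>The padding of the list is arbitrary; by \<open>hit_cong\<close> the coins after the
  block have no influence.\<close>

definition hit_block :: "bool list \<Rightarrow> bool" where
  "hit_block bs = hit (bs @- sconst False)"

lemma hit_eq_hit_block: "hit w = hit_block (stake block w)"
  unfolding hit_block_def by (rule hit_cong) (simp add: stake_shift)

definition num_hits :: nat where
  "num_hits = card {bs. length bs = block \<and> hit_block bs}"

lemma finite_blocks: "finite {bs :: bool list. length bs = m \<and> P bs}"
  by (rule finite_subset[OF _ finite_lists_length_eq[of "UNIV :: bool set" m]]) auto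

lemma card_blocks: "card {bs :: bool list. length bs = m} = 2 ^ m"
  using card_lists_length_eq[of "UNIV :: bool set" m] by simp

lemma card_Collect_neg:
  "card {bs :: bool list. length bs = m \<and> \<not> P bs} = 2 ^ m - card {bs. length bs = m \<and> P bs}"
proof -
  have "{bs :: bool list. length bs = m \<and> \<not> P bs} = {bs. length bs = m} - {bs. length bs = m \<and> P bs}"
    by auto
  then show ?thesis unfolding card_blocks[symmetric]
    using finite_blocks[of m P] by (simp only:) (rule card_Diff_subset, auto)
qed

lemma num_hits_le: "num_hits \<le> 2 ^ block"
  unfolding num_hits_def card_blocks[symmetric] by (rule card_mono) (use finite_blocks[of _ "\<lambda>_. True"] in auto)

lemma measure_some_hit:
  "measure coin_space {w. \<exists>r<R. hit (sdrop (r * block) w)} = 1 - (1 - num_hits / 2 ^ block) ^ R"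
proof -
  let ?fail = "\<lambda>bs. \<forall>r<R. \<not> hit_block (take block (drop (r * block) bs))"
  have "hit (sdrop (r * block) w) \<longleftrightarrow> hit_block (take block (drop (r * block) (stake (R * block) w)))"
    if "r < R" for r w
  proof -
    have "(r + 1) * block \<le> R * block" using that by (intro mult_right_mono) auto
    then have "block \<le> R * block - r * block" by (simp add: algebra_simps)
    then show ?thesis by (simp add: hit_eq_hit_block drop_stake take_stake min_def)
  qed
  then have "{w. \<exists>r<R. hit (sdrop (r * block) w)} = {w. \<not> ?fail (stake (R * block) w)}"
    by blast
  then have "measure coin_space {w. \<exists>r<R. hit (sdrop (r * block) w)} =
      real (card {bs. length bs = R * block \<and> \<not> ?fail bs}) / 2 ^ (R * block)"
    using measure_stake[of "\<lambda>bs. \<not> ?fail bs" "R * block"] by (simp only:)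
  also have "card {bs. length bs = R * block \<and> \<not> ?fail bs} =
      2 ^ (R * block) - (2 ^ block - num_hits) ^ R"
    unfolding card_Collect_neg card_independent_failures[of R block "\<lambda>bs. \<not> hit_block bs"] num_hits_def ..
  also have "real (2 ^ (R * block) - (2 ^ block - num_hits) ^ R) / 2 ^ (R * block) =
      1 - ((2 ^ block - real num_hits) / 2 ^ block) ^ R"
  proof -
    have "(2 ^ block - num_hits) ^ R \<le> (2 ^ block) ^ R" by (intro power_mono) auto
    also have "\<dots> = 2 ^ (R * block)" by (simp add: power_mult mult.commute[of R])
    finally have "real (2 ^ (R * block) - (2 ^ block - num_hits) ^ R) =
        2 ^ (R * block) - (2 ^ block - real num_hits) ^ R"
      using num_hits_le by (simp add: of_nat_diff)
    moreover have "(2 :: real) ^ (R * block) = (2 ^ block) ^ R" by (simp add: power_mult mult.commute[of R])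
    ultimately show ?thesis by (simp only: power_divide) (simp add: diff_divide_distrib)
  qed
  finally show ?thesis by (simp add: diff_divide_distrib)
qed

section \<open>Colors and weights as uniform draws, and the success of a single trial\<close>

abbreviation "draws \<equiv> PiE {..<n} (\<lambda>_. {..<W})"

definition lucky :: "(nat \<Rightarrow> nat) \<Rightarrow> (nat \<Rightarrow> nat) \<Rightarrow> bool" where
  "lucky a u \<longleftrightarrow> (\<exists>m0\<in>colorful (\<lambda>i. a i mod K). \<forall>m\<in>colorful (\<lambda>i. a i mod K).
     m \<noteq> m0 \<longrightarrow> mweight u m \<noteq> mweight u m0)"

lemma realize_draw:
  assumes "a \<in> draws" "u \<in> draws"
  obtains w where "\<And>i. i < n \<Longrightarrow> coin_number wb (sdrop (2 * i * wb) w) = a i"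
    "\<And>i. i < n \<Longrightarrow> weight w i = u i"
proof -
  define x where "x s = (if even s then a (s div 2) else u (s div 2))" for s
  define w where "w = smap (\<lambda>t. odd (x (t div wb) div 2 ^ (wb - 1 - t mod wb))) nats"
  have *: "coin_number wb (sdrop (s * wb) w) = x s" if "x s < W" for s
  proof (rule coin_number_bits)
    show "x s < 2 ^ wb" using that by (simp add: max_weight_def)
    fix p assume "p < wb"
    then show "sdrop (s * wb) w !! p = odd (x s div 2 ^ (wb - 1 - p))"
      by (simp add: w_def sdrop_snth)
  qed
  have x: "x (2 * i) = a i" "x (2 * i + 1) = u i" for i by (simp_all add: x_def)
  have less: "a i < W" "u i < W" if "i < n" for i
    using PiE_mem[OF assms(1), of i] PiE_mem[OF assms(2), of i] that by simp_all
  show ?thesis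
  proof (rule that[of w])
    fix i assume "i < n"
    then show "coin_number wb (sdrop (2 * i * wb) w) = a i" "weight w i = u i"
      using *[of "2 * i"] *[of "2 * i + 1"] less unfolding x weight_def by blast+
  qed
qed

text \<open>Decoding the blocks that hit reaches every lucky pair, and a lower bound for the number
  of hits needs only this surjectivity. A lucky pair is first realized by a coin stream, whose
  initial block is then taken.\<close>

lemma card_lucky_le: "card {(a, u). a \<in> draws \<and> u \<in> draws \<and> lucky a u} \<le> num_hits"
proof -
  let ?G = "{(a, u). a \<in> draws \<and> u \<in> draws \<and> lucky a u}"
  let ?num = "\<lambda>s bs. coin_number wb (sdrop (s * wb) (bs @- sconst False))"
  let ?dec = "\<lambda>bs. (restrict (\<lambda>i. ?num (2 * i) bs) {..<n}, restrict (\<lambda>i. ?num (2 * i + 1) bs) {..<n})"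
  have "?G \<subseteq> ?dec ` {bs. length bs = block \<and> hit_block bs}"
  proof
    fix p assume "p \<in> ?G"
    then obtain a u where p: "p = (a, u)" and a: "a \<in> draws" and u: "u \<in> draws" and l: "lucky a u"
      by blast
    obtain w where w: "\<And>i. i < n \<Longrightarrow> coin_number wb (sdrop (2 * i * wb) w) = a i"
      "\<And>i. i < n \<Longrightarrow> weight w i = u i" by (rule realize_draw[OF a u]) blast
    have c: "colorful (color w) = colorful (\<lambda>i. a i mod K)"
      by (rule colorful_cong) (simp add: color_def w)
    have mw: "mweight (weight w) m = mweight u m" if "m \<in> colorful (color w)" for m
      by (rule mweight_cong[OF _ that]) (rule w)
    from l obtain m0 where m0: "m0 \<in> colorful (color w)"
      and iso: "\<forall>m\<in>colorful (color w). m \<noteq> m0 \<longrightarrow> mweight u m \<noteq> mweight u m0"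
      unfolding lucky_def c[symmetric] by (elim bexE)
    have "hit w" by (rule isolated_imp_hit[OF m0]) (use iso mw m0 in simp)
    then have h: "hit_block (stake block w)" by (simp add: hit_eq_hit_block)
    let ?w' = "stake block w @- sconst False"
    have "stake block ?w' = stake block w" by (simp add: stake_shift)
    then have "coin_number wb (sdrop (2 * i * wb) ?w') = a i" "weight ?w' i = u i" if "i < n" for i
    proof -
      have "(2 * i + 1) * wb \<le> 2 * n * wb" using that by (intro mult_right_mono) auto
      then have "coin_number wb (sdrop (2 * i * wb) ?w') = coin_number wb (sdrop (2 * i * wb) w)"
        using snth_eq_if_stake_eq[OF \<open>stake block ?w' = stake block w\<close>]
        by (intro coin_number_cong) (simp add: sdrop_snth)
      then show "coin_number wb (sdrop (2 * i * wb) ?w') = a i" using w that by simp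
      show "weight ?w' i = u i"
        using color_weight_cong(2)[OF \<open>stake block ?w' = stake block w\<close> that] w that by simp
    qed
    then have "restrict (\<lambda>i. ?num (2 * i) (stake block w)) {..<n} = restrict a {..<n}"
      "restrict (\<lambda>i. ?num (2 * i + 1) (stake block w)) {..<n} = restrict u {..<n}"
      unfolding weight_def by (intro restrict_ext; simp)+
    then have "?dec (stake block w) = p"
      unfolding p using PiE_restrict[OF a] PiE_restrict[OF u] by (simp only:)
    then show "p \<in> ?dec ` {bs. length bs = block \<and> hit_block bs}"
      using h by (intro image_eqI[of _ _ "stake block w"]) simp_all
  qed
  then show ?thesis unfolding num_hits_def by (intro surj_card_le finite_blocks)
qed

lemma mweight_multilinear: "multilinear m \<Longrightarrow> mweight u m = sum u (keys m)"
  unfolding mweight_def by (intro sum.cong) (simp_all add: monomial_degree_multilinear(1))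

lemma isolating_imp_lucky:
  assumes "isolating (keys ` colorful (\<lambda>i. a i mod K)) u"
  shows "lucky a u"
proof -
  let ?M = "colorful (\<lambda>i. a i mod K)"
  have mult: "multilinear m" if "m \<in> ?M" for m using that by (simp add: colorful_def)
  obtain m0 where m0: "m0 \<in> ?M" "\<forall>T\<in>keys ` ?M. T \<noteq> keys m0 \<longrightarrow>
      sum u T \<noteq> sum u (keys m0)"
    using assms unfolding isolating_def by blast
  have "mweight u m \<noteq> mweight u m0" if "m \<in> ?M" "m \<noteq> m0" for m
  proof -
    have "keys m \<noteq> keys m0"
      using multilinear_keys_inj[OF mult[OF that(1)] mult[OF m0(1)]] that(2) by blast
    then show ?thesis using m0(2) that(1) mult m0(1) by (simp add: mweight_multilinear)
  qed
  then show ?thesis unfolding lucky_def using m0(1) by blast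
qed

lemma max_weight_ge: "2 * n + 2 * k * K \<le> W" "0 < W"
  using log_ceil(1)[of "weight_target n k"]
  by (simp_all add: max_weight_def weight_bits_def weight_target_def)

lemma card_colorful_draws:
  assumes "colorful (\<lambda>i. a i mod K) \<noteq> {}"
  shows "W ^ n \<le> 2 * card {u \<in> draws. lucky a u}"
proof -
  let ?F = "keys ` colorful (\<lambda>i. a i mod K)"
  have "W ^ card {..<n} \<le> 2 * card {u \<in> draws. isolating ?F u}"
  proof (rule isolation_lemma)
    show "\<Union>?F \<subseteq> {..<n}" using keys_f by (auto simp: colorful_def)
    show "2 * card {..<n} \<le> W" using max_weight_ge by simp
  qed (use assms in auto)
  also have "card {u \<in> draws. isolating ?F u} \<le> card {u \<in> draws. lucky a u}"
  proof (rule card_mono)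
    have "finite draws" by (intro finite_PiE) auto
    then show "finite {u \<in> draws. lucky a u}" by simp
    show "{u \<in> draws. isolating ?F u} \<subseteq> {u \<in> draws. lucky a u}" using isolating_imp_lucky by blast
  qed
  finally show ?thesis by simp
qed

lemma card_rainbow_draws:
  assumes "T \<subseteq> {..<n}" "card T = k"
  shows "real W ^ n / 2 * rainbow K k \<le> card {a \<in> draws. inj_on (\<lambda>i. a i mod K) T}"
proof -
  let ?q = "W div K"
  have K: "0 < K" by (rule num_colors_pos)
  have "card ({..<n} - T) = n - k" "{..<n} \<inter> T = T" "k \<le> n"
    using assms card_mono[of "{..<n}" T] by (auto simp: card_Diff_subset finite_subset)
  then have "W ^ (n - k) * (\<Prod>j<k. (K - j) * ?q) \<le> card {a \<in> draws. inj_on (\<lambda>i. a i mod K) T}"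
    using card_injective_colorings[of "{..<n}" W T K] assms by simp
  then have "real (W ^ (n - k) * (\<Prod>j<k. (K - j) * ?q)) \<le> real (card {a \<in> draws. inj_on (\<lambda>i. a i mod K) T})"
    by (subst of_nat_le_iff)
  then have 1: "real W ^ (n - k) * (\<Prod>j<k. real (K - j) * real ?q) \<le> card {a \<in> draws. inj_on (\<lambda>i. a i mod K) T}"
    by (simp only: of_nat_mult of_nat_power of_nat_prod)
  have "(\<Prod>j<k. real (K - j) * real ?q) = (\<Prod>j<k. (1 - real j / real K) * (real K * real ?q))"
    using num_colors_gt K by (intro prod.cong refl) (simp add: of_nat_diff field_simps)
  also have "\<dots> = rainbow K k * (real K * real ?q) ^ k" by (simp add: rainbow_def prod.distrib)
  finally have 2: "(\<Prod>j<k. real (K - j) * real ?q) = rainbow K k * (real K * real ?q) ^ k" .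
  have W: "0 < real W" using max_weight_ge by simp
  have "W \<le> K * ?q + K"
    using mult_div_mod_eq[of K W] mod_less_divisor[OF K, of W] by linarith
  then have "real W \<le> real (K * ?q + K)" by (subst of_nat_le_iff)
  then have q: "real W - real K \<le> real K * real ?q" by simp
  \<comment> \<open>Dropping the incomplete period replaces \<open>W\<close> by at least
    \<open>W - K\<close> in each of \<open>k\<close> factors. Bernoulli's inequality bounds the loss
    by \<open>1 - k * K / W\<close>, which is at least 1/2 by the choice of the weight
    target.\<close>
  have 3: "real W ^ k / 2 \<le> (real K * real ?q) ^ k"
  proof (cases "k = 0")
    case False
    have kK: "real (2 * k * K) \<le> real W" using max_weight_ge by (subst of_nat_le_iff) simp
    have "real K \<le> real (2 * k * K)" using False by (subst of_nat_le_iff) simp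
    then have KW: "real K \<le> real W" using kK by linarith
    have "1 / 2 \<le> 1 + real k * (- (real K / real W))" using kK W by (simp add: field_simps)
    also have "\<dots> \<le> (1 + - (real K / real W)) ^ k"
      using KW W by (intro Bernoulli_inequality) (simp add: field_simps)
    finally have "real W ^ k * (1 / 2) \<le> real W ^ k * (1 + - (real K / real W)) ^ k"
      by (intro mult_left_mono) auto
    also have "\<dots> = (real W * (1 + - (real K / real W))) ^ k" by (simp only: power_mult_distrib)
    also have "real W * (1 + - (real K / real W)) = real W - real K" using W by (simp add: field_simps)
    also have "(real W - real K) ^ k \<le> (real K * real ?q) ^ k" using q KW by (intro power_mono) auto
    finally show ?thesis by simp
  qed simp
  have r: "0 \<le> rainbow K k" unfolding rainbow_def
    using num_colors_gt K by (intro prod_nonneg) (auto simp: field_simps)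
  have "real W ^ n = real W ^ (n - k) * real W ^ k" using \<open>k \<le> n\<close> by (simp flip: power_add)
  then have "real W ^ n / 2 * rainbow K k = real W ^ (n - k) * (rainbow K k * (real W ^ k / 2))" by simp
  also have "\<dots> \<le> real W ^ (n - k) * (rainbow K k * (real K * real ?q) ^ k)"
    using 3 r by (intro mult_left_mono) auto
  finally show ?thesis using 1 2 by simp
qed

text \<open>The quarter consists of one half for the bias of the colors and one half for isolation.
  A single monomial \<open>m\<close> is fixed to estimate the colorings; for each coloring that
  makes \<open>m\<close> colorful, isolation is applied to the whole nonempty family of colorful
  monomials, which may single out another one.\<close>

lemma num_hits_ge:
  assumes "has_multilinear_monomial k f"
  shows "rainbow K k / 4 \<le> num_hits / 2 ^ block"
proof -
  obtain m where m: "multilinear m" "monomial_degree m = k" "m \<in> keys f"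
    using assms by (auto simp: has_multilinear_monomial_def in_keys_iff)
  let ?T = "keys m"
  let ?A = "{a \<in> draws. inj_on (\<lambda>i. a i mod K) ?T}"
  have fin: "finite draws" by (intro finite_PiE) auto
  have T: "?T \<subseteq> {..<n}" "card ?T = k"
    using m keys_f monomial_degree_multilinear(2)[of m] by auto
  have "card ?A * W ^ n \<le> (\<Sum>a\<in>?A. 2 * card {u \<in> draws. lucky a u})"
  proof -
    have "W ^ n \<le> 2 * card {u \<in> draws. lucky a u}" if "a \<in> ?A" for a
    proof (rule card_colorful_draws)
      have "m \<in> colorful (\<lambda>i. a i mod K)" using m that by (simp add: colorful_def)
      then show "colorful (\<lambda>i. a i mod K) \<noteq> {}" by blast
    qed
    then have "(\<Sum>a\<in>?A. W ^ n) \<le> (\<Sum>a\<in>?A. 2 * card {u \<in> draws. lucky a u})" by (rule sum_mono)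
    then show ?thesis by simp
  qed
  also have "\<dots> = 2 * card (Sigma ?A (\<lambda>a. {u \<in> draws. lucky a u}))"
    using fin by (subst card_SigmaI) (auto simp: sum_distrib_left)
  also have "card (Sigma ?A (\<lambda>a. {u \<in> draws. lucky a u})) \<le> card {(a, u). a \<in> draws \<and> u \<in> draws \<and> lucky a u}"
  proof (rule card_mono)
    show "finite {(a, u). a \<in> draws \<and> u \<in> draws \<and> lucky a u}"
      by (rule finite_subset[of _ "draws \<times> draws"]) (use fin in auto)
  qed auto
  also have "\<dots> \<le> num_hits" by (rule card_lucky_le)
  finally have "card ?A * W ^ n \<le> 2 * num_hits" by simp
  then have "real (card ?A * W ^ n) \<le> real (2 * num_hits)" by (subst of_nat_le_iff)
  then have "real (card ?A) * real W ^ n \<le> 2 * real num_hits" by simp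
  moreover have "real W ^ n / 2 * rainbow K k * real W ^ n \<le> real (card ?A) * real W ^ n"
    using card_rainbow_draws[OF T] by (intro mult_right_mono) auto
  moreover have "real W ^ n / 2 * rainbow K k * real W ^ n = 2 * (real W ^ n * real W ^ n * (rainbow K k / 4))"
    by simp
  ultimately have "real W ^ n * real W ^ n * (rainbow K k / 4) \<le> real num_hits" by linarith
  \<comment> \<open>As \<open>W\<close> is a power of two, pairs of draws and blocks of coins are
    equally numerous.\<close>
  moreover have "real W ^ n * real W ^ n = 2 ^ block"
    by (simp add: max_weight_def mult_2 flip: power_add power_mult) (simp add: algebra_simps)
  ultimately have "rainbow K k / 4 * 2 ^ block \<le> real num_hits" by (simp only: mult.commute)
  moreover have "0 < (2 :: real) ^ block" by (rule zero_less_power) simp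
  ultimately show ?thesis by (simp only: pos_le_divide_eq)
qed

theorem success_probability:
  "2 / 3 \<le> measure coin_space
     {w. (\<exists>r<trials k. hit (sdrop (r * block) w)) \<longleftrightarrow> has_multilinear_monomial k f}"
proof (cases "has_multilinear_monomial k f")
  case True
  define x where "x = real num_hits / 2 ^ block"
  have "rainbow K k \<le> 4 * x" using num_hits_ge[OF True] unfolding x_def[symmetric] by linarith
  then have "real (trials k) * rainbow K k \<le> real (trials k) * (4 * x)" by (intro mult_left_mono) auto
  moreover have "real (trials k) * (4 * x) = 4 * (real (trials k) * x)" by (rule mult.left_commute)
  ultimately have "5 / 4 \<le> real (trials k) * x" using trials_rainbow[of k] by linarith
  moreover have "x \<le> 1"
  proof -
    have "real num_hits \<le> real (2 ^ block)" using num_hits_le by (subst of_nat_le_iff)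
    then show ?thesis by (simp add: x_def)
  qed
  moreover have "0 \<le> x" by (simp add: x_def)
  ultimately have "(1 - x) ^ trials k \<le> 1 / 3" by (intro failure_le_third)
  then show ?thesis using True measure_some_hit[of "trials k", folded x_def] by simp
next
  case False
  then have "{w. (\<exists>r<trials k. hit (sdrop (r * block) w)) \<longleftrightarrow> has_multilinear_monomial k f} = UNIV"
    using hit_imp_multilinear by blast
  moreover have "measure coin_space UNIV = 1"
    using prob_space.prob_space[OF prob_space_coin_space] by (simp add: coin_space_def space_stream_space)
  ultimately show ?thesis by simp
qed

end

section \<open>Polynomial bounds\<close>

lemma poly_nat_mono: "x \<le> y \<Longrightarrow> poly p x \<le> poly p (y :: nat)"
  by (induction p) (auto intro!: add_mono mult_mono)

context kmmd
begin

context
  fixes Y :: nat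
  assumes Y: "n + k + sz + 1 \<le> Y"
begin

lemma le_powers: "a \<le> b \<Longrightarrow> Y ^ a \<le> Y ^ b" "1 \<le> Y ^ a"
  using Y by (auto intro!: power_increasing one_le_power)

lemma size_bounds:
  "K \<le> 6 * Y" "weight_target n k \<le> 15 * Y ^ 2" "W \<le> 30 * Y ^ 2" "wb \<le> 15 * Y ^ 2" "L \<le> 31 * Y ^ 4"
proof -
  have n: "n \<le> Y" and k: "k + 1 \<le> Y" using Y by simp_all
  show K: "K \<le> 6 * Y" using k by (simp add: num_colors_def num_groups_def)
  have "k * K \<le> Y * (6 * Y)" using k K by (intro mult_mono) auto
  then have "k * K \<le> 6 * Y ^ 2" by (simp add: power2_eq_square)
  moreover have "2 * k * K = 2 * (k * K)" by simp
  moreover have "Y ^ 1 \<le> Y ^ 2" "1 \<le> Y ^ 2" by (rule le_powers; simp)+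
  ultimately show t: "weight_target n k \<le> 15 * Y ^ 2"
    using n unfolding weight_target_def power_one_right by linarith
  have "W \<le> 2 * weight_target n k"
    unfolding max_weight_def weight_bits_def by (rule power_log_ceil_le) (simp add: weight_target_def)
  then show W: "W \<le> 30 * Y ^ 2" using t by linarith
  show "wb \<le> 15 * Y ^ 2"
    using t log_ceil(3)[of "weight_target n k"] unfolding weight_bits_def by linarith
  have "k * W \<le> Y * (30 * Y ^ 2)" using k W by (intro mult_mono) auto
  then have "k * W \<le> 30 * Y ^ 3" by (simp add: power2_eq_square power3_eq_cube)
  moreover have "1 \<le> Y ^ 3" by (rule le_powers)
  ultimately have "D \<le> 31 * Y ^ 3" unfolding stride_def by linarith
  then have "(k + 1) * D \<le> Y * (31 * Y ^ 3)" using k by (intro mult_mono) auto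
  then show "L \<le> 31 * Y ^ 4" by (simp add: trunc_def power_numeral_reduce)
qed

lemma small_le: "small \<le> 103 * Y ^ 4"
proof -
  have "Y ^ 1 \<le> Y ^ 4" "Y ^ 2 \<le> Y ^ 4" "1 \<le> Y ^ 4" by (rule le_powers; simp)+
  then show ?thesis using size_bounds Y unfolding small_def power_one_right by linarith
qed

lemma fld_size_le: "fld_size \<le> 34 * Y ^ 5"
proof -
  have "sz + 1 \<le> Y" using Y by simp
  then have "(sz + 1) * L \<le> Y * (31 * Y ^ 4)" using size_bounds(5) by (rule mult_mono) auto
  then have "(sz + 1) * L \<le> 31 * Y ^ 5" by (simp add: power_numeral_reduce)
  moreover have "Y ^ 1 \<le> Y ^ 5" "1 \<le> Y ^ 5" by (rule le_powers; simp)+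
  ultimately show ?thesis using Y unfolding fld_size_def power_one_right by linarith
qed

lemma cell_bits_le: "cell_bits \<le> 312 * Y ^ 5"
proof -
  have "Y ^ 1 \<le> Y ^ 5" "Y ^ 4 \<le> Y ^ 5" "1 \<le> Y ^ 5" by (rule le_powers; simp)+
  then show ?thesis
    using size_bounds(1) small_le fld_size_le Y unfolding cell_bits_def power_one_right by linarith
qed

lemma space_le:
  "space eb cell_bits (3 * sz + 3) \<le> 40 * Y * (626 * Y ^ 5) + 34 * Y ^ 5 * (313 * Y ^ 5 + eb)"
proof -
  have "1 \<le> Y ^ 5" by (rule le_powers)
  then have B: "cell_bits + 1 \<le> 313 * Y ^ 5" using cell_bits_le by linarith
  then have "2 * (cell_bits + 1) \<le> 626 * Y ^ 5" "cell_bits + 1 + eb \<le> 313 * Y ^ 5 + eb" by simp_all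
  moreover have "3 * sz + 3 + nvars + arr_size \<le> 40 * Y"
    using Y by (simp add: nvars_def arr_size_def)
  ultimately show ?thesis
    unfolding space_def using fld_size_le by - (rule add_mono[OF mult_mono' mult_mono']; simp)
qed

lemma time_le:
  "real (602 * (trials k * (2 ^ K * small ^ 3)) * (\<kappa> * unit_cost cell_bits ot \<kappa>)) \<le>
    real (602 * 81 * \<kappa> * (81 * Y) * (103 * Y ^ 4) ^ 3 * (312 * Y ^ 5 * \<kappa> + 2 + ot)) * 4.32 ^ k"
proof -
  let ?s = "(103 * Y ^ 4) ^ 3" and ?u = "312 * Y ^ 5 * \<kappa> + 2 + ot"
  have "small ^ 3 \<le> ?s" using small_le by (intro power_mono) auto
  moreover have "unit_cost cell_bits ot \<kappa> \<le> ?u"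
    unfolding unit_cost_def using cell_bits_le by (intro add_mono mult_mono) auto
  ultimately have "602 * (small ^ 3 * (\<kappa> * unit_cost cell_bits ot \<kappa>)) \<le> 602 * (?s * (\<kappa> * ?u))"
    by (intro mult_mono) auto
  then have 1: "real (602 * (small ^ 3 * (\<kappa> * unit_cost cell_bits ot \<kappa>))) \<le> real (602 * (?s * (\<kappa> * ?u)))"
    by (subst of_nat_le_iff)
  have "16 * k + 65 \<le> 81 * Y" using Y by simp
  then have "real (16 * k + 65) \<le> real (81 * Y)" by (subst of_nat_le_iff)
  then have "16 * real k + 65 \<le> real (81 * Y)" by simp
  then have "81 * (16 * real k + 65) * 4.32 ^ k \<le> 81 * real (81 * Y) * 4.32 ^ k"
    by (intro mult_right_mono mult_left_mono) auto
  then have 2: "real (trials k) * 2 ^ K \<le> 81 * real (81 * Y) * 4.32 ^ k"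
    using trials_times_subsets[of k] by linarith
  have "real (602 * (trials k * (2 ^ K * small ^ 3)) * (\<kappa> * unit_cost cell_bits ot \<kappa>)) =
    (real (trials k) * 2 ^ K) * real (602 * (small ^ 3 * (\<kappa> * unit_cost cell_bits ot \<kappa>)))"
    by (simp only: of_nat_mult of_nat_power of_nat_numeral mult_ac)
  also have "\<dots> \<le> (81 * real (81 * Y) * 4.32 ^ k) * real (602 * (?s * (\<kappa> * ?u)))"
    by (rule mult_mono'[OF 2 1]) auto
  also have "\<dots> = real (602 * 81 * \<kappa> * (81 * Y) * ?s * ?u) * 4.32 ^ k"
    by (simp only: of_nat_mult of_nat_power of_nat_numeral mult_ac)
  finally show ?thesis .
qed

end

end

theorem theorem2:
  fixes op_time elem_bits :: "nat \<Rightarrow> nat"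
  assumes "polynomially_bounded op_time" and "polynomially_bounded elem_bits"
  shows "\<exists>P :: com. \<forall>size_bound :: nat poly. \<exists>(time_factor :: nat poly) (space_bound :: nat poly).
    \<forall>(n :: nat) (k :: nat) (C :: 'f::field circuit).
      wf_circuit n C \<and> circuit_size C \<le> poly size_bound n \<longrightarrow>
        measure coin_space (answers_correctly op_time elem_bits P n k C) \<ge> 2 / 3 \<and>
        (\<forall>\<omega>. \<exists>t m s'. run op_time elem_bits P n k C \<omega> t m s' \<and>
           real t \<le> real (poly time_factor (n + k)) * 4.32 ^ k \<and>
           m \<le> poly space_bound (n + k))"
proof -
  obtain po where po: "\<And>N. op_time N \<le> poly po N"
    using assms(1) by (auto simp: polynomially_bounded_def)
  obtain pe where pe: "\<And>N. elem_bits N \<le> poly pe N"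
    using assms(2) by (auto simp: polynomially_bounded_def)
  \<comment> \<open>The program does not depend on the input, so its size is an absolute constant in
    the bounds.\<close>
  define \<kappa> where "\<kappa> = csz kmmd_program"
  show ?thesis
  proof (rule exI[of _ kmmd_program], rule allI, goal_cases)
    case (1 sb)
    \<comment> \<open>At \<open>n + k\<close> this polynomial is at least
      \<open>n + k + circuit_size C + 1\<close> and so supplies the \<open>Y\<close> of the
      polynomial bounds. The compositions with \<open>po\<close> and \<open>pe\<close> arise because
      the costs of the field are bounded in terms of the input size, itself at most
      \<open>Y\<close>.\<close>
    define py where "py = [:1, 1:] + sb"
    define time_factor where "time_factor =
      smult (602 * 81 * \<kappa>) (smult 81 py * (smult 103 (py ^ 4)) ^ 3 *
        (smult (312 * \<kappa>) (py ^ 5) + [:2:] + pcompose po py))"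
    define space_bound where "space_bound =
      smult 40 py * smult 626 (py ^ 5) + smult 34 (py ^ 5) * (smult 313 (py ^ 5) + pcompose pe py)"
    have main: "2 / 3 \<le> measure coin_space (answers_correctly op_time elem_bits kmmd_program n k C) \<and>
        (\<forall>\<omega>. \<exists>t m s'. run op_time elem_bits kmmd_program n k C \<omega> t m s' \<and>
           real t \<le> real (poly time_factor (n + k)) * 4.32 ^ k \<and>
           m \<le> poly space_bound (n + k))"
      if wfC: "wf_circuit n C" and sb: "circuit_size C \<le> poly sb n"
      for n k and C :: "'f circuit"
    proof -
      interpret kmmd n k C by unfold_locales (rule wfC)
      define Y where "Y = poly py (n + k)"
      define N where "N = input_size n k C"
      have "circuit_size C \<le> poly sb (n + k)" using sb poly_nat_mono[of n "n + k" sb] by simp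
      then have Y: "n + k + circuit_size C + 1 \<le> Y" by (simp add: Y_def py_def)
      have "N \<le> Y" using Y by (simp add: N_def input_size_def)
      then have ot: "op_time N \<le> poly po Y" and eb: "elem_bits N \<le> poly pe Y"
        using po[of N] pe[of N] poly_nat_mono[of N Y po] poly_nat_mono[of N Y pe] by simp_all
      have time: "602 * 81 * \<kappa> * (81 * Y) * (103 * Y ^ 4) ^ 3 * (312 * Y ^ 5 * \<kappa> + 2 + op_time N)
          \<le> poly time_factor (n + k)"
      proof -
        have "602 * 81 * \<kappa> * (81 * Y) * (103 * Y ^ 4) ^ 3 * (312 * Y ^ 5 * \<kappa> + 2 + op_time N)
          \<le> 602 * 81 * \<kappa> * (81 * Y) * (103 * Y ^ 4) ^ 3 * (312 * Y ^ 5 * \<kappa> + 2 + poly po Y)"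
          using ot by (intro mult_left_mono add_left_mono) auto
        also have "\<dots> = poly time_factor (n + k)"
          by (simp add: time_factor_def poly_pcompose Y_def[symmetric] mult_ac)
        finally show ?thesis .
      qed
      have space: "40 * Y * (626 * Y ^ 5) + 34 * Y ^ 5 * (313 * Y ^ 5 + elem_bits N)
          \<le> poly space_bound (n + k)"
      proof -
        have "40 * Y * (626 * Y ^ 5) + 34 * Y ^ 5 * (313 * Y ^ 5 + elem_bits N)
          \<le> 40 * Y * (626 * Y ^ 5) + 34 * Y ^ 5 * (313 * Y ^ 5 + poly pe Y)"
          using eb by (intro mult_left_mono add_left_mono) auto
        also have "\<dots> = poly space_bound (n + k)"
          by (simp add: space_bound_def poly_pcompose Y_def[symmetric] mult_ac)
        finally show ?thesis .
      qed
      have run: "\<exists>t m s'. run op_time elem_bits kmmd_program n k C \<omega> t m s' \<and>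
           real t \<le> real (poly time_factor (n + k)) * 4.32 ^ k \<and> m \<le> poly space_bound (n + k) \<and>
           (accepting s' \<longleftrightarrow> (\<exists>r<trials k. hit (sdrop (r * block) \<omega>)))" for \<omega>
      proof -
        from program_correct[of "op_time N" "elem_bits N" \<omega>, folded \<kappa>_def]
        obtain t m s' where ex: "exec (op_time N) (elem_bits N) kmmd_program (input_state n k C \<omega>) t m s'"
          and t: "t \<le> 602 * (trials k * (2 ^ num_colors k * small ^ 3)) * (\<kappa> * unit_cost cell_bits (op_time N) \<kappa>)"
          and m: "m \<le> space (elem_bits N) cell_bits (3 * circuit_size C + 3)"
          and acc: "accepting s' \<longleftrightarrow> (\<exists>r<trials k. hit (sdrop (r * block) \<omega>))"
          by blast
        have "real t \<le> real (602 * (trials k * (2 ^ num_colors k * small ^ 3)) * (\<kappa> * unit_cost cell_bits (op_time N) \<kappa>))"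
          using t by (subst of_nat_le_iff)
        also have "\<dots> \<le> real (602 * 81 * \<kappa> * (81 * Y) * (103 * Y ^ 4) ^ 3 * (312 * Y ^ 5 * \<kappa> + 2 + op_time N)) * 4.32 ^ k"
          by (rule time_le[OF Y])
        also have "\<dots> \<le> real (poly time_factor (n + k)) * 4.32 ^ k"
          by (rule mult_right_mono) (use time in \<open>subst of_nat_le_iff\<close>, simp_all)
        finally have "real t \<le> real (poly time_factor (n + k)) * 4.32 ^ k" .
        moreover have "m \<le> poly space_bound (n + k)"
          using m space_le[OF Y, of "elem_bits N"] space by linarith
        moreover have "run op_time elem_bits kmmd_program n k C \<omega> t m s'"
          using ex by (simp add: run_def N_def)
        ultimately show ?thesis using acc by blast
      qed
      have "answers_correctly op_time elem_bits kmmd_program n k C =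
          {\<omega>. (\<exists>r<trials k. hit (sdrop (r * block) \<omega>)) \<longleftrightarrow> has_multilinear_monomial k (circuit_poly C)}"
      proof (rule set_eqI)
        fix \<omega>
        obtain t m s' where r: "run op_time elem_bits kmmd_program n k C \<omega> t m s'"
          and acc: "accepting s' \<longleftrightarrow> (\<exists>r<trials k. hit (sdrop (r * block) \<omega>))"
          using run[of \<omega>] by blast
        \<comment> \<open>Determinism: the existential quantifier over runs in
          \<open>answers_correctly\<close> concerns the one run found above, so the event is exactly
          the one whose probability has been estimated.\<close>
        have "s'' = s'" if "run op_time elem_bits kmmd_program n k C \<omega> t' m' s''" for t' m' s''
          using exec_deterministic[OF that[unfolded run_def] r[unfolded run_def]] by blast
        then show "\<omega> \<in> answers_correctly op_time elem_bits kmmd_program n k C \<longleftrightarrow>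
          \<omega> \<in> {\<omega>. (\<exists>r<trials k. hit (sdrop (r * block) \<omega>)) \<longleftrightarrow> has_multilinear_monomial k (circuit_poly C)}"
          unfolding answers_correctly_def mem_Collect_eq acc[symmetric] using r by blast
      qed
      then show ?thesis using success_probability run by (simp only:) blast
    qed
    show ?case
      by (intro exI[of _ time_factor] exI[of _ space_bound] allI impI main) simp_all
  qed
qed

end
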